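(* Let $\sigma\in\mathfrak{S}_n$ and $1\le k_1<k_2<\dots<k_m<n$, and let $\zeta=\zeta(\sigma,k_1,\dots,k_m)$ be the element of maximal length of the coset $\sigma(\mathfrak{S}_{k_1}\times\mathfrak{S}_{k_2-k_1}\times\mathfrak{S}_{k_3-k_2}\times\dots\times\mathfrak{S}_{n-k_m})$. Then $$K_\omega\,\hat\pi_{\omega\zeta}\,\pi_{\zeta^{-1}\sigma}=\mathfrak{E}_{\sigma,(k_1,\dots,k_m)},\qquad \mathfrak{E}_{\sigma,(k_1,\dots,k_m)}:=\sum_{w}(-1)^{|w|}K_{\sigma w},$$ where the sum is over the subwords $w$ of the list $\mathcal{W}_{(k_1,\dots,k_m)}$ that correspond to valid chains of the Bruhat order starting at $\sigma$. Moreover, the sum is cancellation free, the coefficients are $\pm1$, and the summing set is closed by interval (that is, if $K_\mu$ appears in the sum and $\sigma\le\nu\le\mu$ in the Bruhat order, then $K_\nu$ appears in the sum).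
   Context: Permutations are in one-line notation; $(\sigma\tau)(i)=\sigma(\tau(i))$; $s_i=(i,i+1)$; $\ell$ is Coxeter length; $\omega=[n,n-1,\dots,1]$; $\le$ is the (strong) Bruhat order. Consider the free $\mathbb{Z}$-module with basis of formal symbols $(K_\sigma)_{\sigma\in\mathfrak{S}_n}$. For $1\le i<n$ define right operators by $K_\sigma\pi_i=K_{\sigma s_i}$ if $\sigma(i)>\sigma(i+1)$ and $K_\sigma\pi_i=K_\sigma$ otherwise, and $\hat\pi_i=\pi_i-1$. Both families satisfy the braid relations, so for a reduced decomposition $\mu=s_{i_1}\cdots s_{i_r}$ one sets $\pi_\mu=\pi_{i_1}\cdots\pi_{i_r}$ and $\hat\pi_\mu=\hat\pi_{i_1}\cdots\hat\pi_{i_r}$ (applied from left to right). With $k_0=0$, $\zeta$ is obtained from $\sigma$ by sorting decreasingly the values within each of the position blocks $\{k_{i-1}+1,\dots,k_i\}$ ($1\le i\le m$) and $\{k_m+1,\dots,n\}$. For $1\le i\le m$, $\mathcal{W}_i$ is the list of transpositions $$((k_{i-1}+1,n),(k_{i-1}+1,n-1),\dots,(k_{i-1}+1,k_i+1),\ (k_{i-1}+2,n),\dots,(k_{i-1}+2,k_i+1),\ \dots,\ (k_i,n),(k_i,n-1),\dots,(k_i,k_i+1)),$$ and $\mathcal{W}_{(k_1,\dots,k_m)}:=(\mathcal{W}_m,\mathcal{W}_{m-1},\dots,\mathcal{W}_1)$ is the concatenation. A subword $w=t_1t_2\cdots t_r$ of this list (terms kept in the list order) is a valid chain starting at $\sigma$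 if $\ell(\sigma t_1\cdots t_j)=\ell(\sigma)+j$ for all $1\le j\le r$; $|w|=r$ and $\sigma w=\sigma t_1\cdots t_r$. "Cancellation free" means that no two terms of the sum cancel; together with the coefficients being $\pm1$, each permutation occurring is obtained from exactly one chain. *)

theory Defs
  imports
    "HOL-Combinatorics.Permutations"
    "HOL-Library.Poly_Mapping"
    "HOL-Library.Sublist"
begin

text \<open>
  An element of the symmetric group on \<open>n\<close> letters is a function \<open>\<sigma> :: nat \<Rightarrow> nat\<close> with
  \<open>\<sigma> permutes {1..n}\<close>; the product \<open>\<sigma> \<tau>\<close> is \<open>\<sigma> \<circ> \<tau>\<close>, so right multiplication by the
  transposition \<open>(a, b)\<close> exchanges the entries in positions \<open>a\<close> and \<open>b\<close> of the one-line notation.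
\<close>

definition longest_perm :: "nat \<Rightarrow> nat \<Rightarrow> nat" where
  "longest_perm n = (\<lambda>i. if i \<in> {1..n} then n + 1 - i else i)"

definition transp_prod :: "(nat \<times> nat) list \<Rightarrow> nat \<Rightarrow> nat" where
  "transp_prod w = foldr (\<lambda>(a, b) \<tau>. transpose a b \<circ> \<tau>) w id"

definition simple_prod :: "nat list \<Rightarrow> nat \<Rightarrow> nat" where
  "simple_prod w = transp_prod (map (\<lambda>i. (i, i + 1)) w)"

definition coxeter_length :: "nat \<Rightarrow> (nat \<Rightarrow> nat) \<Rightarrow> nat" where
  "coxeter_length n \<mu> = (LEAST r. \<exists>w. set w \<subseteq> {1..<n} \<and> simple_prod w = \<mu> \<and> length w = r)"

definition reduced_word :: "nat \<Rightarrow> (nat \<Rightarrow> nat) \<Rightarrow> nat list \<Rightarrow> bool" where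
  "reduced_word n \<mu> w \<longleftrightarrow>
     set w \<subseteq> {1..<n} \<and> simple_prod w = \<mu> \<and> length w = coxeter_length n \<mu>"

lemma simple_prod_append: "simple_prod (u @ v) = simple_prod u \<circ> simple_prod v"
  by (induction u) (auto simp: simple_prod_def transp_prod_def comp_assoc)

lemma transpose_eq_simple_prod:
  assumes "1 \<le> a" "a < b" "b \<le> n"
  shows "\<exists>w. set w \<subseteq> {1..<n} \<and> simple_prod w = transpose a b"
  using assms(2,3)
proof (induction b rule: less_induct)
  case (less b)
  show ?case
  proof (cases "b = a + 1")
    case True
    then show ?thesis using less.prems assms(1)
      by (intro exI[of _ "[a]"]) (auto simp: simple_prod_def transp_prod_def)
  next
    case False
    then have b: "a < b - 1" "b - 1 < b" "b - 1 \<le> n" using less.prems by auto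
    then obtain w where w: "set w \<subseteq> {1..<n}" "simple_prod w = transpose a (b - 1)"
      using less.IH by blast
    have s: "simple_prod [b - 1] = transpose b (b - 1)"
      using b by (simp add: simple_prod_def transp_prod_def transpose_commute)
    have "simple_prod ([b - 1] @ w @ [b - 1]) = transpose b (b - 1) \<circ> transpose (b - 1) a \<circ> transpose b (b - 1)"
      unfolding simple_prod_append w(2) s by (simp add: comp_assoc transpose_commute)
    also have "\<dots> = transpose a b"
      using b less.prems by (subst transpose_comp_triple) (auto simp: transpose_commute)
    finally show ?thesis using w(1) b less.prems
      by (intro exI[of _ "[b - 1] @ w @ [b - 1]"]) auto
  qed
qed

lemma reduced_word_exists:
  assumes "\<mu> permutes {1..n}"
  shows "\<exists>w. reduced_word n \<mu> w"
proof -
  have "\<exists>w. set w \<subseteq> {1..<n} \<and> simple_prod w = \<mu>"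
    using assms finite_atLeastAtMost
  proof (induction rule: permutes_induct)
    case id
    show ?case by (intro exI[of _ "[]"]) (auto simp: simple_prod_def transp_prod_def)
  next
    case (swap a b p)
    then obtain v where v: "set v \<subseteq> {1..<n}" "simple_prod v = p" by blast
    have "\<exists>w. set w \<subseteq> {1..<n} \<and> simple_prod w = transpose a b"
      using swap.hyps transpose_eq_simple_prod[of a b n] transpose_eq_simple_prod[of b a n]
      by (cases a b rule: linorder_cases) (auto simp: transpose_commute)
    then obtain w where "set w \<subseteq> {1..<n}" "simple_prod w = transpose a b" by blast
    with v show ?case by (intro exI[of _ "w @ v"]) (auto simp: simple_prod_append)
  qed
  then show ?thesis
    unfolding reduced_word_def coxeter_length_def
    by (smt (verit, best) LeastI)
qed

definition bruhat_step :: "nat \<Rightarrow> (nat \<Rightarrow> nat) \<Rightarrow> (nat \<Rightarrow> nat) \<Rightarrow> bool" where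
  "bruhat_step n \<mu> \<nu> \<longleftrightarrow>
     (\<exists>a b. 1 \<le> a \<and> a < b \<and> b \<le> n \<and> \<nu> = \<mu> \<circ> transpose a b \<and>
            coxeter_length n \<mu> < coxeter_length n \<nu>)"

definition bruhat_le :: "nat \<Rightarrow> (nat \<Rightarrow> nat) \<Rightarrow> (nat \<Rightarrow> nat) \<Rightarrow> bool" where
  "bruhat_le n = (bruhat_step n)\<^sup>*\<^sup>*"

text \<open>
  The basis vector \<open>K\<^sub>\<sigma>\<close> is \<open>frag_of \<sigma>\<close>. The type \<open>(nat \<Rightarrow> nat) \<Rightarrow>\<^sub>0 int\<close> is the free module on all
  functions; the operators with index \<open>1 \<le> i < n\<close> preserve the span of the permutations of \<open>{1..n}\<close>.
\<close>

definition pi_op :: "nat \<Rightarrow> ((nat \<Rightarrow> nat) \<Rightarrow>\<^sub>0 int) \<Rightarrow> ((nat \<Rightarrow> nat) \<Rightarrow>\<^sub>0 int)" where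
  "pi_op i = frag_extend
     (\<lambda>\<sigma>. if \<sigma> i > \<sigma> (i + 1) then frag_of (\<sigma> \<circ> transpose i (i + 1)) else frag_of \<sigma>)"

definition pi_hat_op :: "nat \<Rightarrow> ((nat \<Rightarrow> nat) \<Rightarrow>\<^sub>0 int) \<Rightarrow> ((nat \<Rightarrow> nat) \<Rightarrow>\<^sub>0 int)" where
  "pi_hat_op i x = pi_op i x - x"

text \<open>The operators act on the right: the first letter of the word is applied first.\<close>

definition pi_word :: "nat list \<Rightarrow> ((nat \<Rightarrow> nat) \<Rightarrow>\<^sub>0 int) \<Rightarrow> ((nat \<Rightarrow> nat) \<Rightarrow>\<^sub>0 int)" where
  "pi_word w x = fold pi_op w x"

definition pi_hat_word :: "nat list \<Rightarrow> ((nat \<Rightarrow> nat) \<Rightarrow>\<^sub>0 int) \<Rightarrow> ((nat \<Rightarrow> nat) \<Rightarrow>\<^sub>0 int)" where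
  "pi_hat_word w x = fold pi_hat_op w x"

text \<open>
  The list \<open>ks\<close> stands for \<open>(k\<^sub>1, \<dots>, k\<^sub>m)\<close>, with \<open>m = length ks\<close>. Adding \<open>k\<^sub>0 = 0\<close> and
  \<open>k\<^sub>m\<^sub>+\<^sub>1 = n\<close> makes \<open>cuts n ks ! i = k\<^sub>i\<close> for \<open>0 \<le> i \<le> m + 1\<close>.
\<close>

definition cuts :: "nat \<Rightarrow> nat list \<Rightarrow> nat list" where
  "cuts n ks = 0 # ks @ [n]"

definition young_subgroup :: "nat \<Rightarrow> nat list \<Rightarrow> (nat \<Rightarrow> nat) set" where
  "young_subgroup n ks =
     {\<tau>. \<tau> permutes {1..n} \<and>
         (\<forall>i \<le> length ks. \<tau> ` {cuts n ks ! i + 1..cuts n ks ! (i + 1)}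
                              = {cuts n ks ! i + 1..cuts n ks ! (i + 1)})}"

definition zeta :: "nat \<Rightarrow> (nat \<Rightarrow> nat) \<Rightarrow> nat list \<Rightarrow> nat \<Rightarrow> nat" where
  "zeta n \<sigma> ks =
     (ARG_MAX (coxeter_length n) \<mu>. \<mu> \<in> (\<lambda>\<tau>. \<sigma> \<circ> \<tau>) ` young_subgroup n ks)"

definition W_block :: "nat \<Rightarrow> nat list \<Rightarrow> nat \<Rightarrow> (nat \<times> nat) list" where
  "W_block n ks i =
     concat (map (\<lambda>a. map (\<lambda>b. (a, b)) (rev [cuts n ks ! i + 1..<n + 1]))
                 [cuts n ks ! (i - 1) + 1..<cuts n ks ! i + 1])"

definition W_list :: "nat \<Rightarrow> nat list \<Rightarrow> (nat \<times> nat) list" where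
  "W_list n ks = concat (map (W_block n ks) (rev [1..<length ks + 1]))"

definition valid_chain :: "nat \<Rightarrow> (nat \<Rightarrow> nat) \<Rightarrow> (nat \<times> nat) list \<Rightarrow> bool" where
  "valid_chain n \<sigma> w \<longleftrightarrow>
     (\<forall>j \<in> {1..length w}.
        coxeter_length n (\<sigma> \<circ> transp_prod (take j w)) = coxeter_length n \<sigma> + j)"

text \<open>The entries of \<open>W_list n ks\<close> are pairwise distinct, so a subword is determined by its letters.\<close>

definition valid_chains :: "nat \<Rightarrow> (nat \<Rightarrow> nat) \<Rightarrow> nat list \<Rightarrow> (nat \<times> nat) list set" where
  "valid_chains n \<sigma> ks = {w. subseq w (W_list n ks) \<and> valid_chain n \<sigma> w}"

definition chain_term :: "(nat \<Rightarrow> nat) \<Rightarrow> (nat \<times> nat) list \<Rightarrow> ((nat \<Rightarrow> nat) \<Rightarrow>\<^sub>0 int)" where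
  "chain_term \<sigma> w = frag_cmul ((-1) ^ length w) (frag_of (\<sigma> \<circ> transp_prod w))"

definition E_sum :: "nat \<Rightarrow> (nat \<Rightarrow> nat) \<Rightarrow> nat list \<Rightarrow> ((nat \<Rightarrow> nat) \<Rightarrow>\<^sub>0 int)" where
  "E_sum n \<sigma> ks = (\<Sum>w \<in> valid_chains n \<sigma> ks. chain_term \<sigma> w)"

end

theory Submission
  imports Defs
begin

text \<open>
  Let \<open>D\<^bsub>ab\<^esub>\<close> send \<open>K\<^sub>\<sigma>\<close> to \<open>K\<^sub>\<sigma> - K\<^bsub>\<sigma>(a,b)\<^esub>\<close> if \<open>\<sigma>(a,b)\<close> covers \<open>\<sigma>\<close>, and fix \<open>K\<^sub>\<sigma>\<close> otherwise. Applying these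
  operators in the order of the list \<open>W\<close> to \<open>K\<^sub>\<sigma>\<close> gives the signed sum over the chains. They satisfy a
  Yang--Baxter equation, and suitable adjacent pairs commute with \<open>\<pi>\<^sub>i\<close>; hence the product over \<open>W\<close>
  commutes with \<open>\<pi>\<^sub>i\<close> for every \<open>i\<close> that is not a cut, while the product over all transpositions
  intertwines \<open>\<pi>\<^sub>i - 1\<close> with right multiplication by \<open>s\<^sub>i\<close> at descents. By Yang--Baxter moves the latter
  product is equal to the former preceded by transpositions within the blocks, and these fix \<open>K\<^sub>\<zeta>\<close>.

  For the coefficients, the lifting property of the Bruhat order shows that \<open>\<mu>\<close> occurs if and only if \<open>\<sigma>\<close> is
  the largest element of its coset below \<open>\<mu>\<close>, with sign \<open>(-1)\<close> to the power \<open>\<ell>(\<mu>) - \<ell>(\<sigma>)\<close>. This set is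
  closed by interval, and as all chains from \<open>\<sigma>\<close> to \<open>\<mu>\<close> have the same sign, there is only one.
\<close>

section \<open>Cover operators\<close>

text \<open>A reduced word of \<omega>\<zeta> may use every letter, while the product over the list
  W is only seen to commute with \<pi>_i away from the cuts. This is why the product over all
  transpositions enters: it treats all letters alike, and it is exchanged for the product over W
  only at \<zeta>, which decreases within the blocks. The remaining word, of \<zeta>^{-1}\<sigma>,
  lies in the Young subgroup and avoids the cuts. The list of labels gives no direct hold on whether
  two chains end at the same permutation. The coefficients are therefore read off from the operator
  side: up to a sign determined by lengths, each operator turns the indicator function of a set of
  permutations into another one, and the equality with the chain sum transfers the result. The order
  of a list is the order of application: the leftmost label acts first.\<close>

text \<open>The Yang--Baxter equation fails for functions with repeated values; the guard \<open>inj \<sigma>\<close> makes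
  the operator identities hold on the whole free module.\<close>

definition cover :: "(nat \<Rightarrow> nat) \<Rightarrow> nat \<Rightarrow> nat \<Rightarrow> bool" where
  "cover \<sigma> a b \<longleftrightarrow> inj \<sigma> \<and> \<sigma> a < \<sigma> b \<and> (\<forall>c\<in>{a<..<b}. \<not> (\<sigma> a < \<sigma> c \<and> \<sigma> c < \<sigma> b))"

definition cover_op :: "nat \<times> nat \<Rightarrow> ((nat \<Rightarrow> nat) \<Rightarrow>\<^sub>0 int) \<Rightarrow> ((nat \<Rightarrow> nat) \<Rightarrow>\<^sub>0 int)" where
  "cover_op p = frag_extend (\<lambda>\<sigma>. if cover \<sigma> (fst p) (snd p)
     then frag_of \<sigma> - frag_of (\<sigma> \<circ> transpose (fst p) (snd p)) else frag_of \<sigma>)"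

abbreviation cover_ops where "cover_ops \<equiv> fold cover_op"

lemma cover_op_of:
  "cover_op (a, b) (frag_of \<sigma>) =
     (if cover \<sigma> a b then frag_of \<sigma> - frag_of (\<sigma> \<circ> transpose a b) else frag_of \<sigma>)"
  by (simp add: cover_op_def)

lemma cover_op_diff: "cover_op p (x - y) = cover_op p x - cover_op p y"
  by (simp add: cover_op_def frag_extend_diff)

lemma pi_op_of:
  "pi_op i (frag_of \<sigma>) = (if \<sigma> i > \<sigma> (i + 1) then frag_of (\<sigma> \<circ> transpose i (i + 1)) else frag_of \<sigma>)"
  by (simp add: pi_op_def)

lemma pi_op_diff: "pi_op i (x - y) = pi_op i x - pi_op i y"
  by (simp add: pi_op_def frag_extend_diff)

lemma cover_ops_diff: "cover_ops w (x - y) = cover_ops w x - cover_ops w y"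
  by (induction w arbitrary: x y) (auto simp: cover_op_diff)

text \<open>Compatibility with subtraction already yields f 0 = 0, and the basis vectors generate
  everything under subtraction. Comparing only on the keys of \<open>x\<close> permits identities
  valid on part of the basis, such as the permutations with a prescribed decreasing stretch.\<close>

lemma additive_ext:
  fixes f g :: "('a \<Rightarrow>\<^sub>0 int) \<Rightarrow> 'b::ab_group_add"
  assumes "\<And>x y. f (x - y) = f x - f y" and "\<And>x y. g (x - y) = g x - g y"
    and "\<And>\<sigma>. \<sigma> \<in> Poly_Mapping.keys x \<Longrightarrow> f (frag_of \<sigma>) = g (frag_of \<sigma>)"
  shows "f x = g x"
proof -
  have z: "f 0 = 0" "g 0 = 0" using assms(1)[of 0 0] assms(2)[of 0 0] by simp_all
  have "Poly_Mapping.keys x \<subseteq> Poly_Mapping.keys x" by simp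
  then show ?thesis
    by (induction x rule: frag_induction) (use assms z in auto)
qed

lemma inj_comp_transpose_iff: "inj (\<sigma> \<circ> transpose a b) \<longleftrightarrow> inj \<sigma>"
proof
  assume "inj (\<sigma> \<circ> transpose a b)"
  then have "inj ((\<sigma> \<circ> transpose a b) \<circ> transpose a b)"
    by (rule inj_compose) auto
  also have "(\<sigma> \<circ> transpose a b) \<circ> transpose a b = \<sigma>"
    by (simp add: fun_eq_iff)
  finally show "inj \<sigma>" .
qed (auto intro: inj_compose)

lemma cover_op_not_inj: "\<not> inj \<sigma> \<Longrightarrow> cover_op p (frag_of \<sigma>) = frag_of \<sigma>"
  by (simp add: cover_op_def cover_def)

text \<open>Non-injective basis vectors stay non-injective under \<pi>_i, and every cover operator
  fixes them; on this part of the module the commutation relations are therefore trivial.\<close>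

lemma pi_op_not_inj:
  "\<not> inj \<sigma> \<Longrightarrow> \<exists>\<tau>. \<not> inj \<tau> \<and> pi_op i (frag_of \<sigma>) = frag_of \<tau>"
  unfolding pi_op_of using inj_comp_transpose_iff by metis

section \<open>Relations among the operators on three positions a < c < b\<close>

context
  fixes \<sigma> :: "nat \<Rightarrow> nat" and a b c :: nat
  assumes inj: "inj \<sigma>" and ac: "a < c" and cb: "c < b"
begin

text \<open>Only the entries in positions a, c, b ever move, so the identities reduce to a check
  over the six arrangements of three values; \<open>free1\<close> and \<open>free2\<close> record
  what the fixed entries between these positions contribute to the cover conditions.\<close>

definition "upd3 X Y Z = \<sigma>(a := X, c := Y, b := Z)"
definition "free1 u v = (\<forall>e\<in>{a<..<c}. \<not> (u < \<sigma> e \<and> \<sigma> e < v))"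
definition "free2 u v = (\<forall>e\<in>{c<..<b}. \<not> (u < \<sigma> e \<and> \<sigma> e < v))"

lemma upd3_id: "upd3 (\<sigma> a) (\<sigma> c) (\<sigma> b) = \<sigma>"
  by (auto simp: upd3_def)

lemma upd3_swap:
  "upd3 X Y Z \<circ> transpose a c = upd3 Y X Z"
  "upd3 X Y Z \<circ> transpose a b = upd3 Z Y X"
  "upd3 X Y Z \<circ> transpose c b = upd3 X Z Y"
  using ac cb by (auto simp: upd3_def transpose_def fun_eq_iff)

lemma cover_upd3:
  assumes "inj (upd3 X Y Z)"
  shows "cover (upd3 X Y Z) a c \<longleftrightarrow> X < Y \<and> free1 X Y"
    "cover (upd3 X Y Z) c b \<longleftrightarrow> Y < Z \<and> free2 Y Z"
    "cover (upd3 X Y Z) a b \<longleftrightarrow> X < Z \<and> \<not> (X < Y \<and> Y < Z) \<and> free1 X Z \<and> free2 X Z"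
proof -
  have *: "{a<..<b} = {a<..<c} \<union> {c} \<union> {c<..<b}" using ac cb by auto
  show "cover (upd3 X Y Z) a c \<longleftrightarrow> X < Y \<and> free1 X Y"
    "cover (upd3 X Y Z) c b \<longleftrightarrow> Y < Z \<and> free2 Y Z"
    "cover (upd3 X Y Z) a b \<longleftrightarrow> X < Z \<and> \<not> (X < Y \<and> Y < Z) \<and> free1 X Z \<and> free2 X Z"
    using assms ac cb unfolding cover_def free1_def free2_def * ball_Un
    by (auto simp: upd3_def)
qed

lemma inj_upd3:
  defines "x \<equiv> \<sigma> a" and "y \<equiv> \<sigma> c" and "z \<equiv> \<sigma> b"
  shows "inj (upd3 x y z)" "inj (upd3 x z y)" "inj (upd3 y x z)"
    "inj (upd3 y z x)" "inj (upd3 z x y)" "inj (upd3 z y x)"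
proof -
  show 1: "inj (upd3 x y z)" unfolding x_def y_def z_def upd3_id by (rule inj)
  then show 2: "inj (upd3 x z y)" "inj (upd3 y x z)"
    by (metis upd3_swap inj_comp_transpose_iff)+
  then show "inj (upd3 y z x)" "inj (upd3 z x y)" "inj (upd3 z y x)"
    by (metis upd3_swap inj_comp_transpose_iff)+
qed

text \<open>By injectivity no entry strictly between the three positions takes the value v, so a
  value interval around v is free exactly if both of its halves are. This links the cover conditions
  met along the two sides of the relations.\<close>

lemma free_split:
  assumes "v \<in> {\<sigma> a, \<sigma> b, \<sigma> c}" "u < v" "v < w"
  shows "free1 u w \<longleftrightarrow> free1 u v \<and> free1 v w" "free2 u w \<longleftrightarrow> free2 u v \<and> free2 v w"
proof -
  have "\<sigma> e \<noteq> v" if "e \<in> {a<..<c} \<union> {c<..<b}" for e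
    using assms(1) that ac cb injD[OF inj, of e] by auto
  then show "free1 u w \<longleftrightarrow> free1 u v \<and> free1 v w" "free2 u w \<longleftrightarrow> free2 u v \<and> free2 v w"
    using assms(2,3) unfolding free1_def free2_def
    by (meson UnCI linorder_neqE_nat less_trans)+
qed

lemma cover_op_upd3:
  assumes "inj (upd3 X Y Z)"
  shows "cover_op (a, c) (frag_of (upd3 X Y Z)) =
      (if X < Y \<and> free1 X Y then frag_of (upd3 X Y Z) - frag_of (upd3 Y X Z) else frag_of (upd3 X Y Z))"
    "cover_op (c, b) (frag_of (upd3 X Y Z)) =
      (if Y < Z \<and> free2 Y Z then frag_of (upd3 X Y Z) - frag_of (upd3 X Z Y) else frag_of (upd3 X Y Z))"
    "cover_op (a, b) (frag_of (upd3 X Y Z)) =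
      (if X < Z \<and> \<not> (X < Y \<and> Y < Z) \<and> free1 X Z \<and> free2 X Z
       then frag_of (upd3 X Y Z) - frag_of (upd3 Z Y X) else frag_of (upd3 X Y Z))"
  by (simp_all only: cover_op_of cover_upd3[OF assms] upd3_swap)

lemma pi_op_upd3:
  "b = c + 1 \<Longrightarrow> pi_op c (frag_of (upd3 X Y Z)) =
     (if Y > Z then frag_of (upd3 X Z Y) else frag_of (upd3 X Y Z))"
  "c = a + 1 \<Longrightarrow> pi_op a (frag_of (upd3 X Y Z)) =
     (if X > Y then frag_of (upd3 Y X Z) else frag_of (upd3 X Y Z))"
proof -
  show "pi_op c (frag_of (upd3 X Y Z)) =
     (if Y > Z then frag_of (upd3 X Z Y) else frag_of (upd3 X Y Z))" if "b = c + 1"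
    using ac cb by (simp only: pi_op_of upd3_swap flip: that) (simp add: upd3_def)
  show "pi_op a (frag_of (upd3 X Y Z)) =
     (if X > Y then frag_of (upd3 Y X Z) else frag_of (upd3 X Y Z))" if "c = a + 1"
    using ac cb by (simp only: pi_op_of upd3_swap flip: that) (simp add: upd3_def)
qed

lemma values_distinct: "\<sigma> a \<noteq> \<sigma> b" "\<sigma> a \<noteq> \<sigma> c" "\<sigma> b \<noteq> \<sigma> c"
  using ac cb injD[OF inj] by (metis less_irrefl less_trans)+

lemma ybe_inj:
  "cover_op (a, c) (cover_op (a, b) (cover_op (c, b) (frag_of \<sigma>))) =
   cover_op (c, b) (cover_op (a, b) (cover_op (a, c) (frag_of \<sigma>)))"
proof -
  define x y z where xyz: "x = \<sigma> a" "y = \<sigma> c" "z = \<sigma> b"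
  note i = inj_upd3[folded xyz] and s = free_split[folded xyz] and d = values_distinct[folded xyz]
  have fr: "frag_of \<sigma> = frag_of (upd3 x y z)" unfolding xyz upd3_id ..
  note simps = cover_op_upd3 i cover_op_diff
  \<comment> \<open>The six relative orders of the three values; in each of them \<open>s\<close> is
    instantiated at the middle, the least and the largest value, in this order.\<close>
  consider "x < y" "y < z" | "x < z" "z < y" | "y < x" "x < z" | "y < z" "z < x" | "z < x" "x < y" | "z < y" "y < x"
    using d by linarith
  then show ?thesis
  proof cases
    case 1
    then show ?thesis unfolding fr using s[of y x z] by (simp add: simps)
  next
    case 2
    then show ?thesis unfolding fr using s[of z x y] by (simp add: simps)
  next
    case 3
    then show ?thesis unfolding fr using s[of x y z] by (simp add: simps)
  next
    case 4
    then show ?thesis unfolding fr using s[of z y x] by (simp add: simps)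
  next
    case 5
    then show ?thesis unfolding fr using s[of x z y] by (simp add: simps)
  next
    case 6
    then show ?thesis unfolding fr using s[of y z x] by (simp add: simps)
  qed
qed

text \<open>The single factors do not commute with \<pi>_c in general, only the pair does. As c and
  b are adjacent, nothing lies between them and the \<open>free2\<close> conditions hold
  trivially.\<close>

lemma pi_right_inj:
  assumes bc: "b = c + 1"
  shows "pi_op c (cover_op (a, c) (cover_op (a, b) (frag_of \<sigma>))) =
   cover_op (a, c) (cover_op (a, b) (pi_op c (frag_of \<sigma>)))"
proof -
  define x y z where xyz: "x = \<sigma> a" "y = \<sigma> c" "z = \<sigma> b"
  note i = inj_upd3[folded xyz] and s = free_split[folded xyz] and d = values_distinct[folded xyz]
  have fr: "frag_of \<sigma> = frag_of (upd3 x y z)" unfolding xyz upd3_id ..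
  have f2: "free2 u v" for u v unfolding free2_def using bc by auto
  note p = pi_op_upd3(1)[OF bc]
  note simps = cover_op_upd3 i cover_op_diff p f2 pi_op_diff
  consider "x < y" "y < z" | "x < z" "z < y" | "y < x" "x < z" | "y < z" "z < x" | "z < x" "x < y" | "z < y" "y < x"
    using d by linarith
  then show ?thesis
  proof cases
    case 1
    then show ?thesis unfolding fr using s[of y x z] by (simp add: simps)
  next
    case 2
    then show ?thesis unfolding fr using s[of z x y] by (simp add: simps)
  next
    case 3
    then show ?thesis unfolding fr using s[of x y z] by (simp add: simps)
  next
    case 4
    then show ?thesis unfolding fr using s[of z y x] by (simp add: simps)
  next
    case 5
    then show ?thesis unfolding fr using s[of x z y] by (simp add: simps)
  next
    case 6
    then show ?thesis unfolding fr using s[of y z x] by (simp add: simps)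
  qed
qed

text \<open>The mirror image of the preceding relation: the adjacent positions are now the left end
  points, and \<open>free1\<close> is the trivial condition.\<close>

lemma pi_left_inj:
  assumes bc: "c = a + 1"
  shows "pi_op a (cover_op (c, b) (cover_op (a, b) (frag_of \<sigma>))) =
   cover_op (c, b) (cover_op (a, b) (pi_op a (frag_of \<sigma>)))"
proof -
  define x y z where xyz: "x = \<sigma> a" "y = \<sigma> c" "z = \<sigma> b"
  note i = inj_upd3[folded xyz] and s = free_split[folded xyz] and d = values_distinct[folded xyz]
  have fr: "frag_of \<sigma> = frag_of (upd3 x y z)" unfolding xyz upd3_id ..
  have f2: "free1 u v" for u v unfolding free1_def using bc by auto
  note p = pi_op_upd3(2)[OF bc]
  note simps = cover_op_upd3 i cover_op_diff p f2 pi_op_diff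
  consider "x < y" "y < z" | "x < z" "z < y" | "y < x" "x < z" | "y < z" "z < x" | "z < x" "x < y" | "z < y" "y < x"
    using d by linarith
  then show ?thesis
  proof cases
    case 1
    then show ?thesis unfolding fr using s[of y x z] by (simp add: simps)
  next
    case 2
    then show ?thesis unfolding fr using s[of z x y] by (simp add: simps)
  next
    case 3
    then show ?thesis unfolding fr using s[of x y z] by (simp add: simps)
  next
    case 4
    then show ?thesis unfolding fr using s[of z y x] by (simp add: simps)
  next
    case 5
    then show ?thesis unfolding fr using s[of x z y] by (simp add: simps)
  next
    case 6
    then show ?thesis unfolding fr using s[of y z x] by (simp add: simps)
  qed
qed

end

section \<open>Commutation relations of the cover operators\<close>

lemma cover_op_ybe:
  assumes "a < c" "c < b"
  shows "cover_op (a, c) (cover_op (a, b) (cover_op (c, b) x)) =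
    cover_op (c, b) (cover_op (a, b) (cover_op (a, c) x))"
proof (rule additive_ext[where f = "\<lambda>x. cover_op (a, c) (cover_op (a, b) (cover_op (c, b) x))"
      and g = "\<lambda>x. cover_op (c, b) (cover_op (a, b) (cover_op (a, c) x))"])
  fix \<sigma>
  show "cover_op (a, c) (cover_op (a, b) (cover_op (c, b) (frag_of \<sigma>))) =
    cover_op (c, b) (cover_op (a, b) (cover_op (a, c) (frag_of \<sigma>)))"
    using assms by (cases "inj \<sigma>") (auto simp: cover_op_not_inj intro: ybe_inj)
qed (simp_all add: cover_op_diff)

lemma pi_op_cover_op_right:
  assumes "a < i"
  shows "pi_op i (cover_op (a, i) (cover_op (a, i + 1) x)) =
    cover_op (a, i) (cover_op (a, i + 1) (pi_op i x))"
proof (rule additive_ext[where f = "\<lambda>x. pi_op i (cover_op (a, i) (cover_op (a, i + 1) x))"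
      and g = "\<lambda>x. cover_op (a, i) (cover_op (a, i + 1) (pi_op i x))"])
  fix \<sigma>
  show "pi_op i (cover_op (a, i) (cover_op (a, i + 1) (frag_of \<sigma>))) =
    cover_op (a, i) (cover_op (a, i + 1) (pi_op i (frag_of \<sigma>)))"
  proof (cases "inj \<sigma>")
    case True
    then show ?thesis using assms by (intro pi_right_inj) auto
  next
    case False
    then show ?thesis using pi_op_not_inj[OF False, of i] by (auto simp: cover_op_not_inj)
  qed
qed (simp_all add: cover_op_diff pi_op_diff)

lemma pi_op_cover_op_left:
  assumes "i + 1 < b"
  shows "pi_op i (cover_op (i + 1, b) (cover_op (i, b) x)) =
    cover_op (i + 1, b) (cover_op (i, b) (pi_op i x))"
proof (rule additive_ext[where f = "\<lambda>x. pi_op i (cover_op (i + 1, b) (cover_op (i, b) x))"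
      and g = "\<lambda>x. cover_op (i + 1, b) (cover_op (i, b) (pi_op i x))"])
  fix \<sigma>
  show "pi_op i (cover_op (i + 1, b) (cover_op (i, b) (frag_of \<sigma>))) =
    cover_op (i + 1, b) (cover_op (i, b) (pi_op i (frag_of \<sigma>)))"
  proof (cases "inj \<sigma>")
    case True
    then show ?thesis using assms by (intro pi_left_inj) auto
  next
    case False
    then show ?thesis using pi_op_not_inj[OF False, of i] by (auto simp: cover_op_not_inj)
  qed
qed (simp_all add: cover_op_diff pi_op_diff)

lemma transpose_commute_disjoint:
  assumes "{a, b} \<inter> {c, d} = {}"
  shows "transpose a b \<circ> transpose c d = transpose c d \<circ> transpose a b"
  using assms by (auto simp: transpose_def fun_eq_iff)

text \<open>Exchanging the entries of one pair can affect the cover condition of the other only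
  through a position of the first lying between those of the second. \<open>A\<close> lists what the
  two given covers exclude in these configurations, \<open>B\<close> what is required after the
  order is reversed.\<close>

lemma cover_commute:
  assumes disj: "{a, b} \<inter> {c, d} = {}" and "a < b" "c < d"
    and 1: "cover \<sigma> a b" and 2: "cover (\<sigma> \<circ> transpose a b) c d"
  shows "cover \<sigma> c d \<and> cover (\<sigma> \<circ> transpose c d) a b"
proof -
  have inj: "inj \<sigma>" using 1 by (simp add: cover_def)
  have ne: "\<sigma> a \<noteq> \<sigma> c" "\<sigma> a \<noteq> \<sigma> d" "\<sigma> b \<noteq> \<sigma> c" "\<sigma> b \<noteq> \<sigma> d"
    using disj inj by (auto dest: injD)
  have lt: "\<sigma> a < \<sigma> b" "\<sigma> c < \<sigma> d"
    using 1 2 disj by (auto simp: cover_def transpose_def)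
  have ab: "\<not> (\<sigma> a < \<sigma> e \<and> \<sigma> e < \<sigma> b)" if "a < e" "e < b" for e
    using 1 that by (auto simp: cover_def)
  have cd: "\<not> (\<sigma> c < \<sigma> (transpose a b e) \<and> \<sigma> (transpose a b e) < \<sigma> d)" if "c < e" "e < d" for e
    using 2 that disj unfolding cover_def by (auto simp: transpose_def split: if_splits)
  have neq: "a \<noteq> c" "a \<noteq> d" "b \<noteq> c" "b \<noteq> d" using disj by auto
  have A: "a < c \<and> c < b \<longrightarrow> \<not> (\<sigma> a < \<sigma> c \<and> \<sigma> c < \<sigma> b)"
    "a < d \<and> d < b \<longrightarrow> \<not> (\<sigma> a < \<sigma> d \<and> \<sigma> d < \<sigma> b)"
    "c < a \<and> a < d \<longrightarrow> \<not> (\<sigma> c < \<sigma> b \<and> \<sigma> b < \<sigma> d)"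
    "c < b \<and> b < d \<longrightarrow> \<not> (\<sigma> c < \<sigma> a \<and> \<sigma> a < \<sigma> d)"
    using ab[of c] ab[of d] cd[of a] cd[of b] by auto
  \<comment> \<open>For the first: if c < a < d and \<sigma> a lies between \<sigma> c and \<sigma>
    d, the third fact of \<open>A\<close> forces \<sigma> d < \<sigma> b; then b < d contradicts the
    fourth fact and d < b the second. The others are alike.\<close>
  have B: "c < a \<and> a < d \<longrightarrow> \<not> (\<sigma> c < \<sigma> a \<and> \<sigma> a < \<sigma> d)"
    "c < b \<and> b < d \<longrightarrow> \<not> (\<sigma> c < \<sigma> b \<and> \<sigma> b < \<sigma> d)"
    "a < c \<and> c < b \<longrightarrow> \<not> (\<sigma> a < \<sigma> d \<and> \<sigma> d < \<sigma> b)"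
    "a < d \<and> d < b \<longrightarrow> \<not> (\<sigma> a < \<sigma> c \<and> \<sigma> c < \<sigma> b)"
    using A lt ne assms(2,3) neq by (smt (verit) less_trans linorder_neqE_nat)+
  have "\<not> (\<sigma> c < \<sigma> e \<and> \<sigma> e < \<sigma> d)" if "c < e" "e < d" for e
    using B(1,2) cd[of e] that by (cases "e = a \<or> e = b") auto
  moreover have "\<not> (\<sigma> a < \<sigma> (transpose c d e) \<and> \<sigma> (transpose c d e) < \<sigma> b)" if "a < e" "e < b" for e
    using B(3,4) ab[of e] that by (cases "e = c \<or> e = d") auto
  moreover have "transpose c d a = a" "transpose c d b = b" using disj by auto
  ultimately show ?thesis using lt inj by (simp add: cover_def inj_comp_transpose_iff)
qed

lemma cover_op_commute:
  assumes "{a, b} \<inter> {c, d} = {}" "a < b" "c < d"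
  shows "cover_op (a, b) (cover_op (c, d) x) = cover_op (c, d) (cover_op (a, b) x)"
proof (rule additive_ext[where f = "\<lambda>x. cover_op (a, b) (cover_op (c, d) x)"
      and g = "\<lambda>x. cover_op (c, d) (cover_op (a, b) x)"])
  fix \<sigma>
  have "cover \<sigma> a b \<and> cover (\<sigma> \<circ> transpose a b) c d \<longleftrightarrow> cover \<sigma> c d \<and> cover (\<sigma> \<circ> transpose c d) a b"
    using cover_commute[of a b c d \<sigma>] cover_commute[of c d a b \<sigma>] assms by auto
  moreover have "\<sigma> \<circ> transpose a b \<circ> transpose c d = \<sigma> \<circ> transpose c d \<circ> transpose a b"
    using transpose_commute_disjoint[OF assms(1)] by (simp add: comp_assoc)
  ultimately show "cover_op (a, b) (cover_op (c, d) (frag_of \<sigma>)) = cover_op (c, d) (cover_op (a, b) (frag_of \<sigma>))"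
    by (auto simp: cover_op_of cover_op_diff)
qed (simp_all add: cover_op_diff)

text \<open>An open interval whose end points avoid i and i + 1 contains both of them or neither, so
  exchanging their entries leaves the set of values inside it unchanged.\<close>

lemma cover_comp_adjacent:
  assumes "{a, b} \<inter> {i, i + 1} = {}" "a < b"
  shows "cover (\<sigma> \<circ> transpose i (i + 1)) a b \<longleftrightarrow> cover \<sigma> a b"
proof -
  have mem: "transpose i (i + 1) e \<in> {a<..<b} \<longleftrightarrow> e \<in> {a<..<b}" for e
    using assms by (auto simp: transpose_def)
  define P where "P e \<longleftrightarrow> \<not> (\<sigma> a < \<sigma> e \<and> \<sigma> e < \<sigma> b)" for e
  have "(\<forall>e\<in>{a<..<b}. P (transpose i (i + 1) e)) \<longleftrightarrow> (\<forall>e\<in>{a<..<b}. P e)"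
    using mem transpose_involutory[of i "i + 1"] by metis
  moreover have "transpose i (i + 1) a = a" "transpose i (i + 1) b = b" using assms by auto
  ultimately show ?thesis
    by (simp add: cover_def inj_comp_transpose_iff P_def)
qed

lemma pi_op_cover_op_disjoint:
  assumes "{a, b} \<inter> {i, i + 1} = {}" "a < b"
  shows "pi_op i (cover_op (a, b) x) = cover_op (a, b) (pi_op i x)"
proof (rule additive_ext[where f = "\<lambda>x. pi_op i (cover_op (a, b) x)"
      and g = "\<lambda>x. cover_op (a, b) (pi_op i x)"])
  fix \<sigma> :: "nat \<Rightarrow> nat"
  have "\<sigma> \<circ> transpose a b \<circ> transpose i (i + 1) = \<sigma> \<circ> transpose i (i + 1) \<circ> transpose a b"
    using transpose_commute_disjoint[OF assms(1)] by (simp add: comp_assoc)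
  moreover have "transpose a b i = i" "transpose a b (i + 1) = i + 1" using assms by auto
  ultimately show "pi_op i (cover_op (a, b) (frag_of \<sigma>)) = cover_op (a, b) (pi_op i (frag_of \<sigma>))"
    using cover_comp_adjacent[OF assms, of \<sigma>]
    by (simp add: cover_op_of pi_op_of cover_op_diff pi_op_diff)
qed (simp_all add: cover_op_diff pi_op_diff)

section \<open>Products of cover operators along lists of labels\<close>

lemma cover_ops_append_cong:
  "cover_ops u = cover_ops u' \<Longrightarrow> cover_ops v = cover_ops v' \<Longrightarrow> cover_ops (u @ v) = cover_ops (u' @ v')"
  by simp

definition commuting_pairs :: "(nat \<times> nat) list \<Rightarrow> (nat \<times> nat) list \<Rightarrow> bool" where
  "commuting_pairs u v \<longleftrightarrow>
     (\<forall>(a, b)\<in>set u. \<forall>(c, d)\<in>set v. {a, b} \<inter> {c, d} = {} \<and> a < b \<and> c < d)"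

lemma cover_op_cover_ops:
  assumes "commuting_pairs [p] v"
  shows "cover_op p (cover_ops v x) = cover_ops v (cover_op p x)"
  using assms
proof (induction v arbitrary: x)
  case (Cons q v)
  obtain a b c d where pq: "p = (a, b)" "q = (c, d)" by fastforce
  have "cover_op q (cover_op p x) = cover_op p (cover_op q x)"
    using Cons.prems cover_op_commute[of c d a b x] pq by (auto simp: commuting_pairs_def)
  moreover have "commuting_pairs [p] v" using Cons.prems pq by (auto simp: commuting_pairs_def)
  ultimately show ?case using Cons.IH by simp
qed simp

lemma cover_ops_commute:
  assumes "commuting_pairs u v"
  shows "cover_ops (u @ v) = cover_ops (v @ u)"
  using assms
proof (induction u)
  case (Cons p u)
  have "cover_ops ((p # u) @ v) x = cover_ops (v @ p # u) x" for x
  proof -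
    have "cover_ops ((p # u) @ v) x = cover_ops (v @ u) (cover_op p x)"
      using Cons by (auto simp: commuting_pairs_def fun_eq_iff)
    also have "\<dots> = cover_ops (v @ p # u) x"
      using Cons.prems by (simp add: cover_op_cover_ops commuting_pairs_def)
    finally show ?thesis .
  qed
  then show ?case by blast
qed simp

definition commutes_pi :: "nat \<Rightarrow> (nat \<times> nat) list \<Rightarrow> bool" where
  "commutes_pi i w \<longleftrightarrow> (\<forall>x. pi_op i (cover_ops w x) = cover_ops w (pi_op i x))"

lemma commutes_pi_Nil: "commutes_pi i []"
  by (simp add: commutes_pi_def)

lemma commutes_pi_append:
  "commutes_pi i u \<Longrightarrow> commutes_pi i v \<Longrightarrow> commutes_pi i (u @ v)"
  by (simp add: commutes_pi_def)

lemma commutes_pi_concat: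
  "(\<And>w. w \<in> set ws \<Longrightarrow> commutes_pi i w) \<Longrightarrow> commutes_pi i (concat ws)"
  by (induction ws) (auto simp: commutes_pi_Nil commutes_pi_append)

lemma commutes_pi_disjoint:
  assumes "\<And>a b. (a, b) \<in> set w \<Longrightarrow> {a, b} \<inter> {i, i + 1} = {} \<and> a < b"
  shows "commutes_pi i w"
  using assms
proof (induction w)
  case (Cons p w)
  obtain a b where p: "p = (a, b)" by fastforce
  have "pi_op i (cover_op p x) = cover_op p (pi_op i x)" for x
    using Cons.prems[of a b] p pi_op_cover_op_disjoint[of a b i x] by auto
  moreover have "commutes_pi i w" using Cons by auto
  ultimately show ?case by (simp add: commutes_pi_def)
qed (simp add: commutes_pi_Nil)

section \<open>Rearranging rows and blocks of labels\<close>

definition row :: "nat \<Rightarrow> nat \<Rightarrow> nat \<Rightarrow> (nat \<times> nat) list" where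
  "row n k a = map (Pair a) (rev [k + 1..<n + 1])"

definition block :: "nat \<Rightarrow> nat \<Rightarrow> nat \<Rightarrow> (nat \<times> nat) list" where
  "block n lo k = concat (map (row n k) [lo + 1..<k + 1])"

text \<open>\<open>full_rows n 0 n\<close> runs over all transpositions and is the label list for
  the finest cuts 1, ..., n - 1. Its rows run downwards, whereas those of \<open>block\<close> run
  upwards; the Yang--Baxter moves reconcile the two orders.\<close>

definition full_rows :: "nat \<Rightarrow> nat \<Rightarrow> nat \<Rightarrow> (nat \<times> nat) list" where
  "full_rows n lo k = concat (map (\<lambda>a. row n a a) (rev [lo + 1..<k + 1]))"

text \<open>(a, b) and (c, b') commute if b and b' differ, so two consecutive rows over the same
  columns can be read column by column. This brings the Yang--Baxter triples and the pairs for
  \<pi>_i next to each other.\<close>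

lemma cover_ops_interleave:
  assumes "a \<noteq> c" "distinct bs" "\<And>b. b \<in> set bs \<Longrightarrow> a < b \<and> c < b"
  shows "cover_ops (map (Pair a) bs @ map (Pair c) bs) = cover_ops (concat (map (\<lambda>b. [(a, b), (c, b)]) bs))"
  using assms(2,3)
proof (induction bs)
  case (Cons b bs)
  have "commuting_pairs (map (Pair a) bs) [(c, b)]"
    using Cons.prems assms(1) by (fastforce simp: commuting_pairs_def)
  then have "cover_ops ([(a, b)] @ (map (Pair a) bs @ [(c, b)]) @ map (Pair c) bs)
    = cover_ops ([(a, b)] @ ([(c, b)] @ map (Pair a) bs) @ map (Pair c) bs)"
    by (intro cover_ops_append_cong cover_ops_commute refl)
  also have "\<dots> = cover_ops ([(a, b), (c, b)] @ map (Pair a) bs @ map (Pair c) bs)"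
    by simp
  also have "\<dots> = cover_ops ([(a, b), (c, b)] @ concat (map (\<lambda>b. [(a, b), (c, b)]) bs))"
    by (intro cover_ops_append_cong refl, rule Cons.IH) (use Cons.prems in auto)
  finally show ?case by simp
qed simp

text \<open>The label (a, c) travels from the end of the list to its front, through one Yang--Baxter
  equation for each column, and each passage reverses the two labels of the column.\<close>

lemma cover_ops_ybe_interleaved:
  assumes "a < c" "\<And>b. b \<in> set bs \<Longrightarrow> c < b"
  shows "cover_ops (concat (map (\<lambda>b. [(c, b), (a, b)]) bs) @ [(a, c)]) =
    cover_ops ((a, c) # concat (map (\<lambda>b. [(a, b), (c, b)]) bs))"
  using assms(2)
proof (induction bs)
  case (Cons b bs)
  have "cover_ops [(c, b), (a, b), (a, c)] = cover_ops [(a, c), (a, b), (c, b)]"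
    using cover_op_ybe[of a c b] assms(1) Cons.prems by (auto simp: fun_eq_iff)
  then have "cover_ops ([(c, b), (a, b), (a, c)] @ concat (map (\<lambda>b. [(a, b), (c, b)]) bs))
    = cover_ops ([(a, c), (a, b), (c, b)] @ concat (map (\<lambda>b. [(a, b), (c, b)]) bs))"
    by (intro cover_ops_append_cong refl)
  moreover have "cover_ops ([(c, b), (a, b)] @ concat (map (\<lambda>b. [(c, b), (a, b)]) bs) @ [(a, c)])
    = cover_ops ([(c, b), (a, b)] @ (a, c) # concat (map (\<lambda>b. [(a, b), (c, b)]) bs))"
    by (intro cover_ops_append_cong refl, rule Cons.IH) (use Cons.prems in auto)
  ultimately show ?case by simp
qed simp

lemma cover_ops_ybe_rows:
  assumes "a < c" "c \<le> k"
  shows "cover_ops (row n k c @ row n k a @ [(a, c)]) = cover_ops ([(a, c)] @ row n k a @ row n k c)"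
proof -
  have "cover_ops ((row n k c @ row n k a) @ [(a, c)])
    = cover_ops (concat (map (\<lambda>b. [(c, b), (a, b)]) (rev [k + 1..<n + 1])) @ [(a, c)])"
    unfolding row_def using assms by (intro cover_ops_append_cong cover_ops_interleave refl) auto
  also have "\<dots> = cover_ops ([(a, c)] @ concat (map (\<lambda>b. [(a, b), (c, b)]) (rev [k + 1..<n + 1])))"
    using cover_ops_ybe_interleaved[of a c "rev [k + 1..<n + 1]"] assms by (simp del: upt_Suc)
  also have "\<dots> = cover_ops ([(a, c)] @ row n k a @ row n k c)"
    unfolding row_def using assms
    by (intro cover_ops_append_cong cover_ops_interleave[symmetric] refl) auto
  finally show ?thesis by simp
qed

lemma set_row: "set (row n k a) = {a} \<times> {k<..n}"
  by (auto simp: row_def)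

text \<open>For the last c of the list, (a, c) stands directly after the rows of c and a. It passes
  both and exchanges them, and then commutes with the remaining rows, whose labels contain neither a
  nor c. Taking the rows from the last to the first is what puts the labels (a, c) in reversed
  order.\<close>

lemma cover_ops_ybe_block:
  assumes "distinct cs" "\<And>c. c \<in> set cs \<Longrightarrow> a < c \<and> c \<le> k"
  shows "cover_ops (concat (map (row n k) cs) @ row n k a @ map (Pair a) (rev cs)) =
    cover_ops (map (Pair a) (rev cs) @ row n k a @ concat (map (row n k) cs))"
  using assms
proof (induction cs rule: rev_induct)
  case (snoc c cs)
  let ?G = "concat (map (row n k) cs)" and ?M = "map (Pair a) (rev cs)"
  have ac: "a < c" "c \<le> k" using snoc.prems by auto
  have "cover_ops (?G @ (row n k c @ row n k a @ [(a, c)]) @ ?M)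
    = cover_ops (?G @ ([(a, c)] @ row n k a @ row n k c) @ ?M)"
    by (intro cover_ops_append_cong cover_ops_ybe_rows ac refl)
  also have "\<dots> = cover_ops ((?G @ [(a, c)]) @ row n k a @ (row n k c @ ?M))" by simp
  also have "\<dots> = cover_ops (([(a, c)] @ ?G) @ row n k a @ (?M @ row n k c))"
    using snoc.prems by (intro cover_ops_append_cong cover_ops_commute refl)
      (fastforce simp: commuting_pairs_def set_row)+
  also have "\<dots> = cover_ops ([(a, c)] @ (?G @ row n k a @ ?M) @ row n k c)" by simp
  also have "\<dots> = cover_ops ([(a, c)] @ (?M @ row n k a @ ?G) @ row n k c)"
    using snoc by (intro cover_ops_append_cong snoc.IH refl) auto
  finally show ?case by simp
qed simp

lemma rev_upt_split: "i \<le> j \<Longrightarrow> j \<le> k \<Longrightarrow> rev [i..<k] = rev [j..<k] @ rev [i..<j]"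
  by (metis le_Suc_ex rev_append upt_add_eq_append)

lemma row_split:
  assumes "k \<le> l" "l \<le> n"
  shows "row n k a = row n l a @ map (Pair a) (rev [k + 1..<l + 1])"
  unfolding row_def using assms rev_upt_split[of "k + 1" "l + 1" "n + 1"] by simp

lemma full_rows_split:
  assumes "lo \<le> m" "m \<le> k"
  shows "full_rows n lo k = full_rows n m k @ full_rows n lo m"
  unfolding full_rows_def using assms rev_upt_split[of "lo + 1" "m + 1" "k + 1"] by simp

text \<open>Downward induction on \<open>lo\<close>: the row of \<open>Suc m\<close> is cut at
  column k, and its inner part is moved in front of the block built so far. Of the collected prefix
  \<open>Q\<close> only the range of its labels is recorded: they are transpositions within the
  positions lo + 1 to k.\<close>

lemma full_rows_eq_block:
  assumes "lo \<le> k" "k \<le> n"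
  shows "\<exists>Q. (\<forall>(a, b)\<in>set Q. lo < a \<and> a < b \<and> b \<le> k) \<and>
    cover_ops (full_rows n lo k) = cover_ops (Q @ block n lo k)"
  using assms(1)
proof (induction rule: inc_induct)
  case base
  show ?case by (intro exI[of _ "[]"]) (simp add: full_rows_def block_def)
next
  case (step m)
  then obtain Q where Q: "\<forall>(a, b)\<in>set Q. Suc m < a \<and> a < b \<and> b \<le> k"
    "cover_ops (full_rows n (Suc m) k) = cover_ops (Q @ block n (Suc m) k)" by blast
  let ?M = "map (Pair (Suc m)) (rev [Suc m + 1..<k + 1])"
  have "full_rows n m k = full_rows n (Suc m) k @ row n (Suc m) (Suc m)"
    using full_rows_split[of m "Suc m" k n] step by (simp add: full_rows_def)
  also have "row n (Suc m) (Suc m) = row n k (Suc m) @ ?M"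
    using row_split[of "Suc m" k n "Suc m"] step assms by simp
  finally have "cover_ops (full_rows n m k) = cover_ops ((Q @ block n (Suc m) k) @ row n k (Suc m) @ ?M)"
    using Q(2) by (simp only:) (intro cover_ops_append_cong refl)
  also have "\<dots> = cover_ops (Q @ (block n (Suc m) k @ row n k (Suc m) @ ?M))" by simp
  also have "\<dots> = cover_ops (Q @ (?M @ row n k (Suc m) @ block n (Suc m) k))"
    unfolding block_def
    by (intro cover_ops_append_cong cover_ops_ybe_block refl) auto
  also have "row n k (Suc m) @ block n (Suc m) k = block n m k"
    unfolding block_def using step by (simp add: upt_rec[of "Suc m"] del: upt_Suc)
  finally have "cover_ops (full_rows n m k) = cover_ops ((Q @ ?M) @ block n m k)"
    by (simp only: append_assoc)
  moreover have "\<forall>(a, b)\<in>set (Q @ ?M). m < a \<and> a < b \<and> b \<le> k" using Q(1) by auto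
  ultimately show ?case by blast
qed

section \<open>Commutation of label lists with the operators \<pi>_i\<close>

lemma commutes_pi_row_right:
  assumes "a \<le> k" "k < i" "i < n"
  shows "commutes_pi i (row n k a)"
proof -
  have "rev [k + 1..<n + 1] = rev [i + 2..<n + 1] @ rev [k + 1..<i + 2]"
    using assms by (intro rev_upt_split) auto
  then have *: "row n k a = map (Pair a) (rev [i + 2..<n + 1]) @ [(a, i + 1), (a, i)] @ map (Pair a) (rev [k + 1..<i])"
    using assms unfolding row_def by simp
  have "commutes_pi i [(a, i + 1), (a, i)]"
    using pi_op_cover_op_right[of a i] assms by (simp add: commutes_pi_def)
  moreover have "commutes_pi i (map (Pair a) (rev [i + 2..<n + 1]))" "commutes_pi i (map (Pair a) (rev [k + 1..<i]))"
    using assms by (intro commutes_pi_disjoint; auto)+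
  ultimately show ?thesis unfolding * by (intro commutes_pi_append)
qed

lemma commutes_pi_rows_left:
  assumes "i < k"
  shows "commutes_pi i (row n k i @ row n k (i + 1))"
proof -
  have "commutes_pi i (concat (map (\<lambda>b. [(i, b), (i + 1, b)]) (rev [k + 1..<n + 1])))"
  proof (intro commutes_pi_concat)
    fix w assume "w \<in> set (map (\<lambda>b. [(i, b), (i + 1, b)]) (rev [k + 1..<n + 1]))"
    then obtain b where "w = [(i, b), (i + 1, b)]" "k < b" by auto
    then show "commutes_pi i w"
      using pi_op_cover_op_left[of i b] assms by (simp add: commutes_pi_def)
  qed
  moreover have "cover_ops (row n k i @ row n k (i + 1)) = cover_ops (concat (map (\<lambda>b. [(i, b), (i + 1, b)]) (rev [k + 1..<n + 1])))"
    unfolding row_def using assms by (intro cover_ops_interleave) auto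
  ultimately show ?thesis unfolding commutes_pi_def by metis
qed

text \<open>To the right of k, the columns i + 1 and i form a commuting pair in every row; inside
  the block, the rows i and i + 1 do so in every column; to the left of the block, no label meets i
  or i + 1.\<close>

lemma commutes_pi_block:
  assumes "i \<noteq> lo" "i \<noteq> k" "i < n"
  shows "commutes_pi i (block n lo k)"
proof -
  have outer: "commutes_pi i (row n k a)" if "i < k" "a \<le> k" "a \<noteq> i" "a \<noteq> i + 1" for a
    using that by (intro commutes_pi_disjoint) (auto simp: set_row)
  consider "k < i" | "i < lo" | "lo < i" "i < k" using assms by linarith
  then show ?thesis
  proof cases
    case 1
    then show ?thesis using assms unfolding block_def
      by (intro commutes_pi_concat) (auto intro: commutes_pi_row_right)
  next
    case 2
    then show ?thesis unfolding block_def
      by (intro commutes_pi_concat) (auto intro!: outer)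
  next
    case 3
    have "[lo + 1..<k + 1] = [lo + 1..<i] @ [i..<k + 1]"
      using 3 upt_add_eq_append[of "lo + 1" i "k + 1 - i"] by (simp del: upt_Suc)
    also have "[i..<k + 1] = i # (i + 1) # [i + 2..<k + 1]"
      using 3 by (simp add: upt_rec del: upt_Suc)
    finally have "block n lo k = concat (map (row n k) [lo + 1..<i]) @ (row n k i @ row n k (i + 1))
        @ concat (map (row n k) [i + 2..<k + 1])"
      by (simp add: block_def del: upt_Suc)
    moreover have "commutes_pi i (concat (map (row n k) [lo + 1..<i]))" "commutes_pi i (concat (map (row n k) [i + 2..<k + 1]))"
      using 3 by (intro commutes_pi_concat; auto intro!: outer)+
    ultimately show ?thesis using commutes_pi_rows_left[of i k n] 3
      by (simp only: commutes_pi_append)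
  qed
qed

text \<open>The label (i, i + 1) stands at the end of row i. Moved in front of the rows i + 1 and i,
  it exchanges them, which leaves them in the order in which they commute with \<pi>_i as a
  pair.\<close>

lemma full_rows_extract:
  assumes "1 \<le> i" "i < n"
  shows "\<exists>w. cover_ops (full_rows n 0 n) = cover_ops ((i, i + 1) # w) \<and> commutes_pi i w"
proof -
  let ?top = "full_rows n (i + 1) n" and ?bot = "full_rows n 0 (i - 1)"
  let ?mid = "row n (i + 1) i @ row n (i + 1) (i + 1)"
  obtain j where j: "i = Suc j" using assms by (cases i) auto
  have "full_rows n 0 n = ?top @ full_rows n (i - 1) (i + 1) @ ?bot"
    using full_rows_split[of 0 "i + 1" n n] full_rows_split[of 0 "i - 1" "i + 1" n] assms by simp
  also have "full_rows n (i - 1) (i + 1) = row n (i + 1) (i + 1) @ row n i i"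
    using j by (simp add: full_rows_def)
  also have "row n i i = row n (i + 1) i @ [(i, i + 1)]"
    using row_split[of i "i + 1" n i] assms by simp
  finally have "cover_ops (full_rows n 0 n) =
      cover_ops (?top @ (row n (i + 1) (i + 1) @ row n (i + 1) i @ [(i, i + 1)]) @ ?bot)" by simp
  also have "\<dots> = cover_ops (?top @ ([(i, i + 1)] @ ?mid) @ ?bot)"
    by (intro cover_ops_append_cong cover_ops_ybe_rows refl) auto
  also have "\<dots> = cover_ops ((?top @ [(i, i + 1)]) @ ?mid @ ?bot)" by simp
  also have "\<dots> = cover_ops (([(i, i + 1)] @ ?top) @ ?mid @ ?bot)"
    by (intro cover_ops_append_cong cover_ops_commute refl)
      (auto simp: commuting_pairs_def full_rows_def set_row)
  finally have "cover_ops (full_rows n 0 n) = cover_ops ((i, i + 1) # ?top @ ?mid @ ?bot)" by simp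
  moreover have "commutes_pi i ?top"
    by (intro commutes_pi_disjoint) (auto simp: full_rows_def set_row)
  moreover have "commutes_pi i ?bot"
    unfolding full_rows_def using assms
    by (intro commutes_pi_concat) (auto intro!: commutes_pi_row_right)
  moreover have "commutes_pi i ?mid" by (rule commutes_pi_rows_left) simp
  ultimately show ?thesis using commutes_pi_append by blast
qed

text \<open>With X the remaining product, K_\<sigma> is sent to X K_\<sigma> because \<sigma>
  descends at i, and K_{\<sigma> s_i} to X K_{\<sigma> s_i} - X K_\<sigma>. As X commutes with
  \<pi>_i, the latter is (\<pi>_i - 1) X K_\<sigma>.\<close>

lemma pi_hat_op_full_rows:
  assumes "1 \<le> i" "i < n" "inj \<sigma>" "\<sigma> i > \<sigma> (i + 1)"
  shows "pi_hat_op i (cover_ops (full_rows n 0 n) (frag_of \<sigma>)) =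
    cover_ops (full_rows n 0 n) (frag_of (\<sigma> \<circ> transpose i (i + 1)))"
proof -
  obtain w where w: "cover_ops (full_rows n 0 n) = cover_ops ((i, i + 1) # w)" "commutes_pi i w"
    using full_rows_extract assms by blast
  have "cover (\<sigma> \<circ> transpose i (i + 1)) i (i + 1)" "\<not> cover \<sigma> i (i + 1)"
    using assms inj_comp_transpose_iff[of \<sigma> i "i + 1"] by (auto simp: cover_def)
  then have "cover_ops ((i, i + 1) # w) (frag_of \<sigma>) = cover_ops w (frag_of \<sigma>)"
    "cover_ops ((i, i + 1) # w) (frag_of (\<sigma> \<circ> transpose i (i + 1))) =
       cover_ops w (frag_of (\<sigma> \<circ> transpose i (i + 1))) - cover_ops w (frag_of \<sigma>)"
    by (simp_all add: cover_op_of comp_assoc flip: cover_ops_diff)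
  moreover have "pi_op i (cover_ops w (frag_of \<sigma>)) = cover_ops w (frag_of (\<sigma> \<circ> transpose i (i + 1)))"
    using w(2) assms(4) by (simp add: commutes_pi_def pi_op_of)
  ultimately show ?thesis unfolding w(1) pi_hat_op_def by simp
qed

section \<open>Coxeter length and Bruhat order\<close>

definition inversions :: "nat \<Rightarrow> (nat \<Rightarrow> nat) \<Rightarrow> (nat \<times> nat) set" where
  "inversions n \<mu> = {(i, j). 1 \<le> i \<and> i < j \<and> j \<le> n \<and> \<mu> j < \<mu> i}"

text \<open>Indicator of an inversion for the unordered pair {i, j}. Being symmetric, it lets the
  terms that involve two given positions be split off a double sum without distinguishing the order
  of positions; each inversion is then counted twice.\<close>

definition inverted :: "(nat \<Rightarrow> nat) \<Rightarrow> nat \<Rightarrow> nat \<Rightarrow> nat" where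
  "inverted \<mu> i j = of_bool (i < j \<and> \<mu> j < \<mu> i \<or> j < i \<and> \<mu> i < \<mu> j)"

lemma finite_inversions: "finite (inversions n \<mu>)"
  by (rule finite_subset[of _ "{1..n} \<times> {1..n}"]) (auto simp: inversions_def)

lemma card_inversions: "2 * card (inversions n \<mu>) = (\<Sum>i\<in>{1..n}. \<Sum>j\<in>{1..n}. inverted \<mu> i j)"
proof -
  have "(\<Sum>i\<in>{1..n}. \<Sum>j\<in>{1..n}. inverted \<mu> i j) =
      (\<Sum>p\<in>{1..n} \<times> {1..n}. inverted \<mu> (fst p) (snd p))"
    by (simp add: sum.cartesian_product case_prod_unfold)
  also have "\<dots> = card {p \<in> {1..n} \<times> {1..n}. fst p < snd p \<and> \<mu> (snd p) < \<mu> (fst p) \<or> snd p < fst p \<and> \<mu> (fst p) < \<mu> (snd p)}"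
    by (simp add: inverted_def sum.If_cases of_bool_def Int_def)
  also have "{p \<in> {1..n} \<times> {1..n}. fst p < snd p \<and> \<mu> (snd p) < \<mu> (fst p) \<or> snd p < fst p \<and> \<mu> (fst p) < \<mu> (snd p)}
     = inversions n \<mu> \<union> prod.swap ` inversions n \<mu>"
    by (auto simp: inversions_def image_iff)
  also have "card \<dots> = card (inversions n \<mu>) + card (prod.swap ` inversions n \<mu>)"
    by (rule card_Un_disjoint) (use finite_inversions in \<open>auto simp: inversions_def\<close>)
  also have "card (prod.swap ` inversions n \<mu>) = card (inversions n \<mu>)"
    by (rule card_image) simp
  finally show ?thesis by simp
qed

lemma sum_symmetric_extract:
  fixes f :: "nat \<Rightarrow> nat \<Rightarrow> nat"
  assumes "finite I" "a \<in> I" "b \<in> I" "a \<noteq> b" "\<And>i j. f i j = f j i" "\<And>i. f i i = 0"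
  shows "(\<Sum>i\<in>I. \<Sum>j\<in>I. f i j) =
    (\<Sum>i\<in>I - {a, b}. \<Sum>j\<in>I - {a, b}. f i j) + 2 * (\<Sum>c\<in>I - {a, b}. f c a + f c b) + 2 * f a b"
proof -
  have I: "(\<Sum>i\<in>I. g i) = g a + g b + (\<Sum>i\<in>I - {a, b}. g i)" for g :: "nat \<Rightarrow> nat"
    using assms(1-4) by (simp add: sum.remove[of I a] sum.remove[of "I - {a}" b] flip: Diff_insert2)
  have "(\<Sum>c\<in>I - {a, b}. f a c) = (\<Sum>c\<in>I - {a, b}. f c a)" "(\<Sum>c\<in>I - {a, b}. f b c) = (\<Sum>c\<in>I - {a, b}. f c b)"
    using assms(5) by simp_all
  then show ?thesis
    by (simp add: I sum.distrib assms(5)[of b a] assms(6))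
qed

text \<open>Pairs that avoid a and b are unaffected. A third position c changes the count only if it
  lies between a and b in position and in value, and then by two; the pair (a, b) itself adds
  one.\<close>

lemma card_inversions_transpose:
  assumes "1 \<le> a" "a < b" "b \<le> n" "inj \<mu>" "\<mu> a < \<mu> b"
  shows "card (inversions n (\<mu> \<circ> transpose a b)) =
    card (inversions n \<mu>) + 1 + 2 * card {c. a < c \<and> c < b \<and> \<mu> a < \<mu> c \<and> \<mu> c < \<mu> b}"
proof -
  let ?I = "{1..n}" and ?\<nu> = "\<mu> \<circ> transpose a b"
  let ?J = "{1..n} - {a, b}" and ?M = "{c. a < c \<and> c < b \<and> \<mu> a < \<mu> c \<and> \<mu> c < \<mu> b}"
  have sym: "inverted f i j = inverted f j i" "inverted f i i = 0" for f i j
    by (auto simp: inverted_def)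
  have split: "2 * card (inversions n f) = (\<Sum>i\<in>?J. \<Sum>j\<in>?J. inverted f i j) +
      2 * (\<Sum>c\<in>?J. inverted f c a + inverted f c b) + 2 * inverted f a b" for f
    unfolding card_inversions using assms(1-3) by (intro sum_symmetric_extract sym) auto
  have 1: "(\<Sum>i\<in>?J. \<Sum>j\<in>?J. inverted ?\<nu> i j) = (\<Sum>i\<in>?J. \<Sum>j\<in>?J. inverted \<mu> i j)"
    by (intro sum.cong refl) (auto simp: inverted_def)
  have "inverted ?\<nu> c a + inverted ?\<nu> c b = inverted \<mu> c a + inverted \<mu> c b + 2 * of_bool (c \<in> ?M)"
    if "c \<in> ?J" for c
  proof -
    have "\<mu> c \<noteq> \<mu> a" "\<mu> c \<noteq> \<mu> b" using that assms(4) by (auto dest: injD)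
    moreover have "transpose a b c = c" using that by auto
    ultimately show ?thesis using that assms(2,5) by (auto simp: inverted_def)
  qed
  then have "(\<Sum>c\<in>?J. inverted ?\<nu> c a + inverted ?\<nu> c b) =
      (\<Sum>c\<in>?J. inverted \<mu> c a + inverted \<mu> c b) + 2 * (\<Sum>c\<in>?J. of_bool (c \<in> ?M))"
    by (simp add: sum.distrib sum_distrib_left)
  also have "(\<Sum>c\<in>?J. of_bool (c \<in> ?M)) = card (?J \<inter> ?M)"
    by (simp add: sum.If_cases of_bool_def Int_def)
  also have "?J \<inter> ?M = ?M" using assms(1-3) by auto
  finally have 2: "(\<Sum>c\<in>?J. inverted ?\<nu> c a + inverted ?\<nu> c b) =
      (\<Sum>c\<in>?J. inverted \<mu> c a + inverted \<mu> c b) + 2 * card ?M" .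
  have 3: "inverted ?\<nu> a b = 1" "inverted \<mu> a b = 0"
    using assms(2,5) by (auto simp: inverted_def)
  show ?thesis using split[of ?\<nu>] split[of \<mu>] unfolding 1 2 3 by simp
qed

text \<open>Strict increase gives i \<le> \<mu> i when counted up from 1, and \<mu> i \<le> i when
  counted down from n.\<close>

lemma permutes_id_if_no_descent:
  fixes n :: nat
  assumes "\<mu> permutes {1..n}" "\<And>i. 1 \<le> i \<Longrightarrow> i < n \<Longrightarrow> \<mu> i < \<mu> (i + 1)"
  shows "\<mu> = id"
proof -
  have "i \<le> \<mu> i" if "1 \<le> i" "i \<le> n" for i
    using that
  proof (induction i rule: nat_induct_at_least)
    case base
    then show ?case using permutes_in_image[OF assms(1), of 1] by auto
  next
    case (Suc i)
    then show ?case using assms(2)[of i] by auto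
  qed
  moreover have "\<mu> i \<le> i" if "1 \<le> i" "i \<le> n" for i
    using that(2,1)
  proof (induction rule: inc_induct)
    case base
    then show ?case using permutes_in_image[OF assms(1), of n] by auto
  next
    case (step i)
    then show ?case using assms(2)[of i] by auto
  qed
  ultimately have "\<mu> i = i" for i
    using permutes_not_in[OF assms(1), of i] by (cases "i \<in> {1..n}") (auto intro: antisym)
  then show ?thesis by auto
qed

lemma permutes_comp_transpose:
  fixes n :: nat
  assumes "\<mu> permutes {1..n}" "1 \<le> a" "a \<le> n" "1 \<le> b" "b \<le> n"
  shows "\<mu> \<circ> transpose a b permutes {1..n}"
  using assms by (intro permutes_compose permutes_swap_id) auto

lemma simple_prod_Nil: "simple_prod [] = id"
  by (simp add: simple_prod_def transp_prod_def)

lemma simple_prod_single: "simple_prod [i] = transpose i (i + 1)"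
  by (simp add: simple_prod_def transp_prod_def)

lemma simple_prod_permutes: "set w \<subseteq> {1..<n} \<Longrightarrow> simple_prod w permutes {1..n}"
proof (induction w rule: rev_induct)
  case (snoc i w)
  then show ?case
    unfolding simple_prod_append simple_prod_single by (intro permutes_comp_transpose) auto
qed (simp add: simple_prod_Nil permutes_id)

lemma card_inversions_ascent:
  assumes "1 \<le> i" "i < n" "inj \<mu>" "\<mu> i < \<mu> (i + 1)"
  shows "card (inversions n (\<mu> \<circ> transpose i (i + 1))) = card (inversions n \<mu>) + 1"
proof -
  have "{c. i < c \<and> c < i + 1 \<and> \<mu> i < \<mu> c \<and> \<mu> c < \<mu> (i + 1)} = {}" by auto
  moreover have "card (inversions n (\<mu> \<circ> transpose i (i + 1))) = card (inversions n \<mu>) + 1 +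
      2 * card {c. i < c \<and> c < i + 1 \<and> \<mu> i < \<mu> c \<and> \<mu> c < \<mu> (i + 1)}"
    by (rule card_inversions_transpose) (use assms in auto)
  ultimately show ?thesis by (simp only: card.empty)
qed

lemma comp_transpose_twice: "\<mu> \<circ> transpose a b \<circ> transpose a b = \<mu>"
  by (simp add: fun_eq_iff)

lemma card_inversions_descent:
  assumes "1 \<le> i" "i < n" "inj \<mu>" "\<mu> (i + 1) < \<mu> i"
  shows "card (inversions n \<mu>) = card (inversions n (\<mu> \<circ> transpose i (i + 1))) + 1"
proof -
  have "inj (\<mu> \<circ> transpose i (i + 1))" using assms(3) by (simp only: inj_comp_transpose_iff)
  moreover have "(\<mu> \<circ> transpose i (i + 1)) i < (\<mu> \<circ> transpose i (i + 1)) (i + 1)"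
    using assms(4) by simp
  ultimately show ?thesis
    using card_inversions_ascent[of i n "\<mu> \<circ> transpose i (i + 1)"] assms(1,2)
    unfolding comp_transpose_twice by blast
qed

lemma card_inversions_adjacent_le:
  assumes "1 \<le> i" "i < n" "inj \<mu>"
  shows "card (inversions n (\<mu> \<circ> transpose i (i + 1))) \<le> card (inversions n \<mu>) + 1"
proof (cases "\<mu> i < \<mu> (i + 1)")
  case True
  then show ?thesis using card_inversions_ascent[OF assms] by linarith
next
  case False
  moreover have "\<mu> i \<noteq> \<mu> (i + 1)" using injD[OF assms(3), of i "i + 1"] by auto
  ultimately have "\<mu> (i + 1) < \<mu> i" by linarith
  then show ?thesis using card_inversions_descent[OF assms] by linarith
qed

lemma card_inversions_simple_prod:
  "set w \<subseteq> {1..<n} \<Longrightarrow> card (inversions n (simple_prod w)) \<le> length w"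
proof (induction w rule: rev_induct)
  case Nil
  have "inversions n id = {}" by (auto simp: inversions_def)
  then show ?case unfolding simple_prod_Nil by (simp only: card.empty)
next
  case (snoc i w)
  then have "inj (simple_prod w)" using simple_prod_permutes permutes_inj by auto
  then have "card (inversions n (simple_prod w \<circ> transpose i (i + 1))) \<le> card (inversions n (simple_prod w)) + 1"
    using snoc.prems by (intro card_inversions_adjacent_le) auto
  also have "\<dots> \<le> length (w @ [i])" using snoc by simp
  finally show ?case unfolding simple_prod_append simple_prod_single .
qed

text \<open>Bubble sort: exchanging the entries at a descent removes exactly one inversion, and a
  permutation without descents is the identity.\<close>

lemma simple_prod_of_inversions:
  assumes "\<mu> permutes {1..n}"
  shows "\<exists>w. set w \<subseteq> {1..<n} \<and> simple_prod w = \<mu> \<and> length w = card (inversions n \<mu>)"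
  using assms
proof (induction "card (inversions n \<mu>)" arbitrary: \<mu> rule: less_induct)
  case less
  have inj: "inj \<mu>" using less.prems permutes_inj by blast
  show ?case
  proof (cases "\<exists>i. 1 \<le> i \<and> i < n \<and> \<mu> (i + 1) < \<mu> i")
    case True
    then obtain i where i: "1 \<le> i" "i < n" "\<mu> (i + 1) < \<mu> i" by blast
    let ?\<nu> = "\<mu> \<circ> transpose i (i + 1)"
    have card: "card (inversions n \<mu>) = card (inversions n ?\<nu>) + 1"
      using card_inversions_descent i inj by blast
    have "?\<nu> permutes {1..n}" using less.prems i by (intro permutes_comp_transpose) auto
    moreover have "card (inversions n ?\<nu>) < card (inversions n \<mu>)" using card by linarith
    ultimately obtain w where w: "set w \<subseteq> {1..<n}" "simple_prod w = ?\<nu>" "length w = card (inversions n ?\<nu>)"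
      using less.hyps by metis
    have "simple_prod (w @ [i]) = \<mu>"
      by (simp only: simple_prod_append simple_prod_single w comp_transpose_twice)
    moreover have "set (w @ [i]) \<subseteq> {1..<n}" using w(1) i by simp
    moreover have "length (w @ [i]) = card (inversions n \<mu>)" using w(3) card by simp
    ultimately show ?thesis by (intro exI conjI)
  next
    case False
    have "\<mu> = id"
    proof (rule permutes_id_if_no_descent[OF less.prems])
      fix i assume "1 \<le> i" "i < n"
      moreover have "\<mu> i \<noteq> \<mu> (i + 1)" using injD[OF inj, of i "i + 1"] by auto
      ultimately show "\<mu> i < \<mu> (i + 1)" using False by (metis linorder_neqE_nat)
    qed
    moreover have "inversions n id = {}" by (auto simp: inversions_def)
    ultimately show ?thesis by (intro exI[of _ "[]"]) (simp only: simple_prod_Nil card.empty list.size set_empty2 empty_subsetI, simp)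
  qed
qed

lemma coxeter_length_eq_inversions:
  assumes "\<mu> permutes {1..n}"
  shows "coxeter_length n \<mu> = card (inversions n \<mu>)"
  unfolding coxeter_length_def
proof (rule Least_equality)
  show "\<exists>w. set w \<subseteq> {1..<n} \<and> simple_prod w = \<mu> \<and> length w = card (inversions n \<mu>)"
    using simple_prod_of_inversions[OF assms] .
next
  fix r assume "\<exists>w. set w \<subseteq> {1..<n} \<and> simple_prod w = \<mu> \<and> length w = r"
  then show "card (inversions n \<mu>) \<le> r"
    by (elim exE conjE) (metis card_inversions_simple_prod)
qed

lemma coxeter_length_transpose:
  assumes "\<mu> permutes {1..n}" "1 \<le> a" "a < b" "b \<le> n" "\<mu> a < \<mu> b"
  shows "coxeter_length n (\<mu> \<circ> transpose a b) =
    coxeter_length n \<mu> + 1 + 2 * card {c. a < c \<and> c < b \<and> \<mu> a < \<mu> c \<and> \<mu> c < \<mu> b}"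
proof -
  have \<nu>: "\<mu> \<circ> transpose a b permutes {1..n}" using assms by (intro permutes_comp_transpose) auto
  show ?thesis
    unfolding coxeter_length_eq_inversions[OF \<nu>] coxeter_length_eq_inversions[OF assms(1)]
    by (rule card_inversions_transpose[OF assms(2-4) permutes_inj[OF assms(1)] assms(5)])
qed

lemma coxeter_length_less_iff:
  assumes "\<mu> permutes {1..n}" "1 \<le> a" "a < b" "b \<le> n"
  shows "coxeter_length n \<mu> < coxeter_length n (\<mu> \<circ> transpose a b) \<longleftrightarrow> \<mu> a < \<mu> b"
proof (cases "\<mu> a < \<mu> b")
  case True
  then show ?thesis using coxeter_length_transpose[OF assms] by simp
next
  case False
  moreover have "\<mu> a \<noteq> \<mu> b" using assms permutes_inj[OF assms(1)] by (auto dest: injD)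
  ultimately have lt: "(\<mu> \<circ> transpose a b) a < (\<mu> \<circ> transpose a b) b" by simp
  have "\<mu> \<circ> transpose a b permutes {1..n}" using assms by (intro permutes_comp_transpose) auto
  then have "coxeter_length n (\<mu> \<circ> transpose a b) < coxeter_length n (\<mu> \<circ> transpose a b \<circ> transpose a b)"
    using coxeter_length_transpose[OF _ assms(2-4) lt] by linarith
  then have "coxeter_length n (\<mu> \<circ> transpose a b) < coxeter_length n \<mu>"
    unfolding comp_transpose_twice .
  then show ?thesis using False by linarith
qed

lemma coxeter_length_cover_iff:
  assumes "\<mu> permutes {1..n}" "1 \<le> a" "a < b" "b \<le> n"
  shows "coxeter_length n (\<mu> \<circ> transpose a b) = coxeter_length n \<mu> + 1 \<longleftrightarrow> cover \<mu> a b"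
proof (cases "\<mu> a < \<mu> b")
  case True
  have "finite {c. a < c \<and> c < b \<and> \<mu> a < \<mu> c \<and> \<mu> c < \<mu> b}" by simp
  then show ?thesis
    using coxeter_length_transpose[OF assms True] True permutes_inj[OF assms(1)]
    by (auto simp: cover_def)
next
  case False
  then show ?thesis using coxeter_length_less_iff[OF assms] by (simp add: cover_def)
qed

lemma coxeter_length_adjacent:
  assumes "\<mu> permutes {1..n}" "1 \<le> i" "i < n" "\<mu> i < \<mu> (i + 1)"
  shows "coxeter_length n (\<mu> \<circ> transpose i (i + 1)) = coxeter_length n \<mu> + 1"
proof -
  have "cover \<mu> i (i + 1)" using assms permutes_inj[OF assms(1)] by (auto simp: cover_def)
  then show ?thesis using coxeter_length_cover_iff[of \<mu> n i "i + 1"] assms by simp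
qed

lemma bruhat_step_iff:
  assumes "\<mu> permutes {1..n}"
  shows "bruhat_step n \<mu> \<nu> \<longleftrightarrow>
    (\<exists>a b. 1 \<le> a \<and> a < b \<and> b \<le> n \<and> \<mu> a < \<mu> b \<and> \<nu> = \<mu> \<circ> transpose a b)"
  unfolding bruhat_step_def using coxeter_length_less_iff[OF assms] by blast

lemma bruhat_step_permutes:
  "bruhat_step n \<mu> \<nu> \<Longrightarrow> \<mu> permutes {1..n} \<Longrightarrow> \<nu> permutes {1..n}"
  unfolding bruhat_step_def using permutes_comp_transpose by (metis less_imp_le_nat less_le_trans order_trans)

lemma bruhat_le_permutes:
  assumes "bruhat_le n \<mu> \<nu>" "\<mu> permutes {1..n}"
  shows "\<nu> permutes {1..n}"
  using assms unfolding bruhat_le_def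
  by (induction rule: rtranclp_induct) (blast intro: bruhat_step_permutes)+

lemma bruhat_le_refl: "bruhat_le n \<mu> \<mu>"
  by (simp add: bruhat_le_def)

lemma bruhat_le_trans: "bruhat_le n \<mu> \<nu> \<Longrightarrow> bruhat_le n \<nu> \<rho> \<Longrightarrow> bruhat_le n \<mu> \<rho>"
  by (simp add: bruhat_le_def)

lemma bruhat_step_le: "bruhat_step n \<mu> \<nu> \<Longrightarrow> bruhat_le n \<mu> \<nu>"
  by (simp add: bruhat_le_def)

lemma bruhat_le_length: "bruhat_le n \<mu> \<nu> \<Longrightarrow> \<mu> = \<nu> \<or> coxeter_length n \<mu> < coxeter_length n \<nu>"
  unfolding bruhat_le_def
  by (induction rule: rtranclp_induct) (auto simp: bruhat_step_def)

section \<open>The lifting property of the Bruhat order\<close>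

definition up_right :: "nat \<Rightarrow> (nat \<Rightarrow> nat) \<Rightarrow> nat \<Rightarrow> nat" where
  "up_right i \<mu> = (if \<mu> i < \<mu> (i + 1) then \<mu> \<circ> transpose i (i + 1) else \<mu>)"

definition down_right :: "nat \<Rightarrow> (nat \<Rightarrow> nat) \<Rightarrow> nat \<Rightarrow> nat" where
  "down_right i \<mu> = (if \<mu> i < \<mu> (i + 1) then \<mu> else \<mu> \<circ> transpose i (i + 1))"

text \<open>The left versions act on values: \<open>inv \<mu> j < inv \<mu> (j + 1)\<close> says
  that the value j stands before j + 1, in which case exchanging the two goes up.\<close>

definition up_left :: "nat \<Rightarrow> (nat \<Rightarrow> nat) \<Rightarrow> nat \<Rightarrow> nat" where
  "up_left j \<mu> = (if inv \<mu> j < inv \<mu> (j + 1) then transpose j (j + 1) \<circ> \<mu> else \<mu>)"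

definition down_left :: "nat \<Rightarrow> (nat \<Rightarrow> nat) \<Rightarrow> nat \<Rightarrow> nat" where
  "down_left j \<mu> = (if inv \<mu> j < inv \<mu> (j + 1) then \<mu> else transpose j (j + 1) \<circ> \<mu>)"

lemma permutes_values_neq:
  "\<mu> permutes S \<Longrightarrow> a \<noteq> b \<Longrightarrow> \<mu> a \<noteq> \<mu> b"
  by (auto dest!: permutes_inj injD)

lemma bruhat_step_adjacent:
  assumes "\<mu> permutes {1..n}" "1 \<le> i" "i < n" "\<mu> i < \<mu> (i + 1)"
  shows "bruhat_step n \<mu> (\<mu> \<circ> transpose i (i + 1))"
  using assms bruhat_step_iff[OF assms(1)] by force

lemma bruhat_step_adjacent_descent:
  assumes "\<mu> permutes {1..n}" "1 \<le> i" "i < n" "\<not> \<mu> i < \<mu> (i + 1)"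
  shows "bruhat_step n (\<mu> \<circ> transpose i (i + 1)) \<mu>"
proof -
  have "\<mu> \<circ> transpose i (i + 1) permutes {1..n}" using assms by (intro permutes_comp_transpose) auto
  moreover have "(\<mu> \<circ> transpose i (i + 1)) i < (\<mu> \<circ> transpose i (i + 1)) (i + 1)"
    using assms(4) permutes_values_neq[OF assms(1), of i "i + 1"] by auto
  ultimately have "bruhat_step n (\<mu> \<circ> transpose i (i + 1)) (\<mu> \<circ> transpose i (i + 1) \<circ> transpose i (i + 1))"
    by (intro bruhat_step_adjacent assms(2,3))
  then show ?thesis unfolding comp_transpose_twice .
qed

lemma bruhat_stepI:
  assumes "\<mu> permutes {1..n}" "1 \<le> a" "a < b" "b \<le> n" "\<mu> a < \<mu> b"
  shows "bruhat_step n \<mu> (\<mu> \<circ> transpose a b)"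
  using assms bruhat_step_iff by blast

text \<open>Conjugating (a, b) by s_i keeps its end points in order unless the pair is (i, i + 1)
  itself, which the last hypothesis excludes; so the step is carried to a step that exchanges the
  same two values.\<close>

lemma bruhat_step_right:
  assumes "\<mu> permutes {1..n}" "1 \<le> i" "i < n" "bruhat_step n \<mu> \<nu>" "\<nu> \<noteq> \<mu> \<circ> transpose i (i + 1)"
  shows "bruhat_step n (\<mu> \<circ> transpose i (i + 1)) (\<nu> \<circ> transpose i (i + 1))"
proof -
  let ?s = "transpose i (i + 1)"
  obtain a b where ab: "1 \<le> a" "a < b" "b \<le> n" "\<mu> a < \<mu> b" "\<nu> = \<mu> \<circ> transpose a b"
    using assms bruhat_step_iff by blast
  have "(a, b) \<noteq> (i, i + 1)" using ab assms(5) by auto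
  then have lt: "?s a < ?s b" "1 \<le> ?s a" "?s b \<le> n"
    using ab assms(2,3) by (auto simp: transpose_def)
  have "transpose a b \<circ> ?s = ?s \<circ> transpose (?s a) (?s b)"
    using transpose_comp_eq[of ?s a b] by (simp only: bij_transpose inv_transpose_eq)
  then have "\<nu> \<circ> ?s = (\<mu> \<circ> ?s) \<circ> transpose (?s a) (?s b)"
    by (simp add: ab(5) comp_assoc)
  moreover have "(\<mu> \<circ> ?s) (?s a) < (\<mu> \<circ> ?s) (?s b)" using ab(4) by simp
  moreover have "\<mu> \<circ> ?s permutes {1..n}" using assms by (intro permutes_comp_transpose) auto
  ultimately show ?thesis using lt bruhat_step_iff by blast
qed

text \<open>The lifting property in the form that passing to the larger or to the smaller element of
  the pair {\<mu>, \<mu> s_i} is monotone. The step from \<mu> to \<mu> s_i collapses under both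
  maps; any other step is preserved by right multiplication with s_i, and the comparisons follow by
  transitivity.\<close>

lemma bruhat_step_up_down_right:
  assumes "\<mu> permutes {1..n}" "1 \<le> i" "i < n" "bruhat_step n \<mu> \<nu>"
  shows "bruhat_le n (up_right i \<mu>) (up_right i \<nu>) \<and> bruhat_le n (down_right i \<mu>) (down_right i \<nu>)"
proof -
  let ?s = "transpose i (i + 1)"
  have \<nu>: "\<nu> permutes {1..n}" using assms bruhat_step_permutes by blast
  show ?thesis
  proof (cases "\<nu> = \<mu> \<circ> ?s")
    case True
    then have "\<mu> i < \<mu> (i + 1)"
      using assms coxeter_length_less_iff[of \<mu> n i "i + 1"] by (auto simp: bruhat_step_def)
    then show ?thesis using True
      by (simp add: up_right_def down_right_def bruhat_le_refl comp_transpose_twice[unfolded Suc_eq_plus1[symmetric]])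
  next
    case False
    have "bruhat_le n \<mu> \<nu>" using assms(4) by (rule bruhat_step_le)
    moreover have "bruhat_le n (\<mu> \<circ> ?s) (\<nu> \<circ> ?s)"
      using bruhat_step_right[OF assms False] by (rule bruhat_step_le)
    moreover have "bruhat_le n \<mu> (\<mu> \<circ> ?s)" if "\<mu> i < \<mu> (i + 1)"
      by (rule bruhat_step_le[OF bruhat_step_adjacent[OF assms(1-3) that]])
    moreover have "bruhat_le n (\<mu> \<circ> ?s) \<mu>" if "\<not> \<mu> i < \<mu> (i + 1)"
      by (rule bruhat_step_le[OF bruhat_step_adjacent_descent[OF assms(1-3) that]])
    moreover have "bruhat_le n \<nu> (\<nu> \<circ> ?s)" if "\<nu> i < \<nu> (i + 1)"
      by (rule bruhat_step_le[OF bruhat_step_adjacent[OF \<nu> assms(2,3) that]])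
    moreover have "bruhat_le n (\<nu> \<circ> ?s) \<nu>" if "\<not> \<nu> i < \<nu> (i + 1)"
      by (rule bruhat_step_le[OF bruhat_step_adjacent_descent[OF \<nu> assms(2,3) that]])
    ultimately show ?thesis unfolding up_right_def down_right_def
      by (cases "\<mu> i < \<mu> (i + 1)"; cases "\<nu> i < \<nu> (i + 1)") (simp_all only: if_True if_False simp_thms, (blast intro: bruhat_le_trans)+)
  qed
qed

lemma bruhat_le_up_down_right:
  assumes "bruhat_le n \<mu> \<nu>" "\<mu> permutes {1..n}" "1 \<le> i" "i < n"
  shows "bruhat_le n (up_right i \<mu>) (up_right i \<nu>)" "bruhat_le n (down_right i \<mu>) (down_right i \<nu>)"
proof -
  have "bruhat_le n (up_right i \<mu>) (up_right i \<nu>) \<and> bruhat_le n (down_right i \<mu>) (down_right i \<nu>)"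
    using assms(1)[unfolded bruhat_le_def]
  proof (induction rule: rtranclp_induct)
    case (step \<nu> \<rho>)
    then have "\<nu> permutes {1..n}" using bruhat_le_permutes assms(2) by (auto simp: bruhat_le_def)
    then show ?case using step bruhat_step_up_down_right[of \<nu> n i \<rho>] assms(3,4) bruhat_le_trans by blast
  qed (simp add: bruhat_le_refl)
  then show "bruhat_le n (up_right i \<mu>) (up_right i \<nu>)" "bruhat_le n (down_right i \<mu>) (down_right i \<nu>)"
    by auto
qed

lemma transpose_comp_left:
  assumes "\<mu> permutes S"
  shows "transpose j k \<circ> \<mu> = \<mu> \<circ> transpose (inv \<mu> j) (inv \<mu> k)"
  by (rule transpose_comp_eq[OF permutes_bij[OF assms]])

lemma permutes_transpose_comp:
  fixes n :: nat
  assumes "\<mu> permutes {1..n}" "1 \<le> j" "j < n"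
  shows "transpose j (j + 1) \<circ> \<mu> permutes {1..n}"
  using assms by (intro permutes_compose permutes_swap_id) auto

lemma inv_in_range:
  fixes n :: nat
  assumes "\<mu> permutes {1..n}" "1 \<le> j" "j \<le> n"
  shows "1 \<le> inv \<mu> j" "inv \<mu> j \<le> n"
  using permutes_in_image[OF permutes_inv[OF assms(1)], of j] assms by auto

lemma inv_transpose_comp:
  assumes "\<mu> permutes S"
  shows "inv (transpose j k \<circ> \<mu>) = inv \<mu> \<circ> transpose j k"
  using assms by (simp add: o_inv_distrib permutes_bij inv_transpose_eq)

lemma bruhat_step_adjacent_left:
  assumes "\<mu> permutes {1..n}" "1 \<le> j" "j < n" "inv \<mu> j < inv \<mu> (j + 1)"
  shows "bruhat_step n \<mu> (transpose j (j + 1) \<circ> \<mu>)"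
proof -
  have "\<mu> (inv \<mu> j) < \<mu> (inv \<mu> (j + 1))" using permutes_inverses[OF assms(1)] by simp
  moreover have "1 \<le> inv \<mu> j" "inv \<mu> (j + 1) \<le> n" using inv_in_range[OF assms(1)] assms(2,3) by simp_all
  ultimately show ?thesis
    unfolding transpose_comp_left[OF assms(1)] by (intro bruhat_stepI assms)
qed

lemma bruhat_step_adjacent_left_descent:
  assumes "\<mu> permutes {1..n}" "1 \<le> j" "j < n" "\<not> inv \<mu> j < inv \<mu> (j + 1)"
  shows "bruhat_step n (transpose j (j + 1) \<circ> \<mu>) \<mu>"
proof -
  let ?s = "transpose j (j + 1)"
  have "inv \<mu> (j + 1) < inv \<mu> j"
    using assms(4) permutes_values_neq[OF permutes_inv[OF assms(1)], of j "j + 1"] by auto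
  then have "inv (?s \<circ> \<mu>) j < inv (?s \<circ> \<mu>) (j + 1)"
    unfolding inv_transpose_comp[OF assms(1)] by simp
  then have "bruhat_step n (?s \<circ> \<mu>) (?s \<circ> (?s \<circ> \<mu>))"
    by (intro bruhat_step_adjacent_left permutes_transpose_comp assms)
  moreover have "?s \<circ> (?s \<circ> \<mu>) = \<mu>" by (simp add: fun_eq_iff)
  ultimately show ?thesis by (simp only:)
qed

text \<open>Exchanging the values j and j + 1 in an increasing pair of values reverses its order
  only if the pair is (j, j + 1), and that step is the excluded one.\<close>

lemma bruhat_step_left:
  assumes "\<mu> permutes {1..n}" "1 \<le> j" "j < n" "bruhat_step n \<mu> \<nu>" "\<nu> \<noteq> transpose j (j + 1) \<circ> \<mu>"
  shows "bruhat_step n (transpose j (j + 1) \<circ> \<mu>) (transpose j (j + 1) \<circ> \<nu>)"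
proof -
  let ?s = "transpose j (j + 1)"
  obtain a b where ab: "1 \<le> a" "a < b" "b \<le> n" "\<mu> a < \<mu> b" "\<nu> = \<mu> \<circ> transpose a b"
    using assms bruhat_step_iff by blast
  have "(\<mu> a, \<mu> b) \<noteq> (j, j + 1)"
  proof
    assume "(\<mu> a, \<mu> b) = (j, j + 1)"
    then have "inv \<mu> j = a" "inv \<mu> (j + 1) = b"
      using permutes_inverses(2)[OF assms(1)] by (metis prod.inject)+
    then show False using assms(5) ab(5) transpose_comp_left[OF assms(1), of j "j + 1"] by simp
  qed
  then have "?s (\<mu> a) < ?s (\<mu> b)" using ab(4) by (auto simp: transpose_def)
  then have "bruhat_step n (?s \<circ> \<mu>) (?s \<circ> \<mu> \<circ> transpose a b)"
    by (intro bruhat_stepI permutes_transpose_comp assms ab(1-3)) simp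
  then show ?thesis by (simp only: ab(5) comp_assoc)
qed

lemma bruhat_step_up_down_left:
  assumes "\<mu> permutes {1..n}" "1 \<le> j" "j < n" "bruhat_step n \<mu> \<nu>"
  shows "bruhat_le n (up_left j \<mu>) (up_left j \<nu>) \<and> bruhat_le n (down_left j \<mu>) (down_left j \<nu>)"
proof -
  let ?s = "transpose j (j + 1)"
  have \<nu>: "\<nu> permutes {1..n}" using assms bruhat_step_permutes by blast
  show ?thesis
  proof (cases "\<nu> = ?s \<circ> \<mu>")
    case True
    have "inv \<mu> j < inv \<mu> (j + 1)"
    proof (rule ccontr)
      assume "\<not> inv \<mu> j < inv \<mu> (j + 1)"
      then have "bruhat_step n \<nu> \<mu>" using bruhat_step_adjacent_left_descent assms True by blast
      then show False using assms(4) by (auto simp: bruhat_step_def)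
    qed
    then show ?thesis using True inv_transpose_comp[OF assms(1), of j "j + 1"]
      by (simp add: up_left_def down_left_def bruhat_le_refl flip: comp_assoc)
  next
    case False
    have "bruhat_le n \<mu> \<nu>" using assms(4) by (rule bruhat_step_le)
    moreover have "bruhat_le n (?s \<circ> \<mu>) (?s \<circ> \<nu>)"
      using bruhat_step_left[OF assms False] by (rule bruhat_step_le)
    moreover have "bruhat_le n \<mu> (?s \<circ> \<mu>)" if "inv \<mu> j < inv \<mu> (j + 1)"
      by (rule bruhat_step_le[OF bruhat_step_adjacent_left[OF assms(1-3) that]])
    moreover have "bruhat_le n (?s \<circ> \<mu>) \<mu>" if "\<not> inv \<mu> j < inv \<mu> (j + 1)"
      by (rule bruhat_step_le[OF bruhat_step_adjacent_left_descent[OF assms(1-3) that]])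
    moreover have "bruhat_le n \<nu> (?s \<circ> \<nu>)" if "inv \<nu> j < inv \<nu> (j + 1)"
      by (rule bruhat_step_le[OF bruhat_step_adjacent_left[OF \<nu> assms(2,3) that]])
    moreover have "bruhat_le n (?s \<circ> \<nu>) \<nu>" if "\<not> inv \<nu> j < inv \<nu> (j + 1)"
      by (rule bruhat_step_le[OF bruhat_step_adjacent_left_descent[OF \<nu> assms(2,3) that]])
    ultimately show ?thesis unfolding up_left_def down_left_def
      by (cases "inv \<mu> j < inv \<mu> (j + 1)"; cases "inv \<nu> j < inv \<nu> (j + 1)") (simp_all only: if_True if_False simp_thms, (blast intro: bruhat_le_trans)+)
  qed
qed

lemma bruhat_le_up_down_left:
  assumes "bruhat_le n \<mu> \<nu>" "\<mu> permutes {1..n}" "1 \<le> j" "j < n"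
  shows "bruhat_le n (up_left j \<mu>) (up_left j \<nu>)" "bruhat_le n (down_left j \<mu>) (down_left j \<nu>)"
proof -
  have "bruhat_le n (up_left j \<mu>) (up_left j \<nu>) \<and> bruhat_le n (down_left j \<mu>) (down_left j \<nu>)"
    using assms(1)[unfolded bruhat_le_def]
  proof (induction rule: rtranclp_induct)
    case (step \<nu> \<rho>)
    then have "\<nu> permutes {1..n}" using bruhat_le_permutes assms(2) by (auto simp: bruhat_le_def)
    then show ?case using step bruhat_step_up_down_left[of \<nu> n j \<rho>] assms(3,4) bruhat_le_trans by blast
  qed (simp add: bruhat_le_refl)
  then show "bruhat_le n (up_left j \<mu>) (up_left j \<nu>)" "bruhat_le n (down_left j \<mu>) (down_left j \<nu>)"
    by auto
qed

section \<open>Maximal elements of a coset below a permutation\<close>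

text \<open>A coset of a Young subgroup is described by the block \<open>c v\<close> in which each
  value v has to be placed, rather than by a representative: left multiplication by s_j then just
  replaces \<open>c\<close> by its composition with s_j.\<close>

definition block_coset :: "nat \<Rightarrow> (nat \<Rightarrow> nat) \<Rightarrow> (nat \<Rightarrow> nat) \<Rightarrow> (nat \<Rightarrow> nat) set" where
  "block_coset n blk c = {x. x permutes {1..n} \<and> (\<forall>p\<in>{1..n}. c (x p) = blk p)}"

lemma block_coset_left:
  assumes "x \<in> block_coset n blk c" "1 \<le> j" "j < n"
  shows "transpose j (j + 1) \<circ> x \<in> block_coset n blk (c \<circ> transpose j (j + 1))"
  using assms permutes_transpose_comp[of x n j] by (simp add: block_coset_def)

lemma block_coset_inv:
  assumes "x \<in> block_coset n blk c" "1 \<le> v" "v \<le> n"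
  shows "blk (inv x v) = c v"
proof -
  have x: "x permutes {1..n}" using assms(1) by (simp add: block_coset_def)
  then have "inv x v \<in> {1..n}" using inv_in_range[OF x] assms by simp
  then have "c (x (inv x v)) = blk (inv x v)" using assms(1) by (simp add: block_coset_def)
  then show ?thesis using permutes_inverses(1)[OF x] by simp
qed

lemma bruhat_le_up_left:
  assumes "x permutes {1..n}" "1 \<le> j" "j < n"
  shows "bruhat_le n x (up_left j x)"
  using bruhat_step_le[OF bruhat_step_adjacent_left[OF assms]]
  by (simp add: up_left_def bruhat_le_refl)

lemma transpose_comp_twice: "transpose a b \<circ> (transpose a b \<circ> f) = f"
  by (simp add: fun_eq_iff)

lemma bruhat_le_up_down_left_self:
  assumes "x permutes {1..n}" "1 \<le> j" "j < n"
  shows "bruhat_le n x (up_left j (down_left j x))"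
proof (cases "inv x j < inv x (j + 1)")
  case True
  then show ?thesis using bruhat_le_up_left[OF assms] by (simp add: down_left_def)
next
  case False
  let ?s = "transpose j (j + 1)"
  have "inv x (j + 1) < inv x j"
    using False permutes_values_neq[OF permutes_inv[OF assms(1)], of j "j + 1"] by auto
  then have "inv (?s \<circ> x) j < inv (?s \<circ> x) (j + 1)"
    unfolding inv_transpose_comp[OF assms(1)] by simp
  then have "up_left j (?s \<circ> x) = x"
    unfolding up_left_def transpose_comp_twice by (simp only: if_True)
  then show ?thesis using False by (simp only: down_left_def if_False bruhat_le_refl)
qed

lemma bruhat_le_id:
  assumes "bruhat_le n x id" "x permutes {1..n}"
  shows "x = id"
proof -
  have "inversions n id = {}" by (auto simp: inversions_def)
  then have "coxeter_length n id = 0"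
    by (simp only: coxeter_length_eq_inversions[OF permutes_id] card.empty)
  then show ?thesis using bruhat_le_length[OF assms(1)] by simp
qed

text \<open>A left descent of \<open>\<mu>\<close> at \<open>j\<close> either permutes the coset within itself or exchanges it
  with a second coset, and then one of the two consists of left ascents at \<open>j\<close> only.\<close>

lemma block_coset_max:
  assumes "mono blk" "\<mu> permutes {1..n}" "x\<^sub>0 \<in> block_coset n blk c" "bruhat_le n x\<^sub>0 \<mu>"
  shows "\<exists>m\<in>block_coset n blk c. bruhat_le n m \<mu> \<and>
    (\<forall>x\<in>block_coset n blk c. bruhat_le n x \<mu> \<longrightarrow> bruhat_le n x m)"
  using assms(2-4)
proof (induction "coxeter_length n \<mu>" arbitrary: \<mu> c x\<^sub>0 rule: less_induct)
  case less
  note \<mu> = less.prems(1)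
  have perm: "x permutes {1..n}" if "x \<in> block_coset n blk d" for x d
    using that by (simp add: block_coset_def)
  show ?case
  proof (cases "\<exists>j. 1 \<le> j \<and> j < n \<and> inv \<mu> (j + 1) < inv \<mu> j")
    case False
    have "inv \<mu> = id"
    proof (rule permutes_id_if_no_descent[OF permutes_inv[OF \<mu>]])
      fix j assume "1 \<le> j" "j < n"
      then show "inv \<mu> j < inv \<mu> (j + 1)"
        using False permutes_values_neq[OF permutes_inv[OF \<mu>], of j "j + 1"]
        by (metis linorder_neqE_nat n_not_Suc_n Suc_eq_plus1)
    qed
    then have "\<mu> = id" using permutes_inv_inv[OF \<mu>] by (metis inv_id)
    have "x = id" if "x \<in> block_coset n blk c" "bruhat_le n x \<mu>" for x
      using bruhat_le_id perm that \<open>\<mu> = id\<close> by blast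
    then show ?thesis using less.prems(2,3) bruhat_le_refl by blast
  next
    case True
    then obtain j where j: "1 \<le> j" "j < n" "inv \<mu> (j + 1) < inv \<mu> j" by blast
    let ?s = "transpose j (j + 1)"
    let ?\<nu> = "?s \<circ> \<mu>"
    have \<nu>: "?\<nu> permutes {1..n}" by (rule permutes_transpose_comp[OF \<mu> j(1,2)])
    have step: "bruhat_step n ?\<nu> \<mu>"
      by (rule bruhat_step_adjacent_left_descent[OF \<mu> j(1,2)]) (use j(3) in simp)
    then have len: "coxeter_length n ?\<nu> < coxeter_length n \<mu>" by (auto simp: bruhat_step_def)
    have \<nu>\<mu>: "bruhat_le n ?\<nu> \<mu>" using step by (rule bruhat_step_le)
    have down_\<mu>: "down_left j \<mu> = ?\<nu>" using j(3) by (simp add: down_left_def)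
    have up_\<nu>: "up_left j ?\<nu> = \<mu>"
      using j(3) unfolding up_left_def inv_transpose_comp[OF \<mu>] transpose_comp_twice by simp
    have down: "bruhat_le n (down_left j x) ?\<nu>" if "bruhat_le n x \<mu>" "x permutes {1..n}" for x
      using bruhat_le_up_down_left(2)[OF that j(1,2)] by (simp only: down_\<mu>)
    have up: "bruhat_le n (up_left j x) \<mu>" if "bruhat_le n x ?\<nu>" "x permutes {1..n}" for x
      using bruhat_le_up_down_left(1)[OF that j(1,2)] by (simp only: up_\<nu>)
    have lift: "bruhat_le n x (up_left j m)" if "bruhat_le n (down_left j x) m" "x permutes {1..n}" for x m
    proof -
      have "down_left j x permutes {1..n}"
        using that(2) permutes_transpose_comp[OF that(2) j(1,2)] by (simp add: down_left_def)
      then have "bruhat_le n (up_left j (down_left j x)) (up_left j m)"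
        using bruhat_le_up_down_left(1)[OF that(1)] j by blast
      then show ?thesis using bruhat_le_up_down_left_self[OF that(2) j(1,2)] bruhat_le_trans by blast
    qed
    have IH: "\<exists>m\<in>block_coset n blk d. bruhat_le n m ?\<nu> \<and>
        (\<forall>x\<in>block_coset n blk d. bruhat_le n x ?\<nu> \<longrightarrow> bruhat_le n x m)"
      if "y \<in> block_coset n blk d" "bruhat_le n y ?\<nu>" for y d
      using less.hyps[OF len \<nu> that] .
    \<comment> \<open>If the value j belongs to an earlier block than j + 1, it also stands earlier,
      because \<open>blk\<close> is monotone; so the whole coset consists of left ascents at
      j.\<close>
    have asc: "inv x j < inv x (j + 1)" if "x \<in> block_coset n blk d" "d j < d (j + 1)" for x d
    proof (rule ccontr)
      assume "\<not> ?thesis"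
      then have "blk (inv x (j + 1)) \<le> blk (inv x j)" using assms(1) by (simp add: monoD)
      then show False using that block_coset_inv[OF that(1), of j] block_coset_inv[OF that(1), of "j + 1"] j
        by simp
    qed
    consider "c j = c (j + 1)" | "c j < c (j + 1)" | "c (j + 1) < c j" by linarith
    then show ?thesis
    proof cases
      case 1
      then have cs: "c \<circ> ?s = c" by (auto simp: transpose_def fun_eq_iff)
      have down_mem: "down_left j x \<in> block_coset n blk c" if "x \<in> block_coset n blk c" for x
        using that block_coset_left[OF that j(1,2)] cs by (simp add: down_left_def)
      have up_mem: "up_left j x \<in> block_coset n blk c" if "x \<in> block_coset n blk c" for x
        using that block_coset_left[OF that j(1,2)] cs by (simp add: up_left_def)
      obtain m where m: "m \<in> block_coset n blk c" "bruhat_le n m ?\<nu>"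
        "\<And>x. x \<in> block_coset n blk c \<Longrightarrow> bruhat_le n x ?\<nu> \<Longrightarrow> bruhat_le n x m"
        using IH[OF down_mem[OF less.prems(2)] down[OF less.prems(3) perm[OF less.prems(2)]]] by blast
      have "bruhat_le n x (up_left j m)" if "x \<in> block_coset n blk c" "bruhat_le n x \<mu>" for x
        using lift m(3)[OF down_mem[OF that(1)]] down that perm by blast
      then show ?thesis using up_mem[OF m(1)] up[OF m(2) perm[OF m(1)]] by blast
    next
      case 2
      \<comment> \<open>On a coset of left ascents \<open>down_left\<close> is the identity, so its
        elements below \<mu> already lie below s_j \<mu>, and the maximum found there serves
        unchanged.\<close>
      have "bruhat_le n x ?\<nu>" if "x \<in> block_coset n blk c" "bruhat_le n x \<mu>" for x
        using down[OF that(2) perm[OF that(1)]] asc[OF that(1) 2] by (simp only: down_left_def if_True)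
      then show ?thesis using IH less.prems(2,3) \<nu>\<mu> bruhat_le_trans by meson
    next
      case 3
      \<comment> \<open>Here the coset consists of left descents; s_j carries it to the coset of
        \<open>?d\<close>, which consists of left ascents, and the maximum found there is lifted
        back by \<open>up_left\<close>.\<close>
      let ?d = "c \<circ> ?s"
      have d: "?d j < ?d (j + 1)" using 3 by simp
      have mem: "?s \<circ> x \<in> block_coset n blk ?d" if "x \<in> block_coset n blk c" for x
        using block_coset_left[OF that j(1,2)] .
      have "down_left j x = ?s \<circ> x" if "x \<in> block_coset n blk c" for x
      proof -
        have "inv (?s \<circ> x) j < inv (?s \<circ> x) (j + 1)" using asc[OF mem[OF that] d] .
        then show ?thesis unfolding inv_transpose_comp[OF perm[OF that]] down_left_def by simp
      qed
      then have down_mem: "down_left j x \<in> block_coset n blk ?d" if "x \<in> block_coset n blk c" for x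
        using mem that by simp
      obtain m where m: "m \<in> block_coset n blk ?d" "bruhat_le n m ?\<nu>"
        "\<And>x. x \<in> block_coset n blk ?d \<Longrightarrow> bruhat_le n x ?\<nu> \<Longrightarrow> bruhat_le n x m"
        using IH[OF down_mem[OF less.prems(2)] down[OF less.prems(3) perm[OF less.prems(2)]]] by blast
      have "?d \<circ> ?s = c" by (simp add: fun_eq_iff)
      then have "up_left j m \<in> block_coset n blk c"
        using block_coset_left[OF m(1) j(1,2)] asc[OF m(1) d] by (simp only: up_left_def if_True)
      moreover have "bruhat_le n x (up_left j m)" if "x \<in> block_coset n blk c" "bruhat_le n x \<mu>" for x
        using lift m(3)[OF down_mem[OF that(1)]] down that perm by blast
      ultimately show ?thesis using up[OF m(2) perm[OF m(1)]] by blast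
    qed
  qed
qed

section \<open>The sum over chains\<close>

text \<open>With the initial cut \<open>lo\<close> as a parameter, dropping the first block is a recursion on \<open>ks\<close>.\<close>

primrec chain_labels :: "nat \<Rightarrow> nat \<Rightarrow> nat list \<Rightarrow> (nat \<times> nat) list" where
  "chain_labels n lo [] = []"
| "chain_labels n lo (k # ks) = chain_labels n k ks @ block n lo k"

lemma W_list_eq: "W_list n ks = chain_labels n 0 ks"
proof -
  have "concat (map (\<lambda>i. block n ((lo # ks @ [n]) ! (i - 1)) ((lo # ks @ [n]) ! i)) (rev [1..<length ks + 1]))
     = chain_labels n lo ks" for lo
  proof (induction ks arbitrary: lo)
    case (Cons k ks)
    have "[1..<length (k # ks) + 1] = 1 # map Suc [1..<length ks + 1]"
      by (simp add: map_Suc_upt upt_conv_Cons del: upt_Suc)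
    then have "rev [1..<length (k # ks) + 1] = map Suc (rev [1..<length ks + 1]) @ [1]"
      by (simp add: rev_map del: upt_Suc)
    then have "concat (map (\<lambda>i. block n ((lo # (k # ks) @ [n]) ! (i - 1)) ((lo # (k # ks) @ [n]) ! i)) (rev [1..<length (k # ks) + 1]))
      = concat (map (\<lambda>i. block n ((lo # (k # ks) @ [n]) ! (i - 1)) ((lo # (k # ks) @ [n]) ! i)) (map Suc (rev [1..<length ks + 1])))
        @ block n lo k"
      by (simp only: map_append concat_append) simp
    also have "map (\<lambda>i. block n ((lo # (k # ks) @ [n]) ! (i - 1)) ((lo # (k # ks) @ [n]) ! i)) (map Suc (rev [1..<length ks + 1]))
      = map (\<lambda>i. block n ((k # ks @ [n]) ! (i - 1)) ((k # ks @ [n]) ! i)) (rev [1..<length ks + 1])"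
      unfolding map_map by (rule map_cong) (auto simp: nth_Cons')
    also have "concat \<dots> = chain_labels n k ks" by (rule Cons.IH)
    finally show ?case by simp
  qed simp
  from this[of 0] show ?thesis
    by (simp only: W_list_def W_block_def[abs_def] cuts_def block_def row_def[abs_def])
qed

lemma set_block: "set (block n lo k) = {lo<..k} \<times> {k<..n}"
  by (auto simp: block_def set_row)

lemma distinct_block: "distinct (block n lo k)"
proof -
  have "distinct as \<Longrightarrow> distinct (concat (map (row n k) as))" for as
    by (induction as) (auto simp: set_row, simp add: row_def distinct_map inj_on_def)
  then show ?thesis by (simp add: block_def del: upt_Suc)
qed

lemma chain_labels_range:
  assumes "sorted_wrt (<) (lo # ks)"
  shows "set (chain_labels n lo ks) \<subseteq> {(a, b). lo < a \<and> a < b \<and> b \<le> n}"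
  using assms
proof (induction ks arbitrary: lo)
  case (Cons k ks)
  then have "set (chain_labels n k ks) \<subseteq> {(a, b). k < a \<and> a < b \<and> b \<le> n}" "lo < k" by auto
  then show ?case by (auto simp: set_block)
qed simp

lemma distinct_chain_labels:
  assumes "sorted_wrt (<) (lo # ks)"
  shows "distinct (chain_labels n lo ks)"
  using assms
proof (induction ks arbitrary: lo)
  case (Cons k ks)
  then have "set (chain_labels n k ks) \<subseteq> {(a, b). k < a \<and> a < b \<and> b \<le> n}"
    by (intro chain_labels_range) auto
  then show ?case using Cons by (auto simp: set_block distinct_block)
qed simp

section \<open>From products of cover operators to sums over chains\<close>

lemma transp_prod_Cons: "transp_prod ((a, b) # w) = transpose a b \<circ> transp_prod w"
  by (simp add: transp_prod_def)

lemma transp_prod_Nil: "transp_prod [] = id"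
  by (simp add: transp_prod_def)

lemma valid_chain_Nil: "valid_chain n \<sigma> []"
  by (simp add: valid_chain_def)

text \<open>Validity is defined through the lengths reached after all prefixes. Once the first step
  raises the length by one, the remaining conditions are those of the tail started at the new
  permutation, which makes a recursion along the label list possible.\<close>

lemma valid_chain_Cons:
  assumes "\<sigma> permutes {1..n}" "1 \<le> a" "a < b" "b \<le> n"
  shows "valid_chain n \<sigma> ((a, b) # w) \<longleftrightarrow> cover \<sigma> a b \<and> valid_chain n (\<sigma> \<circ> transpose a b) w"
proof -
  have split: "{1..length ((a, b) # w)} = insert 1 (Suc ` {1..length w})"
    by (simp add: image_Suc_atLeastAtMost atLeastAtMost_insertL numeral_2_eq_2)
  have "valid_chain n \<sigma> ((a, b) # w) \<longleftrightarrow>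
      coxeter_length n (\<sigma> \<circ> transpose a b) = coxeter_length n \<sigma> + 1 \<and>
      (\<forall>j\<in>{1..length w}. coxeter_length n (\<sigma> \<circ> transpose a b \<circ> transp_prod (take j w)) = coxeter_length n \<sigma> + Suc j)"
    unfolding valid_chain_def split
    by (simp only: ball_simps take_Suc_Cons One_nat_def take_0 transp_prod_Cons transp_prod_Nil comp_id comp_assoc)
  also have "\<dots> \<longleftrightarrow> coxeter_length n (\<sigma> \<circ> transpose a b) = coxeter_length n \<sigma> + 1 \<and>
      valid_chain n (\<sigma> \<circ> transpose a b) w"
    unfolding valid_chain_def by (rule conj_cong[OF refl], rule ball_cong[OF refl]) simp
  finally show ?thesis using coxeter_length_cover_iff[OF assms] by simp
qed

lemma subseq_Cons_eq: "{v. subseq v (t # w)} = {v. subseq v w} \<union> (#) t ` {v. subseq v w}"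
proof (intro set_eqI iffI)
  fix v assume "v \<in> {v. subseq v (t # w)}"
  then show "v \<in> {v. subseq v w} \<union> (#) t ` {v. subseq v w}"
    by (cases v) (auto split: if_splits)
qed auto

lemma finite_subseq: "finite {v. subseq v w}"
proof -
  have "{v. subseq v w} = set (subseqs w)" by auto
  then show ?thesis by simp
qed

text \<open>Expansion of the product: each label is either skipped or, where it is a cover, used
  with the sign -1. Distinct labels keep the subwords that skip the first label apart from those
  that use it.\<close>

lemma cover_ops_eq_sum_chains:
  assumes "\<sigma> permutes {1..n}" "distinct w" "set w \<subseteq> {(a, b). 1 \<le> a \<and> a < b \<and> b \<le> n}"
  shows "cover_ops w (frag_of \<sigma>) = (\<Sum>v\<in>{v. subseq v w \<and> valid_chain n \<sigma> v}. chain_term \<sigma> v)"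
  using assms
proof (induction w arbitrary: \<sigma>)
  case Nil
  have "{v. subseq v ([] :: (nat \<times> nat) list) \<and> valid_chain n \<sigma> v} = {[]}"
    by (auto simp: valid_chain_Nil)
  then show ?case by (simp add: chain_term_def transp_prod_Nil)
next
  case (Cons t w)
  obtain a b where t: "t = (a, b)" by fastforce
  have ab: "1 \<le> a" "a < b" "b \<le> n" using Cons.prems(3) t by auto
  let ?\<tau> = "\<sigma> \<circ> transpose a b"
  have \<tau>: "?\<tau> permutes {1..n}" using Cons.prems(1) ab by (intro permutes_comp_transpose) auto
  let ?V = "\<lambda>\<rho>. {v. subseq v w \<and> valid_chain n \<rho> v}"
  let ?T = "if cover \<sigma> a b then (#) t ` ?V ?\<tau> else {}"
  have fin: "finite (?V \<rho>)" for \<rho> using finite_subseq[of w] by (rule finite_subset[rotated]) auto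
  have split: "{v. subseq v (t # w) \<and> valid_chain n \<sigma> v} = ?V \<sigma> \<union> ?T"
  proof -
    have "{v. subseq v (t # w) \<and> valid_chain n \<sigma> v} = {v \<in> {v. subseq v w} \<union> (#) t ` {v. subseq v w}. valid_chain n \<sigma> v}"
      using subseq_Cons_eq[of t w] by blast
    then show ?thesis using valid_chain_Cons[OF Cons.prems(1) ab] t by auto
  qed
  have "t \<notin> set w" using Cons.prems(2) by simp
  then have disj: "?V \<sigma> \<inter> ?T = {}" by (auto dest: list_emb_set)
  have chain_Cons: "chain_term \<sigma> (t # v) = - chain_term ?\<tau> v" for v
    by (simp add: chain_term_def transp_prod_Cons t comp_assoc)
  have "(\<Sum>v\<in>(#) t ` ?V ?\<tau>. chain_term \<sigma> v) = (\<Sum>v\<in>?V ?\<tau>. chain_term \<sigma> (t # v))"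
    by (subst sum.reindex) (auto simp: o_def)
  then have T: "(\<Sum>v\<in>?T. chain_term \<sigma> v) = (if cover \<sigma> a b then - (\<Sum>v\<in>?V ?\<tau>. chain_term ?\<tau> v) else 0)"
    by (simp add: chain_Cons sum_negf)
  have IH: "cover_ops w (frag_of \<rho>) = (\<Sum>v\<in>?V \<rho>. chain_term \<rho> v)" if "\<rho> permutes {1..n}" for \<rho>
    using Cons.IH[OF that] Cons.prems(2,3) by simp
  have "cover_ops (t # w) (frag_of \<sigma>) =
      (if cover \<sigma> a b then cover_ops w (frag_of \<sigma>) - cover_ops w (frag_of ?\<tau>) else cover_ops w (frag_of \<sigma>))"
    by (simp add: t cover_op_of cover_ops_diff)
  also have "\<dots> = (\<Sum>v\<in>?V \<sigma>. chain_term \<sigma> v) + (\<Sum>v\<in>?T. chain_term \<sigma> v)"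
    unfolding T IH[OF \<tau>] IH[OF Cons.prems(1)] by simp
  also have "\<dots> = (\<Sum>v\<in>?V \<sigma> \<union> ?T. chain_term \<sigma> v)"
    using disj fin by (intro sum.union_disjoint[symmetric]) auto
  finally show ?case unfolding split .
qed

lemma E_sum_eq:
  assumes "\<sigma> permutes {1..n}" "sorted_wrt (<) ks" "set ks \<subseteq> {1..<n}"
  shows "E_sum n \<sigma> ks = cover_ops (chain_labels n 0 ks) (frag_of \<sigma>)"
proof -
  have "sorted_wrt (<) (0 # ks)" using assms(2,3) by auto
  moreover from this have "set (chain_labels n 0 ks) \<subseteq> {(a, b). 1 \<le> a \<and> a < b \<and> b \<le> n}"
    using chain_labels_range by fastforce
  ultimately show ?thesis unfolding E_sum_def valid_chains_def W_list_eq
    by (intro cover_ops_eq_sum_chains[symmetric] assms(1) distinct_chain_labels)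
qed

text \<open>Each label in turn meets the unchanged K_\<sigma>, so a condition on \<sigma> alone
  settles the whole list.\<close>

lemma cover_ops_no_cover:
  assumes "\<And>a b. (a, b) \<in> set w \<Longrightarrow> \<not> \<sigma> a < \<sigma> b"
  shows "cover_ops w (frag_of \<sigma>) = frag_of \<sigma>"
  using assms
proof (induction w)
  case (Cons p w)
  obtain a b where p: "p = (a, b)" by fastforce
  then have "\<not> cover \<sigma> a b" using Cons.prems by (simp add: cover_def)
  then have "cover_op p (frag_of \<sigma>) = frag_of \<sigma>" by (simp add: p cover_op_of)
  moreover have "cover_ops w (frag_of \<sigma>) = frag_of \<sigma>"
    by (rule Cons.IH, rule Cons.prems) simp
  ultimately show ?case by simp
qed simp

lemma keys_cover_ops:
  assumes "Poly_Mapping.keys x \<subseteq> A"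
    and "\<And>\<tau> a b. \<tau> \<in> A \<Longrightarrow> (a, b) \<in> set w \<Longrightarrow> \<tau> \<circ> transpose a b \<in> A"
  shows "Poly_Mapping.keys (cover_ops w x) \<subseteq> A"
  using assms
proof (induction w arbitrary: x)
  case (Cons p w)
  obtain a b where p: "p = (a, b)" by fastforce
  have "Poly_Mapping.keys (cover_op p x) \<subseteq> A"
  proof -
    have "Poly_Mapping.keys (if cover \<tau> a b then frag_of \<tau> - frag_of (\<tau> \<circ> transpose a b) else frag_of \<tau>) \<subseteq> A"
      if "\<tau> \<in> Poly_Mapping.keys x" for \<tau>
    proof -
      have "\<tau> \<in> A" using that Cons.prems(1) by blast
      moreover have "\<tau> \<circ> transpose a b \<in> A"
        by (rule Cons.prems(2)[OF calculation]) (simp add: p)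
      ultimately show ?thesis
        using keys_diff[of "frag_of \<tau>" "frag_of (\<tau> \<circ> transpose a b)"] by (auto simp: keys_frag_of)
    qed
    then show ?thesis unfolding p cover_op_def fst_conv snd_conv
      using keys_frag_extend by fastforce
  qed
  then show ?case using Cons.IH Cons.prems(2) by simp
qed simp

lemma decreasing_on_interval:
  fixes \<sigma> :: "nat \<Rightarrow> nat"
  assumes "a < b" "\<And>i. a \<le> i \<Longrightarrow> i < b \<Longrightarrow> \<sigma> (i + 1) < \<sigma> i"
  shows "\<sigma> b < \<sigma> a"
  using assms
proof (induction b rule: less_induct)
  case (less b)
  show ?case
  proof (cases "b = a + 1")
    case True
    then show ?thesis using less.prems(2)[of a] by simp
  next
    case False
    then have "\<sigma> (b - 1) < \<sigma> a" using less.prems by (intro less.IH) auto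
    moreover have "\<sigma> b < \<sigma> (b - 1)" using less.prems(2)[of "b - 1"] less.prems(1) by simp
    ultimately show ?thesis by simp
  qed
qed

text \<open>In a permutation that decreases within the blocks, no pair inside a block is ever a cover:
  the earlier labels only move later positions.\<close>

lemma cover_ops_full_rows:
  assumes "sorted_wrt (<) (lo # ks)" "set ks \<subseteq> {..<n}" "lo \<le> n"
    and "\<And>i. lo < i \<Longrightarrow> i < n \<Longrightarrow> i \<notin> set ks \<Longrightarrow> \<sigma> (i + 1) < \<sigma> i"
  shows "cover_ops (full_rows n lo n) (frag_of \<sigma>) = cover_ops (chain_labels n lo ks) (frag_of \<sigma>)"
  using assms
proof (induction ks arbitrary: lo)
  case Nil
  have "cover_ops (full_rows n lo n) (frag_of \<sigma>) = frag_of \<sigma>"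
  proof (rule cover_ops_no_cover)
    fix a b assume "(a, b) \<in> set (full_rows n lo n)"
    then have ab: "lo < a" "a < b" "b \<le> n" by (auto simp: full_rows_def set_row)
    have "\<sigma> b < \<sigma> a"
    proof (rule decreasing_on_interval[OF ab(2)])
      fix i assume "a \<le> i" "i < b"
      then show "\<sigma> (i + 1) < \<sigma> i" using ab by (intro Nil.prems(4)) auto
    qed
    then show "\<not> \<sigma> a < \<sigma> b" by simp
  qed
  then show ?case by simp
next
  case (Cons k ks)
  have k: "lo < k" "k < n" "sorted_wrt (<) (k # ks)" "\<And>i. i \<in> set ks \<Longrightarrow> k < i"
    using Cons.prems(1,2) by auto
  let ?x = "cover_ops (chain_labels n k ks) (frag_of \<sigma>)"
  let ?A = "{\<tau>. \<forall>p\<le>k. \<tau> p = \<sigma> p}"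
  have IH: "cover_ops (full_rows n k n) (frag_of \<sigma>) = ?x"
  proof (rule Cons.IH[OF k(3)])
    fix i assume "k < i" "i < n" "i \<notin> set ks"
    then show "\<sigma> (i + 1) < \<sigma> i" using k(1) by (intro Cons.prems(4)) auto
  qed (use Cons.prems(2) k(2) in auto)
  have keys: "Poly_Mapping.keys ?x \<subseteq> ?A"
  proof (rule keys_cover_ops)
    fix \<tau> a b assume "\<tau> \<in> ?A" "(a, b) \<in> set (chain_labels n k ks)"
    moreover from this have "k < a" "k < b" using chain_labels_range[OF k(3), of n] by auto
    ultimately show "\<tau> \<circ> transpose a b \<in> ?A" by (auto simp: transpose_def)
  qed (simp add: keys_frag_of)
  obtain Q where Q: "\<forall>(a, b)\<in>set Q. lo < a \<and> a < b \<and> b \<le> k"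
    "cover_ops (full_rows n lo k) = cover_ops (Q @ block n lo k)"
    using full_rows_eq_block[of lo k n] k by auto
  have "cover_ops Q ?x = ?x"
  proof (rule additive_ext[where f = "cover_ops Q" and g = "\<lambda>x. x"])
    fix \<tau> assume "\<tau> \<in> Poly_Mapping.keys ?x"
    then have \<tau>: "\<forall>p\<le>k. \<tau> p = \<sigma> p" using keys by blast
    show "cover_ops Q (frag_of \<tau>) = frag_of \<tau>"
    proof (rule cover_ops_no_cover)
      fix a b assume "(a, b) \<in> set Q"
      then have ab: "lo < a" "a < b" "b \<le> k" using Q(1) by auto
      have "\<sigma> b < \<sigma> a"
      proof (rule decreasing_on_interval[OF ab(2)])
        fix i assume "a \<le> i" "i < b"
        then show "\<sigma> (i + 1) < \<sigma> i"
          using ab k(2) k(4)[of i] by (intro Cons.prems(4)) auto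
      qed
      then show "\<not> \<tau> a < \<tau> b" using \<tau> ab by simp
    qed
  qed (simp_all add: cover_ops_diff)
  moreover have "full_rows n lo n = full_rows n k n @ full_rows n lo k"
    using full_rows_split[of lo k n n] k by simp
  ultimately show ?case using IH Q(2) by simp
qed

lemma commutes_pi_chain_labels:
  assumes "i \<notin> set ks" "i \<noteq> lo" "i < n"
  shows "commutes_pi i (chain_labels n lo ks)"
  using assms
proof (induction ks arbitrary: lo)
  case (Cons k ks)
  then have "commutes_pi i (chain_labels n k ks)" by (intro Cons.IH) auto
  moreover have "commutes_pi i (block n lo k)" using Cons.prems by (intro commutes_pi_block) auto
  ultimately show ?case unfolding chain_labels.simps by (rule commutes_pi_append)
qed (simp add: commutes_pi_Nil)

section \<open>The action on the longest permutation\<close>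

lemma reduced_word_snoc:
  assumes "reduced_word n y (u @ [i])"
  shows "reduced_word n (simple_prod u) u" "1 \<le> i" "i < n"
    "simple_prod u i < simple_prod u (i + 1)" "y = simple_prod u \<circ> transpose i (i + 1)"
proof -
  let ?z = "simple_prod u"
  have u: "set u \<subseteq> {1..<n}" and len: "coxeter_length n y = length u + 1"
    using assms by (auto simp: reduced_word_def)
  show i: "1 \<le> i" "i < n" using assms by (auto simp: reduced_word_def)
  show y: "y = ?z \<circ> transpose i (i + 1)"
    using assms unfolding reduced_word_def simple_prod_append simple_prod_single by blast
  have z: "?z permutes {1..n}" using u by (rule simple_prod_permutes)
  have yp: "y permutes {1..n}" unfolding y using z i by (intro permutes_comp_transpose) auto
  have le: "coxeter_length n ?z \<le> length u"
    using card_inversions_simple_prod[OF u] coxeter_length_eq_inversions[OF z] by linarith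
  show asc: "?z i < ?z (i + 1)"
  proof (rule ccontr)
    assume "\<not> ?z i < ?z (i + 1)"
    then have "?z (i + 1) < ?z i" using permutes_values_neq[OF z, of i "i + 1"] by auto
    from card_inversions_descent[OF i permutes_inj[OF z] this]
    have "coxeter_length n ?z = coxeter_length n y + 1"
      unfolding coxeter_length_eq_inversions[OF z] coxeter_length_eq_inversions[OF yp] unfolding y .
    then show False using len le by linarith
  qed
  have "coxeter_length n y = coxeter_length n ?z + 1"
    unfolding y using coxeter_length_adjacent[OF z i asc] .
  then show "reduced_word n ?z u" using u len by (simp add: reduced_word_def)
qed

lemma reduced_word_permutes: "reduced_word n y u \<Longrightarrow> y permutes {1..n}"
  unfolding reduced_word_def using simple_prod_permutes by blast

lemma longest_perm_involutory: "longest_perm n \<circ> longest_perm n = id"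
  by (auto simp: longest_perm_def fun_eq_iff)

lemma longest_perm_permutes: "longest_perm n permutes {1..n}"
proof (rule bij_imp_permutes)
  show "bij_betw (longest_perm n) {1..n} {1..n}"
    by (rule bij_betw_byWitness[where f' = "longest_perm n"])
      (auto simp: longest_perm_def)
qed (auto simp: longest_perm_def)

lemma longest_perm_less:
  "a \<in> {1..n} \<Longrightarrow> b \<in> {1..n} \<Longrightarrow> a < b \<Longrightarrow> longest_perm n b < longest_perm n a"
  by (auto simp: longest_perm_def)

lemma bruhat_le_longest_perm: "bruhat_le n (longest_perm n) \<mu> \<longleftrightarrow> \<mu> = longest_perm n"
proof
  assume "bruhat_le n (longest_perm n) \<mu>"
  then show "\<mu> = longest_perm n" unfolding bruhat_le_def
  proof (cases rule: converse_rtranclpE)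
    case (step \<nu>)
    then obtain a b where "1 \<le> a" "a < b" "b \<le> n" "longest_perm n a < longest_perm n b"
      using bruhat_step_iff[OF longest_perm_permutes] by blast
    then show ?thesis using longest_perm_less[of a n b] by simp
  qed simp
qed (simp add: bruhat_le_refl)

lemma longest_comp_descent:
  assumes "y permutes {1..n}" "1 \<le> i" "i < n" "y i < y (i + 1)"
  shows "(longest_perm n \<circ> y) (i + 1) < (longest_perm n \<circ> y) i"
  using longest_perm_less[of "y i" n "y (i + 1)"] permutes_in_image[OF assms(1), of i]
    permutes_in_image[OF assms(1), of "i + 1"] assms by simp

lemma pi_hat_word_snoc: "pi_hat_word (u @ [i]) x = pi_hat_op i (pi_hat_word u x)"
  by (simp add: pi_hat_word_def)

lemma pi_word_snoc: "pi_word (u @ [i]) x = pi_op i (pi_word u x)"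
  by (simp add: pi_word_def)

text \<open>As \<omega> reverses the order of values, each letter of a reduced word of y is a
  descent of \<omega> times the current prefix, so \<open>pi_hat_op_full_rows\<close> applies letter
  by letter. The start is K_\<omega>, which all the cover operators of the list fix.\<close>

lemma pi_hat_word_longest:
  assumes "reduced_word n y u"
  shows "pi_hat_word u (frag_of (longest_perm n)) =
    cover_ops (full_rows n 0 n) (frag_of (longest_perm n \<circ> y))"
  using assms
proof (induction u arbitrary: y rule: rev_induct)
  case Nil
  have "cover_ops (full_rows n 0 n) (frag_of (longest_perm n)) = frag_of (longest_perm n)"
  proof (rule cover_ops_no_cover)
    fix a b assume "(a, b) \<in> set (full_rows n 0 n)"
    then show "\<not> longest_perm n a < longest_perm n b"
      using longest_perm_less[of a n b] by (auto simp: full_rows_def set_row)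
  qed
  moreover have "y = id" using Nil by (simp add: reduced_word_def simple_prod_Nil)
  ultimately show ?case by (simp add: pi_hat_word_def)
next
  case (snoc i u)
  let ?z = "simple_prod u"
  note z = reduced_word_snoc[OF snoc.prems]
  have zp: "?z permutes {1..n}" using z(1) by (rule reduced_word_permutes)
  have "pi_hat_word (u @ [i]) (frag_of (longest_perm n)) =
      pi_hat_op i (cover_ops (full_rows n 0 n) (frag_of (longest_perm n \<circ> ?z)))"
    unfolding pi_hat_word_snoc snoc.IH[OF z(1)] ..
  also have "\<dots> = cover_ops (full_rows n 0 n) (frag_of (longest_perm n \<circ> ?z \<circ> transpose i (i + 1)))"
  proof (rule pi_hat_op_full_rows[OF z(2,3)])
    show "inj (longest_perm n \<circ> ?z)"
      using permutes_inj[OF longest_perm_permutes] permutes_inj[OF zp] by (rule inj_compose)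
    show "(longest_perm n \<circ> ?z) (i + 1) < (longest_perm n \<circ> ?z) i"
      by (rule longest_comp_descent[OF zp z(2-4)])
  qed
  finally show ?case unfolding z(5) comp_assoc .
qed

section \<open>Signed indicators of sets of permutations and their behaviour under \<pi>_i\<close>

lemma
  shows lookup_pi_op_ascent: "\<mu> i < \<mu> (i + 1) \<Longrightarrow>
      Poly_Mapping.lookup (pi_op i x) \<mu> = Poly_Mapping.lookup x \<mu> + Poly_Mapping.lookup x (\<mu> \<circ> transpose i (i + 1))"
    and lookup_pi_op_descent: "\<mu> (i + 1) < \<mu> i \<Longrightarrow> Poly_Mapping.lookup (pi_op i x) \<mu> = 0"
    and lookup_pi_op_level: "\<mu> i = \<mu> (i + 1) \<Longrightarrow> Poly_Mapping.lookup (pi_op i x) \<mu> = Poly_Mapping.lookup x \<mu>"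
proof -
  let ?s = "transpose i (i + 1)"
  have swap: "\<mu> = \<sigma> \<circ> ?s \<longleftrightarrow> \<mu> \<circ> ?s = \<sigma>" for \<sigma>
    using comp_transpose_twice[of \<mu> i "i + 1"] comp_transpose_twice[of \<sigma> i "i + 1"] by metis
  have val: "\<sigma> i = \<mu> (i + 1) \<and> \<sigma> (i + 1) = \<mu> i" if "\<mu> \<circ> ?s = \<sigma>" for \<sigma>
    unfolding that[symmetric] by simp
  have of: "Poly_Mapping.lookup (pi_op i (frag_of \<sigma>)) \<mu> =
      (if \<sigma> (i + 1) < \<sigma> i then of_bool (\<mu> \<circ> ?s = \<sigma>) else of_bool (\<mu> = \<sigma>))" for \<sigma>
    unfolding pi_op_of swap[symmetric] by simp
  show "Poly_Mapping.lookup (pi_op i x) \<mu> = Poly_Mapping.lookup x \<mu> + Poly_Mapping.lookup x (\<mu> \<circ> ?s)"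
    if "\<mu> i < \<mu> (i + 1)"
  proof (rule additive_ext[where f = "\<lambda>x. Poly_Mapping.lookup (pi_op i x) \<mu>"
        and g = "\<lambda>x. Poly_Mapping.lookup x \<mu> + Poly_Mapping.lookup x (\<mu> \<circ> ?s)"])
    fix \<sigma>
    show "Poly_Mapping.lookup (pi_op i (frag_of \<sigma>)) \<mu> =
        Poly_Mapping.lookup (frag_of \<sigma>) \<mu> + Poly_Mapping.lookup (frag_of \<sigma>) (\<mu> \<circ> ?s)"
      unfolding of lookup_frag_of using that val[of \<sigma>] by (cases "\<mu> \<circ> ?s = \<sigma>"; cases "\<mu> = \<sigma>") auto
  qed (simp_all add: pi_op_diff lookup_minus)
  show "Poly_Mapping.lookup (pi_op i x) \<mu> = 0" if "\<mu> (i + 1) < \<mu> i"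
  proof (rule additive_ext[where f = "\<lambda>x. Poly_Mapping.lookup (pi_op i x) \<mu>" and g = "\<lambda>x. 0"])
    fix \<sigma>
    show "Poly_Mapping.lookup (pi_op i (frag_of \<sigma>)) \<mu> = 0"
      unfolding of using that val[of \<sigma>] by (cases "\<mu> \<circ> ?s = \<sigma>"; cases "\<mu> = \<sigma>") auto
  qed (simp_all add: pi_op_diff lookup_minus)
  \<comment> \<open>Equal neighbouring entries occur only off the permutations; the case completes
    the description of the operator on the whole free module.\<close>
  show "Poly_Mapping.lookup (pi_op i x) \<mu> = Poly_Mapping.lookup x \<mu>" if "\<mu> i = \<mu> (i + 1)"
  proof (rule additive_ext[where f = "\<lambda>x. Poly_Mapping.lookup (pi_op i x) \<mu>" and g = "\<lambda>x. Poly_Mapping.lookup x \<mu>"])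
    fix \<sigma>
    show "Poly_Mapping.lookup (pi_op i (frag_of \<sigma>)) \<mu> = Poly_Mapping.lookup (frag_of \<sigma>) \<mu>"
      unfolding of lookup_frag_of using that val[of \<sigma>] by (cases "\<mu> \<circ> ?s = \<sigma>"; cases "\<mu> = \<sigma>") auto
  qed (simp_all add: pi_op_diff lookup_minus)
qed

text \<open>The sum of the lengths stands for their difference, which has the same parity but could
  be truncated in \<open>nat\<close>.\<close>

definition signed_indicator :: "nat \<Rightarrow> (nat \<Rightarrow> nat) \<Rightarrow> (nat \<Rightarrow> nat) set \<Rightarrow> ((nat \<Rightarrow> nat) \<Rightarrow>\<^sub>0 int) \<Rightarrow> bool" where
  "signed_indicator n \<sigma> S x \<longleftrightarrow> S \<subseteq> {\<mu>. \<mu> permutes {1..n}} \<and>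
     (\<forall>\<mu>. Poly_Mapping.lookup x \<mu> = (if \<mu> \<in> S then (-1) ^ (coxeter_length n \<sigma> + coxeter_length n \<mu>) else 0))"

lemma permutes_comp_adjacent_iff:
  fixes n :: nat
  assumes "1 \<le> i" "i < n"
  shows "\<mu> \<circ> transpose i (i + 1) permutes {1..n} \<longleftrightarrow> \<mu> permutes {1..n}"
proof
  assume "\<mu> \<circ> transpose i (i + 1) permutes {1..n}"
  then have "\<mu> \<circ> transpose i (i + 1) \<circ> transpose i (i + 1) permutes {1..n}"
    by (rule permutes_comp_transpose) (use assms in auto)
  then show "\<mu> permutes {1..n}" unfolding comp_transpose_twice .
qed (use assms in \<open>intro permutes_comp_transpose, auto\<close>)

lemma coxeter_length_adjacent_descent:
  assumes "\<sigma> permutes {1..n}" "1 \<le> i" "i < n" "\<sigma> (i + 1) < \<sigma> i"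
  shows "coxeter_length n \<sigma> = coxeter_length n (\<sigma> \<circ> transpose i (i + 1)) + 1"
proof -
  have \<tau>: "\<sigma> \<circ> transpose i (i + 1) permutes {1..n}" using assms permutes_comp_adjacent_iff by blast
  show ?thesis
    unfolding coxeter_length_eq_inversions[OF assms(1)] coxeter_length_eq_inversions[OF \<tau>]
    by (rule card_inversions_descent[OF assms(2,3) permutes_inj[OF assms(1)] assms(4)])
qed

lemma descent_up_down:
  assumes "\<sigma> (i + 1) < \<sigma> i"
  shows "up_right i \<sigma> = \<sigma>" "down_right i \<sigma> = \<sigma> \<circ> transpose i (i + 1)"
    "up_right i (\<sigma> \<circ> transpose i (i + 1)) = \<sigma>"
    "down_right i (\<sigma> \<circ> transpose i (i + 1)) = \<sigma> \<circ> transpose i (i + 1)"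
  using assms unfolding up_right_def down_right_def comp_transpose_twice by simp_all

lemma ascent_up_down:
  assumes "\<mu> i < \<mu> (i + 1)"
  shows "up_right i \<mu> = \<mu> \<circ> transpose i (i + 1)" "down_right i \<mu> = \<mu>"
    "up_right i (\<mu> \<circ> transpose i (i + 1)) = \<mu> \<circ> transpose i (i + 1)"
    "down_right i (\<mu> \<circ> transpose i (i + 1)) = \<mu>"
  using assms unfolding up_right_def down_right_def comp_transpose_twice by simp_all

lemma bruhat_le_up_right:
  assumes "x permutes {1..n}" "1 \<le> i" "i < n"
  shows "bruhat_le n x (up_right i x)"
  using bruhat_step_le[OF bruhat_step_adjacent[OF assms]]
  by (simp add: up_right_def bruhat_le_refl)

lemma bruhat_le_up_down_right_self:
  assumes "x permutes {1..n}" "1 \<le> i" "i < n"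
  shows "bruhat_le n x (up_right i (down_right i x))"
proof (cases "x i < x (i + 1)")
  case True
  then show ?thesis using bruhat_le_up_right[OF assms] by (simp only: ascent_up_down)
next
  case False
  then have "x (i + 1) < x i" using permutes_values_neq[OF assms(1), of i "i + 1"] by auto
  then show ?thesis by (simp only: descent_up_down bruhat_le_refl)
qed

text \<open>The parameter e treats both operators at once: e = 1 gives \<pi>_i - 1 and e = 0 gives
  \<pi>_i. Since \<sigma> s_i is shorter than \<sigma> by one and \<mu> s_i is longer than an
  ascending \<mu> by one, all signs can be divided out, which leaves identities between indicator
  functions.\<close>

lemma signed_indicator_step:
  assumes x: "signed_indicator n \<sigma> S x" and \<sigma>: "\<sigma> permutes {1..n}" "1 \<le> i" "i < n" "\<sigma> (i + 1) < \<sigma> i"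
    and T: "T \<subseteq> {\<mu>. \<mu> permutes {1..n}}"
  defines "s \<equiv> transpose i (i + 1)"
  assumes asc: "\<And>\<mu>. \<mu> permutes {1..n} \<Longrightarrow> \<mu> i < \<mu> (i + 1) \<Longrightarrow>
      of_bool (\<mu> \<circ> s \<in> S) - of_bool (\<mu> \<in> S) + e * of_bool (\<mu> \<in> S) = (of_bool (\<mu> \<in> T) :: int)"
    and desc: "\<And>\<mu>. \<mu> permutes {1..n} \<Longrightarrow> \<mu> (i + 1) < \<mu> i \<Longrightarrow>
      e * of_bool (\<mu> \<in> S) = (of_bool (\<mu> \<in> T) :: int)"
  shows "signed_indicator n (\<sigma> \<circ> s) T (pi_op i x - frag_cmul e x)"
  unfolding signed_indicator_def
proof (intro conjI allI T)
  fix \<mu>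
  let ?c = "coxeter_length n"
  have look: "Poly_Mapping.lookup x \<nu> = of_bool (\<nu> \<in> S) * (-1) ^ (?c \<sigma> + ?c \<nu>)" for \<nu>
    using x by (simp add: signed_indicator_def)
  have len: "?c \<sigma> = ?c (\<sigma> \<circ> s) + 1"
    unfolding s_def by (rule coxeter_length_adjacent_descent[OF \<sigma>])
  have diff: "Poly_Mapping.lookup (pi_op i x - frag_cmul e x) \<mu> =
      Poly_Mapping.lookup (pi_op i x) \<mu> - e * Poly_Mapping.lookup x \<mu>"
    by (simp add: lookup_minus)
  have "Poly_Mapping.lookup (pi_op i x - frag_cmul e x) \<mu> = of_bool (\<mu> \<in> T) * (-1) ^ (?c (\<sigma> \<circ> s) + ?c \<mu>)"
  proof (cases "\<mu> permutes {1..n}")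
    case False
    then have out: "\<mu> \<notin> S" "\<mu> \<circ> s \<notin> S" "\<mu> \<notin> T"
      using x T permutes_comp_adjacent_iff[OF \<sigma>(2,3), of \<mu>] by (auto simp: signed_indicator_def s_def)
    have "Poly_Mapping.lookup (pi_op i x) \<mu> = 0"
    proof (cases "\<mu> i" "\<mu> (i + 1)" rule: linorder_cases)
      case less
      then show ?thesis using lookup_pi_op_ascent[OF less, of x] out by (simp add: look s_def)
    next
      case equal
      then show ?thesis using lookup_pi_op_level[OF equal, of x] out by (simp add: look)
    next
      case greater
      then show ?thesis by (rule lookup_pi_op_descent)
    qed
    then show ?thesis unfolding diff using out by (simp add: look)
  next
    case perm: True
    consider "\<mu> i < \<mu> (i + 1)" | "\<mu> (i + 1) < \<mu> i"
      using permutes_values_neq[OF perm, of i "i + 1"] by fastforce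
    then show ?thesis
    proof cases
      case 1
      have l: "?c (\<mu> \<circ> s) = ?c \<mu> + 1" unfolding s_def by (rule coxeter_length_adjacent[OF perm \<sigma>(2,3) 1])
      show ?thesis
        unfolding diff lookup_pi_op_ascent[OF 1, folded s_def] look l len asc[OF perm 1, symmetric]
        by (simp add: algebra_simps)
    next
      case 2
      show ?thesis
        unfolding diff lookup_pi_op_descent[OF 2] look len desc[OF perm 2, symmetric] by simp
    qed
  qed
  then show "Poly_Mapping.lookup (pi_op i x - frag_cmul e x) \<mu> =
      (if \<mu> \<in> T then (-1) ^ (?c (\<sigma> \<circ> s) + ?c \<mu>) else 0)" by simp
qed

definition upper_set :: "nat \<Rightarrow> (nat \<Rightarrow> nat) \<Rightarrow> (nat \<Rightarrow> nat) set" where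
  "upper_set n \<sigma> = {\<mu>. \<mu> permutes {1..n} \<and> bruhat_le n \<sigma> \<mu>}"

text \<open>The coefficients are the values of the Moebius function of the Bruhat order. For
  \<sigma> descending at i the lifting property gives two equivalences: if \<mu> ascends at i, then
  \<mu> s_i lies above \<sigma> iff \<mu> lies above \<sigma> s_i; if \<mu> descends at i, then
  \<mu> lies above \<sigma> iff it lies above \<sigma> s_i.\<close>

lemma signed_indicator_pi_hat_word:
  assumes "reduced_word n y u"
  shows "signed_indicator n (longest_perm n \<circ> y) (upper_set n (longest_perm n \<circ> y))
    (pi_hat_word u (frag_of (longest_perm n)))"
  using assms
proof (induction u arbitrary: y rule: rev_induct)
  case Nil
  have "y = id" using Nil by (simp add: reduced_word_def simple_prod_Nil)
  moreover have "upper_set n (longest_perm n) = {longest_perm n}"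
    using longest_perm_permutes by (auto simp: upper_set_def bruhat_le_longest_perm)
  ultimately show ?case using longest_perm_permutes
    by (simp add: pi_hat_word_def signed_indicator_def)
next
  case (snoc i u)
  let ?z = "simple_prod u" and ?s = "transpose i (i + 1)"
  let ?\<sigma> = "longest_perm n \<circ> ?z"
  note z = reduced_word_snoc[OF snoc.prems]
  have zp: "?z permutes {1..n}" using z(1) by (rule reduced_word_permutes)
  have \<sigma>: "?\<sigma> permutes {1..n}" using zp longest_perm_permutes by (rule permutes_compose)
  have desc: "?\<sigma> (i + 1) < ?\<sigma> i" by (rule longest_comp_descent[OF zp z(2-4)])
  have \<tau>: "?\<sigma> \<circ> ?s permutes {1..n}" using \<sigma> permutes_comp_adjacent_iff[OF z(2,3)] by blast
  have "signed_indicator n (?\<sigma> \<circ> ?s) (upper_set n (?\<sigma> \<circ> ?s))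
      (pi_op i (pi_hat_word u (frag_of (longest_perm n))) - frag_cmul 1 (pi_hat_word u (frag_of (longest_perm n))))"
  proof (rule signed_indicator_step[OF snoc.IH[OF z(1)] \<sigma> z(2,3) desc])
    fix \<mu> :: "nat \<Rightarrow> nat" assume perm: "\<mu> permutes {1..n}"
    { assume asc: "\<mu> i < \<mu> (i + 1)"
      have "\<mu> \<circ> ?s permutes {1..n}" using perm permutes_comp_adjacent_iff[OF z(2,3)] by blast
      moreover have "bruhat_le n ?\<sigma> (\<mu> \<circ> ?s) \<longleftrightarrow> bruhat_le n (?\<sigma> \<circ> ?s) \<mu>"
        using bruhat_le_up_down_right(2)[OF _ \<sigma> z(2,3), of "\<mu> \<circ> ?s"]
          bruhat_le_up_down_right(1)[OF _ \<tau> z(2,3), of \<mu>]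
        unfolding ascent_up_down[of \<mu>, OF asc] descent_up_down[of ?\<sigma>, OF desc] by blast
      ultimately show "of_bool (\<mu> \<circ> ?s \<in> upper_set n ?\<sigma>) - of_bool (\<mu> \<in> upper_set n ?\<sigma>) +
          1 * of_bool (\<mu> \<in> upper_set n ?\<sigma>) = (of_bool (\<mu> \<in> upper_set n (?\<sigma> \<circ> ?s)) :: int)"
        using perm by (simp add: upper_set_def) }
    { assume desc': "\<mu> (i + 1) < \<mu> i"
      have "bruhat_le n (?\<sigma> \<circ> ?s) ?\<sigma>"
        by (rule bruhat_step_le[OF bruhat_step_adjacent_descent[OF \<sigma> z(2,3)]]) (use desc in simp)
      then have "bruhat_le n ?\<sigma> \<mu> \<longleftrightarrow> bruhat_le n (?\<sigma> \<circ> ?s) \<mu>"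
        using bruhat_le_up_down_right(1)[OF _ \<tau> z(2,3), of \<mu>] bruhat_le_trans
        unfolding descent_up_down[of \<mu>, OF desc'] descent_up_down[of ?\<sigma>, OF desc] by blast
      then show "1 * of_bool (\<mu> \<in> upper_set n ?\<sigma>) = (of_bool (\<mu> \<in> upper_set n (?\<sigma> \<circ> ?s)) :: int)"
        by (simp add: upper_set_def) }
  qed (auto simp: upper_set_def)
  then show ?case unfolding z(5) pi_hat_word_snoc pi_hat_op_def comp_assoc by (simp only: frag_cmul_one)
qed

section \<open>Young subgroups\<close>

text \<open>For increasing \<open>ks\<close> this is the number of cuts below p, that is, the index
  of the block containing p, counted from 0.\<close>

definition block_index :: "nat list \<Rightarrow> nat \<Rightarrow> nat" where
  "block_index ks p = length (takeWhile (\<lambda>k. k < p) ks)"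

lemma mono_block_index: "mono (block_index ks)"
proof (rule monoI)
  fix p q :: nat assume "p \<le> q"
  then show "block_index ks p \<le> block_index ks q"
    by (induction ks) (auto simp: block_index_def)
qed

lemma block_index_eq_iff:
  assumes "sorted_wrt (<) ks" "1 \<le> p" "p \<le> n" "i \<le> length ks"
  shows "p \<in> {cuts n ks ! i + 1..cuts n ks ! (i + 1)} \<longleftrightarrow> block_index ks p = i"
proof -
  have lower: "cuts n ks ! i = (if i = 0 then 0 else ks ! (i - 1))"
    using assms(4) by (cases i) (auto simp: cuts_def nth_append)
  have upper: "cuts n ks ! (i + 1) = (if i < length ks then ks ! i else n)"
    using assms(4) by (auto simp: cuts_def nth_append)
  show ?thesis
  proof
    assume p: "p \<in> {cuts n ks ! i + 1..cuts n ks ! (i + 1)}"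
    have "takeWhile (\<lambda>k. k < p) ks = take i ks"
    proof (rule takeWhile_eq_take_P_nth)
      fix j assume j: "j < i" "j < length ks"
      then have "ks ! j \<le> ks ! (i - 1)"
        using sorted_wrt_nth_less[OF assms(1), of j "i - 1"] assms(4) j
        by (cases "j = i - 1") (auto simp: less_imp_le)
      then show "ks ! j < p" using p j(1) lower by auto
    qed (use p upper in auto)
    then show "block_index ks p = i" using assms(4) by (simp add: block_index_def)
  next
    assume i: "block_index ks p = i"
    have "ks ! (i - 1) < p" if "i > 0"
    proof -
      have "i - 1 < length (takeWhile (\<lambda>k. k < p) ks)" using that i by (simp add: block_index_def)
      then have "takeWhile (\<lambda>k. k < p) ks ! (i - 1) \<in> set (takeWhile (\<lambda>k. k < p) ks)"
        "takeWhile (\<lambda>k. k < p) ks ! (i - 1) = ks ! (i - 1)"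
        by (auto intro: nth_mem takeWhile_nth)
      then show ?thesis by (metis set_takeWhileD)
    qed
    moreover have "p \<le> ks ! i" if "i < length ks"
      using nth_length_takeWhile[of "\<lambda>k. k < p" ks] that i by (simp add: block_index_def)
    ultimately show "p \<in> {cuts n ks ! i + 1..cuts n ks ! (i + 1)}"
      unfolding lower upper using assms(2,3) by auto
  qed
qed

lemma block_index_le: "block_index ks p \<le> length ks"
  by (simp add: block_index_def length_takeWhile_le)

lemma block_index_adjacent:
  assumes "sorted_wrt (<) ks"
  shows "block_index ks i = block_index ks (i + 1) \<longleftrightarrow> i \<notin> set ks"
proof
  assume "i \<notin> set ks"
  then show "block_index ks i = block_index ks (i + 1)"
    unfolding block_index_def
    by (intro arg_cong[where f = length] takeWhile_cong refl) (metis less_Suc_eq Suc_eq_plus1)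
next
  assume eq: "block_index ks i = block_index ks (i + 1)"
  show "i \<notin> set ks"
  proof
    assume "i \<in> set ks"
    then obtain j where j: "j < length ks" "ks ! j = i" by (auto simp: in_set_conv_nth)
    have "block_index ks (i + 1) = j + 1"
    proof -
      have "takeWhile (\<lambda>k. k < i + 1) ks = take (j + 1) ks"
      proof (rule takeWhile_eq_take_P_nth)
        fix l assume "l < j + 1" "l < length ks"
        then show "ks ! l < i + 1"
          using sorted_wrt_nth_less[OF assms, of l j] j by (cases "l = j") auto
      next
        assume "j + 1 < length ks"
        then show "\<not> ks ! (j + 1) < i + 1"
          using sorted_wrt_nth_less[OF assms, of j "j + 1"] j by auto
      qed
      then show ?thesis using j by (simp add: block_index_def)
    qed
    moreover have "block_index ks i = j"
    proof -
      have "takeWhile (\<lambda>k. k < i) ks = take j ks"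
      proof (rule takeWhile_eq_take_P_nth)
        fix l assume "l < j" "l < length ks"
        then show "ks ! l < i" using sorted_wrt_nth_less[OF assms, of l j] j by auto
      qed (use j in auto)
      then show ?thesis using j by (simp add: block_index_def)
    qed
    ultimately show False using eq by simp
  qed
qed

lemma young_subgroup_iff:
  assumes "sorted_wrt (<) ks" "set ks \<subseteq> {1..<n}"
  shows "\<tau> \<in> young_subgroup n ks \<longleftrightarrow>
    \<tau> permutes {1..n} \<and> (\<forall>p\<in>{1..n}. block_index ks (\<tau> p) = block_index ks p)"
proof (cases "\<tau> permutes {1..n}")
  case \<tau>: True
  let ?B = "\<lambda>i. {cuts n ks ! i + 1..cuts n ks ! (i + 1)}"
  have B: "?B i = {p \<in> {1..n}. block_index ks p = i}" if "i \<le> length ks" for i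
  proof -
    have "cuts n ks ! (i + 1) \<le> n"
    proof -
      have "cuts n ks ! (i + 1) \<in> set (ks @ [n])"
        using that by (simp add: cuts_def del: set_append)
      then show ?thesis using assms(2) by auto
    qed
    then have range: "p \<in> ?B i \<Longrightarrow> 1 \<le> p \<and> p \<le> n" for p by auto
    have "p \<in> ?B i \<longleftrightarrow> p \<in> {1..n} \<and> block_index ks p = i" for p
      using block_index_eq_iff[OF assms(1) _ _ that, of p n] range[of p]
      by (meson atLeastAtMost_iff)
    then show ?thesis by blast
  qed
  have \<tau>_mem: "\<tau> p \<in> {1..n} \<longleftrightarrow> p \<in> {1..n}" for p using permutes_in_image[OF \<tau>] .
  have "(\<forall>i\<le>length ks. \<tau> ` ?B i = ?B i) \<longleftrightarrow> (\<forall>p\<in>{1..n}. block_index ks (\<tau> p) = block_index ks p)"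
  proof
    assume im: "\<forall>i\<le>length ks. \<tau> ` ?B i = ?B i"
    show "\<forall>p\<in>{1..n}. block_index ks (\<tau> p) = block_index ks p"
    proof
      fix p assume "p \<in> {1..n}"
      then have "p \<in> ?B (block_index ks p)" unfolding B[OF block_index_le] by blast
      then have "\<tau> p \<in> ?B (block_index ks p)" using im block_index_le by blast
      then show "block_index ks (\<tau> p) = block_index ks p" unfolding B[OF block_index_le] by blast
    qed
  next
    assume pres: "\<forall>p\<in>{1..n}. block_index ks (\<tau> p) = block_index ks p"
    show "\<forall>i\<le>length ks. \<tau> ` ?B i = ?B i"
    proof (intro allI impI)
      fix i assume i: "i \<le> length ks"
      have "\<tau> ` ?B i \<subseteq> ?B i" unfolding B[OF i] using pres \<tau>_mem by auto
      then show "\<tau> ` ?B i = ?B i"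
        using endo_inj_surj[of "?B i" \<tau>] permutes_inj[OF \<tau>] by (meson finite_atLeastAtMost inj_on_subset subset_UNIV)
    qed
  qed
  then show ?thesis using \<tau> by (simp only: young_subgroup_def mem_Collect_eq simp_thms)
qed (simp add: young_subgroup_def)

lemma id_in_young_subgroup: "id \<in> young_subgroup n ks"
  by (simp add: young_subgroup_def permutes_id)

text \<open>A crude bound; it guarantees that the maximum in the definition of \<open>zeta\<close>
  is attained.\<close>

lemma coxeter_length_bound:
  assumes "\<mu> permutes {1..n}"
  shows "coxeter_length n \<mu> < n * n + 1"
proof -
  have "card (inversions n \<mu>) \<le> card ({1..n} \<times> {1..n})"
    by (rule card_mono) (auto simp: inversions_def)
  then show ?thesis unfolding coxeter_length_eq_inversions[OF assms] by (simp add: card_cartesian_product)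
qed

lemma young_subgroup_adjacent:
  assumes "sorted_wrt (<) ks" "set ks \<subseteq> {1..<n}" "\<tau> \<in> young_subgroup n ks"
    "1 \<le> i" "i < n" "i \<notin> set ks"
  shows "\<tau> \<circ> transpose i (i + 1) \<in> young_subgroup n ks"
proof -
  have \<tau>: "\<tau> permutes {1..n}" "\<And>p. p \<in> {1..n} \<Longrightarrow> block_index ks (\<tau> p) = block_index ks p"
    using assms(3) young_subgroup_iff[OF assms(1,2)] by auto
  have eq: "block_index ks i = block_index ks (i + 1)"
    using block_index_adjacent[OF assms(1)] assms(6) by blast
  have "block_index ks (\<tau> (transpose i (i + 1) p)) = block_index ks p" if "p \<in> {1..n}" for p
    using \<tau>(2)[OF that] \<tau>(2)[of i] \<tau>(2)[of "i + 1"] eq assms(4,5)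
    by (cases "p = i"; cases "p = i + 1") auto
  then show ?thesis
    using young_subgroup_iff[OF assms(1,2)] permutes_comp_adjacent_iff[OF assms(4,5)] \<tau>(1) by simp
qed

text \<open>What is used of \<zeta> from here on. The last property comes from maximality: at an
  ascent i inside a block, \<zeta> s_i would be a longer element of the same coset. Hence \<zeta>
  decreases within each block.\<close>

lemma zeta_properties:
  assumes "\<sigma> permutes {1..n}" "sorted_wrt (<) ks" "set ks \<subseteq> {1..<n}"
  shows "zeta n \<sigma> ks permutes {1..n}" "inv (zeta n \<sigma> ks) \<circ> \<sigma> \<in> young_subgroup n ks"
    "\<forall>i\<in>{1..<n} - set ks. zeta n \<sigma> ks (i + 1) < zeta n \<sigma> ks i"
proof -
  let ?\<zeta> = "zeta n \<sigma> ks" and ?C = "(\<lambda>\<tau>. \<sigma> \<circ> \<tau>) ` young_subgroup n ks"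
  have perm: "\<mu> permutes {1..n}" if "\<mu> \<in> ?C" for \<mu>
    using that assms(1) by (auto simp: young_subgroup_def intro: permutes_compose)
  have "\<sigma> \<in> ?C" by (rule image_eqI[OF _ id_in_young_subgroup]) simp
  moreover have "\<forall>\<mu>. \<mu> \<in> ?C \<longrightarrow> coxeter_length n \<mu> < n * n + 1" using perm coxeter_length_bound by blast
  ultimately have max: "?\<zeta> \<in> ?C" "\<forall>\<mu>. \<mu> \<in> ?C \<longrightarrow> coxeter_length n \<mu> \<le> coxeter_length n ?\<zeta>"
    using arg_max_nat_lemma[of "\<lambda>\<mu>. \<mu> \<in> ?C" \<sigma> "coxeter_length n" "n * n + 1"]
    unfolding zeta_def by blast+
  show \<zeta>: "?\<zeta> permutes {1..n}" using perm max(1) by blast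
  obtain \<tau> where \<tau>: "\<tau> \<in> young_subgroup n ks" "?\<zeta> = \<sigma> \<circ> \<tau>" using max(1) by blast
  have \<tau>p: "\<tau> permutes {1..n}" "\<And>p. p \<in> {1..n} \<Longrightarrow> block_index ks (\<tau> p) = block_index ks p"
    using \<tau>(1) young_subgroup_iff[OF assms(2,3)] by auto
  have "inv ?\<zeta> \<circ> \<sigma> = inv \<tau>"
    unfolding \<tau>(2) o_inv_distrib[OF permutes_bij[OF assms(1)] permutes_bij[OF \<tau>p(1)]]
    using permutes_inv_o(2)[OF assms(1)] by (simp add: comp_assoc)
  moreover have "inv \<tau> \<in> young_subgroup n ks"
    unfolding young_subgroup_iff[OF assms(2,3)]
  proof (intro conjI ballI permutes_inv[OF \<tau>p(1)])
    fix p assume "p \<in> {1..n}"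
    then have "inv \<tau> p \<in> {1..n}" using permutes_in_image[OF permutes_inv[OF \<tau>p(1)]] by blast
    then show "block_index ks (inv \<tau> p) = block_index ks p"
      using \<tau>p(2)[of "inv \<tau> p"] permutes_inverses(1)[OF \<tau>p(1)] by simp
  qed
  ultimately show "inv ?\<zeta> \<circ> \<sigma> \<in> young_subgroup n ks" by simp
  show "\<forall>i\<in>{1..<n} - set ks. ?\<zeta> (i + 1) < ?\<zeta> i"
  proof (rule ballI, rule ccontr)
    fix i assume "i \<in> {1..<n} - set ks"
    then have i: "1 \<le> i" "i < n" "i \<notin> set ks" by auto
    assume "\<not> ?\<zeta> (i + 1) < ?\<zeta> i"
    then have "?\<zeta> i < ?\<zeta> (i + 1)" using permutes_values_neq[OF \<zeta>, of i "i + 1"] by auto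
    then have "coxeter_length n (?\<zeta> \<circ> transpose i (i + 1)) = coxeter_length n ?\<zeta> + 1"
      by (rule coxeter_length_adjacent[OF \<zeta> i(1,2)])
    moreover have "?\<zeta> \<circ> transpose i (i + 1) \<in> ?C"
      unfolding \<tau>(2) comp_assoc using young_subgroup_adjacent[OF assms(2,3) \<tau>(1) i] by blast
    ultimately show False using max(2) by force
  qed
qed

text \<open>A reduced word of an element of the Young subgroup only uses letters of that subgroup, and
  each of them is a descent of the corresponding prefix of \<open>\<zeta> y\<close>.\<close>

lemma young_reduced_word_snoc:
  assumes "sorted_wrt (<) ks" "set ks \<subseteq> {1..<n}" "\<zeta> permutes {1..n}"
    and dec: "\<forall>i\<in>{1..<n} - set ks. \<zeta> (i + 1) < \<zeta> i"
    and "reduced_word n y (u @ [i])" "y \<in> young_subgroup n ks"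
  shows "i \<notin> set ks" "simple_prod u \<in> young_subgroup n ks"
    "(\<zeta> \<circ> simple_prod u) (i + 1) < (\<zeta> \<circ> simple_prod u) i"
proof -
  let ?z = "simple_prod u" and ?b = "block_index ks"
  note z = reduced_word_snoc[OF assms(5)]
  have zp: "?z permutes {1..n}" using z(1) by (rule reduced_word_permutes)
  have y: "?b (y p) = ?b p" if "p \<in> {1..n}" for p
    using assms(6) young_subgroup_iff[OF assms(1,2)] that by blast
  have yi: "y i = ?z (i + 1)" "y (i + 1) = ?z i" unfolding z(5) by simp_all
  show i: "i \<notin> set ks"
  proof
    assume "i \<in> set ks"
    then have "?b i \<noteq> ?b (i + 1)" using block_index_adjacent[OF assms(1)] by blast
    \<comment> \<open>As y preserves the blocks, i and i + 1 lie in the blocks of z (i + 1) and of z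
      i respectively, and z i < z (i + 1).\<close>
    moreover have "?b (i + 1) \<le> ?b i"
      using y[of i] y[of "i + 1"] z(2-4) yi monoD[OF mono_block_index, of "?z i" "?z (i + 1)" ks] by simp
    moreover have "?b i \<le> ?b (i + 1)" by (rule monoD[OF mono_block_index]) simp
    ultimately show False by simp
  qed
  have "?z = y \<circ> transpose i (i + 1)" unfolding z(5) comp_transpose_twice ..
  then show mem: "?z \<in> young_subgroup n ks"
    using young_subgroup_adjacent[OF assms(1,2,6) z(2,3) i] by simp
  have "?b (?z i) = ?b i" "?b (?z (i + 1)) = ?b (i + 1)"
    using mem young_subgroup_iff[OF assms(1,2)] z(2,3) by auto
  then have eq: "?b (?z i) = ?b (?z (i + 1))"
    using block_index_adjacent[OF assms(1), of i] i by simp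
  have range: "1 \<le> ?z i" "?z (i + 1) \<le> n"
    using permutes_in_image[OF zp, of i] permutes_in_image[OF zp, of "i + 1"] z(2,3) by auto
  \<comment> \<open>Both z i and z (i + 1) lie in one block, so no cut occurs from z i up to z (i +
    1) - 1, and \<zeta> decreases all the way between them.\<close>
  have "\<zeta> (?z (i + 1)) < \<zeta> (?z i)"
  proof (rule decreasing_on_interval[OF z(4)])
    fix j assume j: "?z i \<le> j" "j < ?z (i + 1)"
    have "?b (?z i) \<le> ?b j" "?b j \<le> ?b (j + 1)" "?b (j + 1) \<le> ?b (?z (i + 1))"
      using j by (auto intro: monoD[OF mono_block_index])
    then have "j \<notin> set ks" using eq block_index_adjacent[OF assms(1), of j] by simp
    then show "\<zeta> (j + 1) < \<zeta> j" using j range by (intro bspec[OF dec]) auto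
  qed
  then show "(\<zeta> \<circ> ?z) (i + 1) < (\<zeta> \<circ> ?z) i" by simp
qed

text \<open>No letter of the word is a cut, so \<pi>_i passes through the product; on the basis
  vector it then meets a descent and simply exchanges two entries.\<close>

lemma pi_word_chain_labels:
  assumes "sorted_wrt (<) ks" "set ks \<subseteq> {1..<n}" "\<zeta> permutes {1..n}"
    and dec: "\<forall>i\<in>{1..<n} - set ks. \<zeta> (i + 1) < \<zeta> i"
    and "reduced_word n y v" "y \<in> young_subgroup n ks"
  shows "pi_word v (cover_ops (chain_labels n 0 ks) (frag_of \<zeta>)) =
    cover_ops (chain_labels n 0 ks) (frag_of (\<zeta> \<circ> y))"
  using assms(5,6)
proof (induction v arbitrary: y rule: rev_induct)
  case Nil
  then have "y = id" by (simp add: reduced_word_def simple_prod_Nil)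
  then show ?case by (simp add: pi_word_def)
next
  case (snoc i u)
  let ?z = "simple_prod u" and ?W = "cover_ops (chain_labels n 0 ks)"
  note z = reduced_word_snoc[OF snoc.prems(1)]
  note Y = young_reduced_word_snoc[OF assms(1-3) dec snoc.prems]
  have "commutes_pi i (chain_labels n 0 ks)"
    using Y(1) z(2,3) by (intro commutes_pi_chain_labels) auto
  then have "pi_op i (?W (frag_of (\<zeta> \<circ> ?z))) = ?W (pi_op i (frag_of (\<zeta> \<circ> ?z)))"
    by (simp add: commutes_pi_def)
  also have "pi_op i (frag_of (\<zeta> \<circ> ?z)) = frag_of (\<zeta> \<circ> ?z \<circ> transpose i (i + 1))"
    unfolding pi_op_of using Y(3) by (simp only: if_True)
  finally show ?case unfolding pi_word_snoc snoc.IH[OF z(1) Y(2)] z(5) comp_assoc .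
qed

text \<open>Along a reduced word of y every letter is a descent, hence a Bruhat step down that
  starts from \<zeta>: the longest element of the coset is also its Bruhat maximum.\<close>

lemma young_coset_le_max:
  assumes "sorted_wrt (<) ks" "set ks \<subseteq> {1..<n}" "\<zeta> permutes {1..n}"
    and dec: "\<forall>i\<in>{1..<n} - set ks. \<zeta> (i + 1) < \<zeta> i"
    and "y \<in> young_subgroup n ks"
  shows "bruhat_le n (\<zeta> \<circ> y) \<zeta>"
proof -
  have "y permutes {1..n}" using assms(5) by (simp add: young_subgroup_def)
  then obtain v where "reduced_word n y v" using reduced_word_exists by blast
  then show ?thesis using assms(5)
  proof (induction v arbitrary: y rule: rev_induct)
    case Nil
    then have "y = id" by (simp add: reduced_word_def simple_prod_Nil)
    then show ?case by (simp add: bruhat_le_refl)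
  next
    case (snoc i u)
    let ?z = "simple_prod u"
    note z = reduced_word_snoc[OF snoc.prems(1)]
    note Y = young_reduced_word_snoc[OF assms(1-3) dec snoc.prems]
    have "\<zeta> \<circ> ?z permutes {1..n}" using reduced_word_permutes[OF z(1)] assms(3) by (rule permutes_compose)
    then have "bruhat_step n (\<zeta> \<circ> ?z \<circ> transpose i (i + 1)) (\<zeta> \<circ> ?z)"
      by (rule bruhat_step_adjacent_descent[OF _ z(2,3)]) (use Y(3) in simp)
    then show ?case unfolding z(5)
      using bruhat_le_trans[OF bruhat_step_le snoc.IH[OF z(1) Y(2)]] by (simp only: comp_assoc)
  qed
qed

section \<open>Permutations below which \<sigma> is the largest element of its coset\<close>

definition coset_top :: "nat \<Rightarrow> (nat \<Rightarrow> nat) set \<Rightarrow> (nat \<Rightarrow> nat) \<Rightarrow> (nat \<Rightarrow> nat) set" where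
  "coset_top n C \<sigma> = {\<mu>. \<mu> permutes {1..n} \<and> bruhat_le n \<sigma> \<mu> \<and>
     (\<forall>x\<in>C. bruhat_le n x \<mu> \<longrightarrow> bruhat_le n x \<sigma>)}"

lemma coset_top_interval_closed:
  assumes "\<mu> \<in> coset_top n C \<sigma>" "bruhat_le n \<sigma> \<nu>" "bruhat_le n \<nu> \<mu>" "\<sigma> permutes {1..n}"
  shows "\<nu> \<in> coset_top n C \<sigma>"
  using assms bruhat_le_permutes[OF assms(2,4)] bruhat_le_trans by (auto simp: coset_top_def)

text \<open>For \<mu> ascending at i, the set attached to \<sigma> contains \<mu> s_i iff \<mu> lies
  in the set of \<sigma> or in that of \<sigma> s_i, and these two are disjoint; a descending \<mu>
  never lies in the set of \<sigma> s_i. So \<pi>_i turns one signed indicator into the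
  other.\<close>

lemma signed_indicator_coset_step:
  assumes "signed_indicator n \<sigma> (coset_top n C \<sigma>) x"
    and \<sigma>: "\<sigma> permutes {1..n}" "1 \<le> i" "i < n" "\<sigma> (i + 1) < \<sigma> i" and "\<sigma> \<in> C"
    and C: "\<And>\<rho>. \<rho> \<in> C \<Longrightarrow> \<rho> permutes {1..n}" "\<And>\<rho>. \<rho> \<in> C \<Longrightarrow> \<rho> \<circ> transpose i (i + 1) \<in> C"
    and max: "\<And>\<mu> y. \<mu> permutes {1..n} \<Longrightarrow> y \<in> C \<Longrightarrow> bruhat_le n y \<mu> \<Longrightarrow>
      \<exists>m\<in>C. bruhat_le n m \<mu> \<and> (\<forall>x\<in>C. bruhat_le n x \<mu> \<longrightarrow> bruhat_le n x m)"
  shows "signed_indicator n (\<sigma> \<circ> transpose i (i + 1)) (coset_top n C (\<sigma> \<circ> transpose i (i + 1))) (pi_op i x)"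
proof -
  let ?s = "transpose i (i + 1)"
  let ?\<tau> = "\<sigma> \<circ> ?s" and ?S = "coset_top n C \<sigma>" and ?T = "coset_top n C (\<sigma> \<circ> ?s)"
  have \<tau>: "?\<tau> permutes {1..n}" using \<sigma>(1) permutes_comp_adjacent_iff[OF \<sigma>(2,3)] by blast
  have \<tau>C: "?\<tau> \<in> C" using C(2) assms(6) .
  have len: "coxeter_length n \<sigma> = coxeter_length n ?\<tau> + 1"
    by (rule coxeter_length_adjacent_descent[OF \<sigma>])
  have not_le: "\<not> bruhat_le n \<sigma> ?\<tau>" using bruhat_le_length[of n \<sigma> ?\<tau>] len by auto
  have down_mem: "down_right i \<rho> \<in> C" if "\<rho> \<in> C" for \<rho> using that C(2)[OF that] by (simp add: down_right_def)
  have lift: "bruhat_le n \<rho> (up_right i m)" if "bruhat_le n (down_right i \<rho>) m" "\<rho> \<in> C" for \<rho> m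
    using bruhat_le_up_down_right(1)[OF that(1) C(1)[OF down_mem[OF that(2)]] \<sigma>(2,3)]
      bruhat_le_up_down_right_self[OF C(1)[OF that(2)] \<sigma>(2,3)] bruhat_le_trans by blast
  have "signed_indicator n ?\<tau> ?T (pi_op i x - frag_cmul 0 x)"
  proof (rule signed_indicator_step[OF assms(1) \<sigma>])
    fix \<mu> :: "nat \<Rightarrow> nat" assume \<mu>: "\<mu> permutes {1..n}"
    { assume desc: "\<mu> (i + 1) < \<mu> i"
      \<comment> \<open>For descending \<mu>, the lifting property turns \<sigma> s_i \<le> \<mu>
        into \<sigma> \<le> \<mu>, so \<sigma> s_i is not the largest element of the coset below
        \<mu>.\<close>
      have "\<mu> \<notin> ?T"
      proof
        assume "\<mu> \<in> ?T"
        moreover from this have "bruhat_le n \<sigma> \<mu>"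
          using bruhat_le_up_down_right(1)[OF _ \<tau> \<sigma>(2,3), of \<mu>]
          unfolding coset_top_def descent_up_down[of \<mu>, OF desc] descent_up_down[of \<sigma>, OF \<sigma>(4)] by blast
        ultimately show False using assms(6) not_le by (simp add: coset_top_def)
      qed
      then show "0 * of_bool (\<mu> \<in> ?S) = (of_bool (\<mu> \<in> ?T) :: int)" by simp }
    assume asc: "\<mu> i < \<mu> (i + 1)"
    let ?\<nu> = "\<mu> \<circ> ?s"
    have \<nu>: "?\<nu> permutes {1..n}" using \<mu> permutes_comp_adjacent_iff[OF \<sigma>(2,3)] by blast
    have \<mu>\<nu>: "bruhat_le n \<mu> ?\<nu>"
      by (rule bruhat_step_le[OF bruhat_step_adjacent[OF \<mu> \<sigma>(2,3) asc]])
    have down: "bruhat_le n (down_right i \<rho>) \<mu>" if "bruhat_le n \<rho> ?\<nu>" "\<rho> \<in> C" for \<rho>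
      using bruhat_le_up_down_right(2)[OF that(1) C(1)[OF that(2)] \<sigma>(2,3)]
      unfolding ascent_up_down[of \<mu>, OF asc] .
    \<comment> \<open>A bound \<kappa> for the coset elements below \<mu> yields the bound
      \<open>up_right i \<kappa>\<close> for those below \<mu> s_i. It is used for \<kappa> =
      \<sigma> and for \<kappa> = \<sigma> s_i; the new bound is \<sigma> in both cases.\<close>
    have below: "bruhat_le n \<rho> (up_right i \<kappa>)"
      if "\<And>x. x \<in> C \<Longrightarrow> bruhat_le n x \<mu> \<Longrightarrow> bruhat_le n x \<kappa>" "\<rho> \<in> C" "bruhat_le n \<rho> ?\<nu>" for \<rho> \<kappa>
      using lift[OF that(1)[OF down_mem[OF that(2)] down[OF that(3,2)]] that(2)] .
    have S: "?\<nu> \<in> ?S" if "\<mu> \<in> ?S"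
    proof -
      have "bruhat_le n \<sigma> ?\<nu>" using that \<mu>\<nu> bruhat_le_trans by (auto simp: coset_top_def)
      moreover have "bruhat_le n \<rho> \<sigma>" if "\<rho> \<in> C" "bruhat_le n \<rho> ?\<nu>" for \<rho>
        using below[of \<sigma>, OF _ that] \<open>\<mu> \<in> ?S\<close> unfolding descent_up_down[of \<sigma>, OF \<sigma>(4)]
        by (simp add: coset_top_def)
      ultimately show ?thesis using \<nu> by (simp add: coset_top_def)
    qed
    have not_T: "\<mu> \<notin> ?T" if "\<mu> \<in> ?S"
      using that assms(6) not_le by (auto simp: coset_top_def)
    have T: "\<mu> \<in> ?T" if "?\<nu> \<in> ?S" "\<mu> \<notin> ?S"
    proof -
      have le: "bruhat_le n x \<sigma>" if "x \<in> C" "bruhat_le n x \<mu>" for x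
        using \<open>?\<nu> \<in> ?S\<close> bruhat_le_trans[OF that(2) \<mu>\<nu>] that(1) by (simp add: coset_top_def)
      then have nle: "\<not> bruhat_le n \<sigma> \<mu>" using \<open>\<mu> \<notin> ?S\<close> \<mu> by (auto simp: coset_top_def)
      have \<tau>\<mu>: "bruhat_le n ?\<tau> \<mu>"
        using down[OF _ assms(6)] \<open>?\<nu> \<in> ?S\<close> unfolding descent_up_down[of \<sigma>, OF \<sigma>(4)]
        by (simp add: coset_top_def)
      \<comment> \<open>This maximum lies between \<sigma> s_i and \<sigma>, whose lengths differ by
        one, and it is not \<sigma>; so it is \<sigma> s_i.\<close>
      obtain m where m: "m \<in> C" "bruhat_le n m \<mu>" "\<And>x. x \<in> C \<Longrightarrow> bruhat_le n x \<mu> \<Longrightarrow> bruhat_le n x m"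
        using max[OF \<mu> \<tau>C \<tau>\<mu>] by blast
      have "m \<noteq> \<sigma>" using m(2) nle by auto
      then have "coxeter_length n m < coxeter_length n \<sigma>"
        using bruhat_le_length[OF le[OF m(1,2)]] by auto
      then have "m = ?\<tau>"
        using bruhat_le_length[OF m(3)[OF \<tau>C \<tau>\<mu>]] len by auto
      then show ?thesis using m(3) \<tau>\<mu> \<mu> by (simp add: coset_top_def)
    qed
    have S': "?\<nu> \<in> ?S" if "\<mu> \<in> ?T"
    proof -
      have "bruhat_le n \<sigma> ?\<nu>"
        using that bruhat_le_up_down_right(1)[OF _ \<tau> \<sigma>(2,3), of \<mu>]
        unfolding coset_top_def ascent_up_down[of \<mu>, OF asc] descent_up_down[of \<sigma>, OF \<sigma>(4)] by blast
      moreover have "bruhat_le n \<rho> \<sigma>" if "\<rho> \<in> C" "bruhat_le n \<rho> ?\<nu>" for \<rho>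
        using below[of ?\<tau>, OF _ that] \<open>\<mu> \<in> ?T\<close> unfolding descent_up_down[of \<sigma>, OF \<sigma>(4)]
        by (simp add: coset_top_def)
      ultimately show ?thesis using \<nu> by (simp add: coset_top_def)
    qed
    show "of_bool (?\<nu> \<in> ?S) - of_bool (\<mu> \<in> ?S) + 0 * of_bool (\<mu> \<in> ?S) = (of_bool (\<mu> \<in> ?T) :: int)"
      using S not_T T S' by (cases "\<mu> \<in> ?S"; cases "?\<nu> \<in> ?S"; cases "\<mu> \<in> ?T") auto
  qed (auto simp: coset_top_def)
  then show ?thesis by simp
qed

section \<open>Coefficients of the sum\<close>

text \<open>Since \<omega>(\<omega>\<zeta>) = \<zeta> and \<zeta>(\<zeta>^{-1}\<sigma>) = \<sigma>,
  the two words lead from \<omega> to \<zeta> and from \<zeta> to \<sigma>. The change from all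
  transpositions to the label list takes place between them, at \<zeta>.\<close>

lemma E_sum_eq_operators:
  assumes "\<sigma> permutes {1..n}" "sorted_wrt (<) ks" "set ks \<subseteq> {1..<n}"
    and "reduced_word n (longest_perm n \<circ> zeta n \<sigma> ks) u"
    and "reduced_word n (inv (zeta n \<sigma> ks) \<circ> \<sigma>) v"
  shows "pi_word v (pi_hat_word u (frag_of (longest_perm n))) = E_sum n \<sigma> ks"
proof -
  let ?\<zeta> = "zeta n \<sigma> ks"
  note \<zeta> = zeta_properties[OF assms(1-3)]
  have u: "longest_perm n \<circ> (longest_perm n \<circ> ?\<zeta>) = ?\<zeta>"
    unfolding comp_assoc[symmetric] longest_perm_involutory by simp
  have v: "?\<zeta> \<circ> (inv ?\<zeta> \<circ> \<sigma>) = \<sigma>"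
    unfolding comp_assoc[symmetric] permutes_inv_o(1)[OF \<zeta>(1)] by simp
  have "sorted_wrt (<) (0 # ks)" "set ks \<subseteq> {..<n}" using assms(2,3) by auto
  then have "cover_ops (full_rows n 0 n) (frag_of ?\<zeta>) = cover_ops (chain_labels n 0 ks) (frag_of ?\<zeta>)"
    by (rule cover_ops_full_rows) (use \<zeta>(3) in auto)
  then have "pi_word v (pi_hat_word u (frag_of (longest_perm n))) =
      pi_word v (cover_ops (chain_labels n 0 ks) (frag_of ?\<zeta>))"
    unfolding pi_hat_word_longest[OF assms(4)] u by simp
  also have "\<dots> = cover_ops (chain_labels n 0 ks) (frag_of \<sigma>)"
    unfolding pi_word_chain_labels[OF assms(2,3) \<zeta>(1,3) assms(5) \<zeta>(2)] v ..
  also have "\<dots> = E_sum n \<sigma> ks" by (rule E_sum_eq[OF assms(1-3), symmetric])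
  finally show ?thesis .
qed

text \<open>The coefficients are traced along the operators, not along the chains. The set
  \<open>C\<close> is left existential because coefficients 1 and -1 and closure under intervals
  follow from this form whatever \<open>C\<close> is.\<close>

lemma signed_indicator_E_sum:
  assumes "\<sigma> permutes {1..n}" "sorted_wrt (<) ks" "set ks \<subseteq> {1..<n}"
  obtains C where "signed_indicator n \<sigma> (coset_top n C \<sigma>) (E_sum n \<sigma> ks)"
proof -
  let ?\<zeta> = "zeta n \<sigma> ks" and ?b = "block_index ks" and ?\<omega> = "frag_of (longest_perm n)"
  note \<zeta> = zeta_properties[OF assms]
  note young = young_subgroup_iff[OF assms(2,3)]
  \<comment> \<open>The coset of \<sigma>, described by the block in which \<zeta> places each
    value.\<close>
  define C where "C = block_coset n ?b (?b \<circ> inv ?\<zeta>)"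
  have C_perm: "\<rho> permutes {1..n}" if "\<rho> \<in> C" for \<rho> using that by (simp add: C_def block_coset_def)
  have C_mem: "?\<zeta> \<circ> y \<in> C" if "y \<in> young_subgroup n ks" for y
    using that young \<zeta>(1) permutes_inverses(2)[OF \<zeta>(1)]
    by (auto simp: C_def block_coset_def intro: permutes_compose)
  have C_iff: "\<rho> \<in> C \<longleftrightarrow> \<rho> permutes {1..n} \<and> inv ?\<zeta> \<circ> \<rho> \<in> young_subgroup n ks" for \<rho>
    using young permutes_compose[of \<rho> "{1..n}" "inv ?\<zeta>"] permutes_inv[OF \<zeta>(1)]
    by (auto simp: C_def block_coset_def)
  have C_adj: "\<rho> \<circ> transpose i (i + 1) \<in> C" if "\<rho> \<in> C" "1 \<le> i" "i < n" "i \<notin> set ks" for \<rho> i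
    using that young_subgroup_adjacent[OF assms(2,3) _ that(2-4)] permutes_comp_adjacent_iff[OF that(2,3)]
    unfolding C_iff comp_assoc[symmetric] by blast
  have C_le: "bruhat_le n \<rho> ?\<zeta>" if "\<rho> \<in> C" for \<rho>
  proof -
    have "?\<zeta> \<circ> (inv ?\<zeta> \<circ> \<rho>) = \<rho>"
      unfolding comp_assoc[symmetric] permutes_inv_o(1)[OF \<zeta>(1)] by simp
    then show ?thesis
      using young_coset_le_max[OF assms(2,3) \<zeta>(1,3), of "inv ?\<zeta> \<circ> \<rho>"] that C_iff by simp
  qed
  have C_max: "\<exists>m\<in>C. bruhat_le n m \<mu> \<and> (\<forall>x\<in>C. bruhat_le n x \<mu> \<longrightarrow> bruhat_le n x m)"
    if "\<mu> permutes {1..n}" "y \<in> C" "bruhat_le n y \<mu>" for \<mu> y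
    using block_coset_max[OF mono_block_index that(1)] that(2,3) unfolding C_def by blast
  have "longest_perm n \<circ> ?\<zeta> permutes {1..n}"
    using \<zeta>(1) longest_perm_permutes by (rule permutes_compose)
  then obtain u where u: "reduced_word n (longest_perm n \<circ> ?\<zeta>) u" using reduced_word_exists by blast
  have "inv ?\<zeta> \<circ> \<sigma> permutes {1..n}" using \<zeta>(2) young by blast
  then obtain v where v: "reduced_word n (inv ?\<zeta> \<circ> \<sigma>) v" using reduced_word_exists by blast
  have \<omega>\<zeta>: "longest_perm n \<circ> (longest_perm n \<circ> ?\<zeta>) = ?\<zeta>"
    unfolding comp_assoc[symmetric] longest_perm_involutory by simp
  \<comment> \<open>All of the coset lies below \<zeta>, so the maximality condition is automatic at
    the start of the induction.\<close>
  have "upper_set n ?\<zeta> = coset_top n C ?\<zeta>"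
    using C_le by (auto simp: upper_set_def coset_top_def)
  then have base: "signed_indicator n ?\<zeta> (coset_top n C ?\<zeta>) (pi_hat_word u ?\<omega>)"
    using signed_indicator_pi_hat_word[OF u] unfolding \<omega>\<zeta> by simp
  have "signed_indicator n (?\<zeta> \<circ> y) (coset_top n C (?\<zeta> \<circ> y)) (pi_word v (pi_hat_word u ?\<omega>))"
    if "reduced_word n y v" "y \<in> young_subgroup n ks" for y v
    using that
  proof (induction v arbitrary: y rule: rev_induct)
    case Nil
    then have "y = id" by (simp add: reduced_word_def simple_prod_Nil)
    then show ?case using base by (simp add: pi_word_def)
  next
    case (snoc i w)
    let ?z = "simple_prod w"
    note z = reduced_word_snoc[OF snoc.prems(1)]
    note Y = young_reduced_word_snoc[OF assms(2,3) \<zeta>(1,3) snoc.prems]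
    have zC: "?\<zeta> \<circ> ?z \<in> C" using C_mem Y(2) .
    have "signed_indicator n (?\<zeta> \<circ> ?z \<circ> transpose i (i + 1)) (coset_top n C (?\<zeta> \<circ> ?z \<circ> transpose i (i + 1)))
        (pi_op i (pi_word w (pi_hat_word u ?\<omega>)))"
    proof (rule signed_indicator_coset_step[OF snoc.IH[OF z(1) Y(2)] C_perm[OF zC] z(2,3) Y(3) zC])
      show "\<rho> permutes {1..n}" if "\<rho> \<in> C" for \<rho> using C_perm[OF that] .
      show "\<rho> \<circ> transpose i (i + 1) \<in> C" if "\<rho> \<in> C" for \<rho> using C_adj[OF that z(2,3) Y(1)] .
      show "\<exists>m\<in>C. bruhat_le n m \<mu> \<and> (\<forall>x\<in>C. bruhat_le n x \<mu> \<longrightarrow> bruhat_le n x m)"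
        if "\<mu> permutes {1..n}" "y \<in> C" "bruhat_le n y \<mu>" for \<mu> y using C_max[OF that] .
    qed
    then show ?case unfolding z(5) pi_word_snoc comp_assoc .
  qed
  from this[OF v \<zeta>(2)] have "signed_indicator n (?\<zeta> \<circ> (inv ?\<zeta> \<circ> \<sigma>)) (coset_top n C (?\<zeta> \<circ> (inv ?\<zeta> \<circ> \<sigma>))) (E_sum n \<sigma> ks)"
    unfolding E_sum_eq_operators[OF assms u v] .
  moreover have "?\<zeta> \<circ> (inv ?\<zeta> \<circ> \<sigma>) = \<sigma>"
    unfolding comp_assoc[symmetric] permutes_inv_o(1)[OF \<zeta>(1)] by simp
  ultimately show ?thesis using that by simp
qed

lemma valid_chain_length:
  assumes "valid_chain n \<sigma> w"
  shows "coxeter_length n (\<sigma> \<circ> transp_prod w) = coxeter_length n \<sigma> + length w"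
proof (cases "w = []")
  case False
  then have "length w \<in> {1..length w}" by (simp add: Suc_le_eq)
  then show ?thesis using assms unfolding valid_chain_def by (metis take_all order_refl)
qed (simp add: transp_prod_Nil)

text \<open>All chains from \<open>\<sigma>\<close> to \<open>\<mu>\<close> carry the same sign, so a coefficient \<open>\<plusminus>1\<close> forces
  the chain to be unique.\<close>

lemma lookup_E_sum:
  "Poly_Mapping.lookup (E_sum n \<sigma> ks) \<mu> =
    int (card {w \<in> valid_chains n \<sigma> ks. \<sigma> \<circ> transp_prod w = \<mu>}) * (-1) ^ (coxeter_length n \<sigma> + coxeter_length n \<mu>)"
proof -
  let ?V = "valid_chains n \<sigma> ks" and ?e = "(-1) ^ (coxeter_length n \<sigma> + coxeter_length n \<mu>) :: int"
  have fin: "finite ?V"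
    by (rule finite_subset[OF _ finite_subseq[of "W_list n ks"]]) (auto simp: valid_chains_def)
  have "Poly_Mapping.lookup (chain_term \<sigma> w) \<mu> = of_bool (\<sigma> \<circ> transp_prod w = \<mu>) * ?e" if "w \<in> ?V" for w
  proof (cases "\<sigma> \<circ> transp_prod w = \<mu>")
    case True
    have "coxeter_length n \<mu> = coxeter_length n \<sigma> + length w"
      using valid_chain_length[of n \<sigma> w] that unfolding True by (simp add: valid_chains_def)
    then show ?thesis using True by (simp add: chain_term_def power_add)
  next
    case False
    then show ?thesis by (auto simp: chain_term_def)
  qed
  then have "Poly_Mapping.lookup (E_sum n \<sigma> ks) \<mu> = (\<Sum>w\<in>?V. of_bool (\<sigma> \<circ> transp_prod w = \<mu>) * ?e)"
    unfolding E_sum_def lookup_sum by (rule sum.cong[OF refl])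
  also have "\<dots> = (\<Sum>w\<in>?V. of_bool (\<sigma> \<circ> transp_prod w = \<mu>)) * ?e" by (simp only: sum_distrib_right)
  also have "(\<Sum>w\<in>?V. of_bool (\<sigma> \<circ> transp_prod w = \<mu>)) = int (card {w \<in> ?V. \<sigma> \<circ> transp_prod w = \<mu>})"
    using fin by (simp add: of_bool_def sum.If_cases Int_def)
  finally show ?thesis .
qed

text \<open>The operators attached to a permutation are represented by arbitrary reduced words, so
  the identity covers every choice of reduced decompositions. Cancellation freeness is expressed on
  the chain terms themselves, before equal basis vectors are collected.\<close>

theorem proposition6p2:
  fixes n :: nat and \<sigma> :: "nat \<Rightarrow> nat" and ks :: "nat list"
  assumes "\<sigma> permutes {1..n}"
    and "sorted_wrt (<) ks" and "set ks \<subseteq> {1..<n}"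
  shows "(\<forall>u v. reduced_word n (longest_perm n \<circ> zeta n \<sigma> ks) u \<longrightarrow>
                reduced_word n (inv (zeta n \<sigma> ks) \<circ> \<sigma>) v \<longrightarrow>
                pi_word v (pi_hat_word u (frag_of (longest_perm n))) = E_sum n \<sigma> ks)
       \<and> (\<forall>w \<in> valid_chains n \<sigma> ks. \<forall>w' \<in> valid_chains n \<sigma> ks. chain_term \<sigma> w + chain_term \<sigma> w' \<noteq> 0)
       \<and> inj_on (\<lambda>w. \<sigma> \<circ> transp_prod w) (valid_chains n \<sigma> ks)
       \<and> (\<forall>\<mu> \<in> Poly_Mapping.keys (E_sum n \<sigma> ks).
            Poly_Mapping.lookup (E_sum n \<sigma> ks) \<mu> \<in> {1, -1})
       \<and> (\<forall>\<mu> \<nu>. \<mu> \<in> Poly_Mapping.keys (E_sum n \<sigma> ks) \<longrightarrow>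
                 bruhat_le n \<sigma> \<nu> \<longrightarrow> bruhat_le n \<nu> \<mu> \<longrightarrow>
                 \<nu> \<in> Poly_Mapping.keys (E_sum n \<sigma> ks))"
proof -
  let ?E = "E_sum n \<sigma> ks" and ?V = "valid_chains n \<sigma> ks"
  obtain C where "signed_indicator n \<sigma> (coset_top n C \<sigma>) ?E"
    using signed_indicator_E_sum[OF assms] .
  then have look: "Poly_Mapping.lookup ?E \<mu> =
      (if \<mu> \<in> coset_top n C \<sigma> then (-1) ^ (coxeter_length n \<sigma> + coxeter_length n \<mu>) else 0)" for \<mu>
    by (simp add: signed_indicator_def)
  have keys: "Poly_Mapping.keys ?E = coset_top n C \<sigma>"
    by (auto simp: in_keys_iff look split: if_splits)
  have sign: "(-1) ^ k \<in> {1, -1 :: int}" for k by (induction k) auto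
  have inj: "inj_on (\<lambda>w. \<sigma> \<circ> transp_prod w) ?V"
  proof (rule inj_onI)
    fix w w' assume w: "w \<in> ?V" "w' \<in> ?V" and eq: "\<sigma> \<circ> transp_prod w = \<sigma> \<circ> transp_prod w'"
    let ?F = "{v \<in> ?V. \<sigma> \<circ> transp_prod v = \<sigma> \<circ> transp_prod w'}"
    have "finite ?F"
      by (rule finite_subset[OF _ finite_subseq[of "W_list n ks"]]) (auto simp: valid_chains_def)
    moreover have "card ?F \<le> 1"
    proof -
      have "\<bar>int (card ?F)\<bar> = \<bar>Poly_Mapping.lookup ?E (\<sigma> \<circ> transp_prod w')\<bar>"
        unfolding lookup_E_sum by (simp add: abs_mult power_abs)
      also have "\<dots> \<le> 1" unfolding look by (simp add: power_abs)
      finally show ?thesis by simp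
    qed
    ultimately show "w = w'" using w eq by (auto simp: card_le_Suc0_iff_eq)
  qed
  have "chain_term \<sigma> w + chain_term \<sigma> w' \<noteq> 0" if "w \<in> ?V" "w' \<in> ?V" for w w'
  proof
    assume "chain_term \<sigma> w + chain_term \<sigma> w' = 0"
    then have "Poly_Mapping.lookup (chain_term \<sigma> w) (\<sigma> \<circ> transp_prod w)
        + Poly_Mapping.lookup (chain_term \<sigma> w') (\<sigma> \<circ> transp_prod w) = 0"
      by (metis lookup_add lookup_zero)
    \<comment> \<open>If both terms involve the same permutation, injectivity makes them the same
      term and its coefficient is doubled; otherwise a single coefficient 1 or -1 remains.\<close>
    then show False
      using inj_onD[OF inj _ that(2,1)] sign[of "length w"]
      by (auto simp: chain_term_def split: if_splits)
  qed
  moreover have "Poly_Mapping.lookup ?E \<mu> \<in> {1, -1}" if "\<mu> \<in> Poly_Mapping.keys ?E" for \<mu>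
    using that sign unfolding keys look by simp
  moreover have "\<nu> \<in> Poly_Mapping.keys ?E"
    if "\<mu> \<in> Poly_Mapping.keys ?E" "bruhat_le n \<sigma> \<nu>" "bruhat_le n \<nu> \<mu>" for \<mu> \<nu>
    using that coset_top_interval_closed[OF _ that(2,3) assms(1)] unfolding keys by blast
  ultimately show ?thesis using inj E_sum_eq_operators[OF assms] by blast
qed

end
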